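(* Let $\alpha,\kappa>0$. Let $p\in\mathcal{P}^{\log}(\mathbb{R}^n)$ and $r\in\mathcal{P}(\mathbb{R}^n)$ be such that either $r^+\le p^+=p_\infty<\infty$ or $p^+=p_\infty=\infty$. Then there is a constant $C>0$ such that for every $t>0$ and every $\varphi\in L^{r(\cdot)}(\mathbb{R}^n)$: (1) $\displaystyle\|g_{\alpha,t}*\varphi\|_{L^{p(\cdot)}(\mathbb{R}^n)}\le C\,t^{-\frac{n\sigma(t)}{2\alpha}}\|\varphi\|_{L^{r(\cdot)}(\mathbb{R}^n)}$; (2) $\displaystyle\|(-\Delta)^{\kappa/2}g_{\alpha,t}*\varphi\|_{L^{p(\cdot)}(\mathbb{R}^n)}\le C\,t^{-\frac{\kappa}{2\alpha}-\frac{n\sigma(t)}{2\alpha}}\|\varphi\|_{L^{r(\cdot)}(\mathbb{R}^n)}$; where $$\sigma(t)=\begin{cases}\left(\frac1{r^-}-\frac1{p_\infty}\right)\left(1+\frac1{p_\infty}\,\frac{\frac1{r^-}-\frac1{r^+}}{\left(1+\frac1{p_\infty}-\frac1{r^-}\right)\left(1+\frac1{p_\infty}-\frac1{r^+}\right)}\right), & 0<t\le1,\\[8pt] \left(\frac1{r^+}-\frac1{p_\infty}\right)\left(1-\frac1{p_\infty}\,\frac{\frac1{r^-}-\frac1{r^+}}{\left(1+\frac1{p_\infty}-\frac1{r^-}\right)\left(1+\frac1{p_\infty}-\frac1{r^+}\right)}\right), & t>1,\end{cases}$$ with $\frac1\infty=0$ (so that for $p_\infty=\infty$ the second bracket is read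 as $1$).
   Context: $g_{\alpha,t}=\mathcal{F}^{-1}[e^{-t|\xi|^{2\alpha}}]$ is the fractional heat kernel on $\mathbb{R}^n$, so that $g_{\alpha,t}*\varphi=e^{-t(-\Delta)^\alpha}\varphi$ (the multiplicative normalisation of the Fourier transform only affects constants); $(-\Delta)^{\kappa/2}$ is the Fourier multiplier with symbol $|\xi|^\kappa$. $\mathcal{P}(\mathbb{R}^n)$ is the set of measurable functions $p:\mathbb{R}^n\to[1,\infty]$; $p^-$ and $p^+$ are the essential infimum and supremum of $p$. The modular is $\varrho_{p(\cdot)}(f)=\int_{\mathbb{R}^n}\omega_{p(x)}(|f(x)|)\,dx$, with $\omega_p(t)=t^p$ if $p<\infty$, and $\omega_\infty(t)=0$ for $t\le1$, $\omega_\infty(t)=\infty$ for $t>1$. $L^{p(\cdot)}(\mathbb{R}^n)$ is the space of measurable $f$ with $\varrho_{p(\cdot)}(\lambda f)<\infty$ for some $\lambda>0$, normed by $\|f\|_{L^{p(\cdot)}}=\inf\{\lambda>0:\varrho_{p(\cdot)}(f/\lambda)\le1\}$. A real function $g$ on $\mathbb{R}^n$ is globally log-Hölder continuous if there are $c>0$ and $g_\infty\in\mathbb{R}$ with $|g(x)-g(y)|\le \frac{c}{\log(e+1/|x-y|)}$ and $|g(x)-g_\infty|\le\frac{c}{\log(e+|x|)}$ for all $x,y$. $\mathcal{P}^{\log}(\mathbb{R}^n)$ is the set of $p\in\mathcal{P}(\mathbb{R}^n)$ with $1/p$ globally log-Hölder continuous, and $p_\infty\in[1,\infty]$ is defined by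 $\frac1{p_\infty}=\lim_{|x|\to\infty}\frac1{p(x)}$. *)

theory Defs
  imports "HOL-Analysis.Analysis" "HOL-Probability.Essential_Supremum"
begin

text \<open>The space $\mathbb{R}^n$ is an arbitrary Euclidean space \<open>'a\<close>, with \<open>n = DIM('a)\<close>.
  Functions are complex valued; measurability and integrals refer to Lebesgue measure.\<close>

section \<open>The fractional heat kernel\<close>

definition fourier :: "('a::euclidean_space \<Rightarrow> complex) \<Rightarrow> 'a \<Rightarrow> complex" where
  "fourier f \<xi> = (\<integral>x. cis (- (x \<bullet> \<xi>)) * f x \<partial>lebesgue)"

text \<open>This normalisation makes convolution with \<open>inv_fourier m\<close> the Fourier multiplier
  with symbol \<open>m\<close>.\<close>

definition inv_fourier :: "('a::euclidean_space \<Rightarrow> complex) \<Rightarrow> 'a \<Rightarrow> complex" where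
  "inv_fourier m x = (\<integral>\<xi>. cis (x \<bullet> \<xi>) * m \<xi> \<partial>lebesgue) / of_real ((2 * pi) ^ DIM('a))"

definition fourier_multiplier ::
    "('a::euclidean_space \<Rightarrow> complex) \<Rightarrow> ('a \<Rightarrow> complex) \<Rightarrow> 'a \<Rightarrow> complex" where
  "fourier_multiplier m f = inv_fourier (\<lambda>\<xi>. m \<xi> * fourier f \<xi>)"

text \<open>\<open>frac_laplacian s\<close> is $(-\Delta)^s$, with symbol $|\xi|^{2s}$. It is only applied to the
  heat kernel, which is integrable with an integrable Fourier transform.\<close>

definition frac_laplacian :: "real \<Rightarrow> ('a::euclidean_space \<Rightarrow> complex) \<Rightarrow> 'a \<Rightarrow> complex" where
  "frac_laplacian s = fourier_multiplier (\<lambda>\<xi>. of_real (norm \<xi> powr (2 * s)))"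

definition heat_kernel :: "real \<Rightarrow> real \<Rightarrow> 'a::euclidean_space \<Rightarrow> complex" where
  "heat_kernel \<alpha> t = inv_fourier (\<lambda>\<xi>. of_real (exp (- t * norm \<xi> powr (2 * \<alpha>))))"

definition convol ::
    "('a::euclidean_space \<Rightarrow> complex) \<Rightarrow> ('a \<Rightarrow> complex) \<Rightarrow> 'a \<Rightarrow> complex" (infixl \<open>\<ast>\<close> 70) where
  "(f \<ast> g) x = (\<integral>y. f (x - y) * g y \<partial>lebesgue)"

section \<open>Variable exponents\<close>

text \<open>In \<^typ>\<open>ennreal\<close> the inverse of \<open>0\<close> is \<open>\<infinity>\<close> and conversely, so \<open>inverse\<close> implements
  $1/\infty = 0$.\<close>

abbreviation recip :: "ennreal \<Rightarrow> real" where
  "recip q \<equiv> enn2real (inverse q)"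

definition exponents :: "('a::euclidean_space \<Rightarrow> ennreal) set" where
  "exponents = {p \<in> borel_measurable lebesgue. \<forall>x. 1 \<le> p x}"

definition exp_minus :: "('a::euclidean_space \<Rightarrow> ennreal) \<Rightarrow> ennreal" where
  "exp_minus p = Sup {c. AE x in lebesgue. c \<le> p x}"

definition exp_plus :: "('a::euclidean_space \<Rightarrow> ennreal) \<Rightarrow> ennreal" where
  "exp_plus p = esssup lebesgue p"

text \<open>For \<open>x = y\<close> the first inequality holds trivially, since both \<open>1 / 0 = 0\<close> and the left-hand
  side vanishes.\<close>

definition globally_log_holder :: "('a::euclidean_space \<Rightarrow> real) \<Rightarrow> bool" where
  "globally_log_holder g \<longleftrightarrow> (\<exists>c>0. \<exists>g_inf.
     (\<forall>x y. \<bar>g x - g y\<bar> \<le> c / ln (exp 1 + 1 / norm (x - y))) \<and>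
     (\<forall>x. \<bar>g x - g_inf\<bar> \<le> c / ln (exp 1 + norm x)))"

definition log_exponents :: "('a::euclidean_space \<Rightarrow> ennreal) set" where
  "log_exponents = {p \<in> exponents. globally_log_holder (\<lambda>x. recip (p x))}"

definition exp_infty :: "('a::euclidean_space \<Rightarrow> ennreal) \<Rightarrow> ennreal" where
  "exp_infty p = inverse (Lim at_infinity (\<lambda>x. inverse (p x)))"

section \<open>Variable Lebesgue spaces\<close>

definition \<omega> :: "ennreal \<Rightarrow> real \<Rightarrow> ennreal" where
  "\<omega> p t = (if p = \<infinity> then (if t \<le> 1 then 0 else \<infinity>) else ennreal (t powr enn2real p))"

definition modular :: "('a::euclidean_space \<Rightarrow> ennreal) \<Rightarrow> ('a \<Rightarrow> complex) \<Rightarrow> ennreal" where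
  "modular p f = (\<integral>\<^sup>+x. \<omega> (p x) (norm (f x)) \<partial>lebesgue)"

definition var_Lp :: "('a::euclidean_space \<Rightarrow> ennreal) \<Rightarrow> ('a \<Rightarrow> complex) set" where
  "var_Lp p = {f \<in> borel_measurable lebesgue. \<exists>l>0. modular p (\<lambda>x. of_real l * f x) < \<infinity>}"

definition var_norm :: "('a::euclidean_space \<Rightarrow> ennreal) \<Rightarrow> ('a \<Rightarrow> complex) \<Rightarrow> ennreal" where
  "var_norm p f = (INF l\<in>{l::real. l > 0 \<and> modular p (\<lambda>x. f x / of_real l) \<le> 1}. ennreal l)"

section \<open>The decay exponent\<close>

text \<open>Here \<open>a\<close>, \<open>b\<close>, \<open>c\<close> are $1/r^-$, $1/r^+$, $1/p_\infty$. If \<open>c = 0\<close>, then the quotient is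
  multiplied by \<open>c\<close> and the second bracket is \<open>1\<close>, also when a denominator vanishes.\<close>

definition decay_exponent ::
    "('a::euclidean_space \<Rightarrow> ennreal) \<Rightarrow> ('a \<Rightarrow> ennreal) \<Rightarrow> real \<Rightarrow> real" where
  "decay_exponent p r t =
    (let a = recip (exp_minus r); b = recip (exp_plus r); c = recip (exp_infty p) in
     if t \<le> 1 then (a - c) * (1 + c * ((a - b) / ((1 + c - a) * (1 + c - b))))
     else (b - c) * (1 - c * ((a - b) / ((1 + c - a) * (1 + c - b)))))"

end

theory Submission
  imports Defs "HOL-Probability.Probability" "HOL-Real_Asymp.Real_Asymp"
begin

text \<open>Split a function \<open>\<phi>\<close> with modular at most \<open>1\<close> into its parts where \<open>|\<phi>| > 1\<close> and \<open>|\<phi>| \<le> 1\<close>; they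
  belong to the unit balls of $L^{r^-}$ and $L^{r^+}$. Convolution with a kernel \<open>k\<close> such that
  \<open>\<parallel>k\<parallel>\<^sub>1 \<le> 1\<close> and \<open>|k| \<le> S\<close> maps \<open>L\<^sup>q\<close> to \<open>L\<^sup>P\<close>, \<open>q \<le> P\<close>, with norm at most \<open>S\<close> to the power
  \<open>1/q - 1/P\<close>. For \<open>P = p\<^sub>\<infinity> = p\<^sup>+\<close> the logarithmic decay of \<open>1/p - 1/P\<close> gives an embedding of \<open>L\<^sup>P\<close>
  into \<open>L\<close> with exponent \<open>p(\<cdot>)\<close>. This yields the exponents $1/r^- - 1/p_\infty$ for \<open>t \<le> 1\<close> and
  $1/r^+ - 1/p_\infty$ for \<open>t > 1\<close>, which are at least as good as \<open>\<sigma>(t)\<close>.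

  The kernels have symbols \<open>F(|\<xi>|\<^sup>2)\<close> with \<open>F(s)\<close> the product of $s^{\kappa/2}$ and $e^{-s^\alpha}$ after
  scaling. They are integrable for all \<open>\<alpha> > 0\<close>, since by Taylor's formula at infinity \<open>F(|\<xi>|\<^sup>2)\<close>
  is a superposition of Bochner--Riesz symbols \<open>(s - |\<xi>|\<^sup>2)\<^sub>+\<^sup>m\<close>, whose transforms, normalised by
  \<open>s\<^sup>m\<close>, have an \<open>L\<^sup>1\<close> norm independent of \<open>s\<close>.\<close>

section \<open>Dilations and a polynomially decaying weight\<close>

text \<open>The obstacle is the origin: for small \<open>\<alpha>\<close> or \<open>\<kappa>\<close>
  the symbol \<open>|xi|^\<kappa> exp (-|xi|^(2\<alpha>))\<close> is not smooth enough at
  \<open>0\<close> to be integrated by parts often enough for integrable decay in \<open>x\<close>.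
  The superposition moves this singularity into a weight in the single variable \<open>s\<close>,
  where only the integrability of \<open>s^m F^(m+1)(s)\<close> matters, while the Bochner--Riesz
  symbols are as smooth as desired for large \<open>m\<close>. The recurring exponent
  \<open>2n\<close> is chosen because \<open>(1 + |x|)^(-2n)\<close> is integrable; this one weight
  controls the transforms, the symbols and the error term of the embedding. Integrability of the
  kernel is needed a second time: \<open>frac_laplacian\<close> multiplies the Fourier transform of
  a kernel that is itself given as an inverse transform, so Fourier inversion for an integrable
  kernel is required. The condition \<open>p^+ = p_\<infinity>\<close> gives
  \<open>p(x) \<le> P\<close> almost everywhere, so the embedding goes from the largest exponent
  downwards and costs a constant independent of \<open>t\<close>.\<close>

lemma nn_integral_weight_finite:
  "(\<integral>\<^sup>+x. ennreal (inverse ((1 + norm x) ^ (2 * DIM('a)))) \<partial>(lborel :: 'a::euclidean_space measure)) < \<infinity>"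
proof -
  let ?f = "\<lambda>u::real. inverse ((1 + \<bar>u\<bar>) ^ 2)"
  \<comment> \<open>The exponent \<open>2n\<close> supplies one factor of exponent 2 for each
    coordinate, and the right-hand side is a product of integrable functions of one
    variable.\<close>
  have le: "inverse ((1 + norm x) ^ (2 * DIM('a))) \<le> (\<Prod>b\<in>Basis. ?f (x \<bullet> b))" for x :: 'a
  proof -
    have "(\<Prod>b\<in>(Basis::'a set). (1 + \<bar>x \<bullet> b\<bar>)\<^sup>2) \<le> (\<Prod>b\<in>(Basis::'a set). (1 + norm x)\<^sup>2)"
      by (intro prod_mono conjI power_mono add_left_mono) (auto simp: Basis_le_norm)
    also have "\<dots> = (1 + norm x) ^ (2 * DIM('a))"
      by (simp add: power_mult)
    finally have *: "(\<Prod>b\<in>(Basis::'a set). (1 + \<bar>x \<bullet> b\<bar>)\<^sup>2) \<le> (1 + norm x) ^ (2 * DIM('a))" .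
    have "0 < 1 + \<bar>x \<bullet> b\<bar>" for b
      by (simp add: add_pos_nonneg)
    with * have "inverse ((1 + norm x) ^ (2 * DIM('a))) \<le> inverse (\<Prod>b\<in>(Basis::'a set). (1 + \<bar>x \<bullet> b\<bar>)\<^sup>2)"
      by (intro le_imp_inverse_le prod_pos zero_less_power)
    also have "\<dots> = (\<Prod>b\<in>(Basis::'a set). ?f (x \<bullet> b))"
      by (simp add: prod_inversef[unfolded o_def])
    finally show ?thesis .
  qed
  have fin: "(\<integral>\<^sup>+u. ennreal (?f u) \<partial>lborel) < \<infinity>"
  proof -
    have 0: "(\<integral>\<^sup>+u. ennreal (?f u) * indicator {0..} u \<partial>lborel) = ennreal (0 - (- inverse (1 + 0)))"
    proof (rule nn_integral_FTC_atLeast[where F="\<lambda>u. - inverse (1 + u)"])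
      show "((\<lambda>u::real. - inverse (1 + u)) \<longlongrightarrow> 0) at_top"
        by real_asymp
    qed (auto intro!: derivative_eq_intros simp: power2_eq_square divide_simps)
    let ?g = "\<lambda>u::real. ennreal (?f u) * indicator {0..} u"
    have 1: "(\<integral>\<^sup>+u. ?g u \<partial>lborel) = (\<integral>\<^sup>+u. ?g (- u) \<partial>lborel)"
      using nn_integral_real_affine[of ?g "-1" 0] by simp
    have "(\<integral>\<^sup>+u. ennreal (?f u) \<partial>lborel) \<le> (\<integral>\<^sup>+u. ?g u + ?g (- u) \<partial>lborel)"
      by (intro nn_integral_mono) (auto split: split_indicator)
    also have "\<dots> = (\<integral>\<^sup>+u. ?g u \<partial>lborel) + (\<integral>\<^sup>+u. ?g (-u) \<partial>lborel)"
      by (rule nn_integral_add) auto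
    also have "\<dots> < \<infinity>"
      unfolding 1[symmetric] 0 by simp
    finally show ?thesis .
  qed
  have "(\<integral>\<^sup>+x. ennreal (inverse ((1 + norm x) ^ (2 * DIM('a)))) \<partial>(lborel :: 'a measure))
     \<le> (\<integral>\<^sup>+x. (\<Prod>b\<in>Basis. ennreal (?f (x \<bullet> b))) \<partial>(lborel :: 'a measure))"
    by (intro nn_integral_mono) (simp only: prod_ennreal le ennreal_leI inverse_nonnegative_iff_nonnegative zero_le_power2)
  also have "\<dots> = (\<Prod>b\<in>(Basis::'a set). (\<integral>\<^sup>+u. ennreal (?f u) \<partial>lborel))"
    by (rule nn_integral_lborel_prod) auto
  also have "\<dots> < \<infinity>"
    using fin by (simp add: power_less_top_ennreal)
  finally show ?thesis .
qed

lemma lborel_integral_scaleR: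
  fixes f :: "'a::euclidean_space \<Rightarrow> 'b::{banach, second_countable_topology}"
  assumes [measurable]: "f \<in> borel_measurable borel" and "c > 0"
  shows "(\<integral>x. f (c *\<^sub>R x) \<partial>lborel) = inverse (c ^ DIM('a)) *\<^sub>R (\<integral>x. f x \<partial>lborel)"
proof -
  have "(\<integral>x. f x \<partial>lborel) = (\<integral>x. f x \<partial>density (distr lborel borel (\<lambda>x. 0 + c *\<^sub>R x)) (\<lambda>_. ennreal (\<bar>c\<bar>^DIM('a))))"
    using assms by (subst lborel_affine[of c 0]) auto
  also have "\<dots> = (\<integral>x. \<bar>c\<bar>^DIM('a) *\<^sub>R f x \<partial>distr lborel borel (\<lambda>x. 0 + c *\<^sub>R x))"
    by (rule integral_density) auto
  also have "\<dots> = (\<integral>x. \<bar>c\<bar>^DIM('a) *\<^sub>R f (0 + c *\<^sub>R x) \<partial>lborel)"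
    by (rule integral_distr) auto
  finally show ?thesis
    using assms by (simp add: field_simps)
qed

lemma lborel_nn_integral_scaleR:
  fixes f :: "'a::euclidean_space \<Rightarrow> ennreal"
  assumes [measurable]: "f \<in> borel_measurable borel" and "c > 0"
  shows "(\<integral>\<^sup>+x. f x \<partial>lborel) = ennreal (c ^ DIM('a)) * (\<integral>\<^sup>+x. f (c *\<^sub>R x) \<partial>lborel)"
proof -
  have "(\<integral>\<^sup>+x. f x \<partial>lborel) = (\<integral>\<^sup>+x. f x \<partial>density (distr lborel borel (\<lambda>x. 0 + c *\<^sub>R x)) (\<lambda>_. ennreal (\<bar>c\<bar>^DIM('a))))"
    using assms by (subst lborel_affine[of c 0]) auto
  also have "\<dots> = (\<integral>\<^sup>+x. ennreal (\<bar>c\<bar>^DIM('a)) * f x \<partial>distr lborel borel (\<lambda>x. 0 + c *\<^sub>R x))"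
    by (rule nn_integral_density) auto
  also have "\<dots> = (\<integral>\<^sup>+x. ennreal (\<bar>c\<bar>^DIM('a)) * f (0 + c *\<^sub>R x) \<partial>lborel)"
    by (rule nn_integral_distr) auto
  also have "\<dots> = ennreal (c ^ DIM('a)) * (\<integral>\<^sup>+x. f (c *\<^sub>R x) \<partial>lborel)"
    using assms by (subst nn_integral_cmult) auto
  finally show ?thesis .
qed

lemma lborel_integral_translate:
  fixes f :: "'a::euclidean_space \<Rightarrow> 'b::{banach, second_countable_topology}"
  assumes [measurable]: "f \<in> borel_measurable borel"
  shows "(\<integral>x. f (a + x) \<partial>lborel) = (\<integral>x. f x \<partial>lborel)"
proof -
  have "(\<integral>x. f x \<partial>lborel) = (\<integral>x. f x \<partial>distr lborel borel ((+) a))"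
    by (simp add: lborel_distr_plus)
  also have "\<dots> = (\<integral>x. f (a + x) \<partial>lborel)"
    by (rule integral_distr) auto
  finally show ?thesis ..
qed

lemma lborel_nn_integral_translate:
  fixes f :: "'a::euclidean_space \<Rightarrow> ennreal"
  assumes [measurable]: "f \<in> borel_measurable borel"
  shows "(\<integral>\<^sup>+x. f (a + x) \<partial>lborel) = (\<integral>\<^sup>+x. f x \<partial>lborel)"
proof -
  have "(\<integral>\<^sup>+x. f x \<partial>lborel) = (\<integral>\<^sup>+x. f x \<partial>distr lborel borel ((+) a))"
    by (simp add: lborel_distr_plus)
  also have "\<dots> = (\<integral>\<^sup>+x. f (a + x) \<partial>lborel)"
    by (rule nn_integral_distr) auto
  finally show ?thesis ..
qed

section \<open>Fourier integrals of directional derivatives\<close>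

lemma cis_measurable [measurable]: "cis \<in> borel_measurable borel"
  by (intro borel_measurable_continuous_onI continuous_intros)

text \<open>Integration by parts along a single direction. Translation invariance moves the
  difference quotient of \<open>h\<close> onto the character, where it becomes a scalar factor;
  dominated convergence then lets the step tend to \<open>0\<close>.\<close>

lemma integral_cis_directional_deriv:
  fixes h h' :: "'a::euclidean_space \<Rightarrow> real"
  assumes h [measurable]: "h \<in> borel_measurable borel"
    and supp: "\<And>\<xi>. norm \<xi> > R \<Longrightarrow> h \<xi> = 0"
    and b: "norm b \<le> 1"
    and deriv: "\<And>\<xi> s. ((\<lambda>s. h (\<xi> + s *\<^sub>R b)) has_real_derivative h' (\<xi> + s *\<^sub>R b)) (at s)"
    and bound: "\<And>\<xi>. \<bar>h' \<xi>\<bar> \<le> L" and hbound: "\<And>\<xi>. \<bar>h \<xi>\<bar> \<le> L"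
  shows "(\<integral>\<xi>. cis (x \<bullet> \<xi>) * h' \<xi> \<partial>lborel) = - \<i> * (x \<bullet> b) * (\<integral>\<xi>. cis (x \<bullet> \<xi>) * h \<xi> \<partial>lborel)"
proof -
  define \<epsilon> :: "nat \<Rightarrow> real" where "\<epsilon> k = 1 / (k + 1)" for k
  have \<epsilon>: "\<epsilon> k > 0" "\<epsilon> k \<le> 1" for k by (auto simp: \<epsilon>_def)
  have \<epsilon>0: "filterlim \<epsilon> (at 0) sequentially"
    unfolding \<epsilon>_def by real_asymp
  define q where "q k \<xi> = (h (\<xi> + \<epsilon> k *\<^sub>R b) - h \<xi>) / \<epsilon> k" for k \<xi>
  define J where "J = (\<integral>\<xi>. cis (x \<bullet> \<xi>) * h \<xi> \<partial>lborel)"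
  have qlim: "(\<lambda>k. q k \<xi>) \<longlonglongrightarrow> h' \<xi>" for \<xi>
  proof -
    have "((\<lambda>s. (h (\<xi> + s *\<^sub>R b) - h \<xi>) / s) \<longlongrightarrow> h' \<xi>) (at 0)"
      using deriv[of \<xi> 0] by (simp add: DERIV_def)
    from filterlim_compose[OF this \<epsilon>0] show ?thesis by (simp add: q_def)
  qed
  have [measurable]: "q k \<in> borel_measurable borel" for k
    unfolding q_def by measurable
  have [measurable]: "h' \<in> borel_measurable borel"
    by (rule borel_measurable_LIMSEQ_real[OF qlim]) auto
  have L0: "L \<ge> 0" using bound[of 0] by linarith
  \<comment> \<open>The mean value theorem gives the uniform bound \<open>L\<close>. Since
    \<open>\<epsilon> k\<close> and \<open>norm b\<close> are at most 1, the supports stay in the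
    ball of radius \<open>R + 1\<close>, so one majorant serves all \<open>k\<close>.\<close>
  have qb: "\<bar>q k \<xi>\<bar> \<le> L * indicator (cball 0 (R + 1)) \<xi>" for k \<xi>
  proof (cases "norm \<xi> \<le> R + 1")
    case True
    have "\<exists>z. 0 < z \<and> z < \<epsilon> k \<and> h (\<xi> + \<epsilon> k *\<^sub>R b) - h (\<xi> + 0 *\<^sub>R b) = (\<epsilon> k - 0) * h' (\<xi> + z *\<^sub>R b)"
      by (rule MVT2) (auto simp: \<epsilon> deriv)
    then obtain z where "h (\<xi> + \<epsilon> k *\<^sub>R b) - h \<xi> = \<epsilon> k * h' (\<xi> + z *\<^sub>R b)" by auto
    then have "q k \<xi> = h' (\<xi> + z *\<^sub>R b)" using \<epsilon>(1)[of k] by (simp add: q_def)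
    with True show ?thesis using bound by simp
  next
    case False
    have "norm (\<xi> + \<epsilon> k *\<^sub>R b) > R"
    proof -
      have "norm (\<epsilon> k *\<^sub>R b) \<le> 1 * 1" using \<epsilon>[of k] b by (simp only: norm_scaleR) (intro mult_mono, auto)
      with False norm_diff_ineq[of \<xi> "\<epsilon> k *\<^sub>R b"] show ?thesis by linarith
    qed
    with False show ?thesis by (simp add: q_def supp)
  qed
  have ball: "integrable lborel (\<lambda>\<xi>::'a. L * indicator (cball 0 r) \<xi>)" for r
    using emeasure_lborel_cball_finite[of "0::'a" r]
    by (intro integrable_mult_right integrable_real_indicator) auto
  have lim1: "(\<lambda>k. \<integral>\<xi>. cis (x \<bullet> \<xi>) * q k \<xi> \<partial>lborel) \<longlonglongrightarrow> (\<integral>\<xi>. cis (x \<bullet> \<xi>) * h' \<xi> \<partial>lborel)"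
  proof (rule integral_dominated_convergence[OF _ _ ball[of "R + 1"]])
    show "AE \<xi> in lborel. (\<lambda>k. cis (x \<bullet> \<xi>) * complex_of_real (q k \<xi>)) \<longlonglongrightarrow> cis (x \<bullet> \<xi>) * complex_of_real (h' \<xi>)"
      by (intro always_eventually allI tendsto_intros qlim)
  qed (auto simp: norm_mult qb)
  have int: "integrable lborel (\<lambda>\<xi>. cis (x \<bullet> \<xi>) * h \<xi>)"
  proof (rule Bochner_Integration.integrable_bound[OF ball[of R]])
    show "AE \<xi> in lborel. norm (cis (x \<bullet> \<xi>) * complex_of_real (h \<xi>)) \<le> norm (L * indicator (cball 0 R) \<xi>)"
      using hbound L0 by (auto simp: norm_mult supp indicator_def abs_mult)
  qed auto
  have int2: "integrable lborel (\<lambda>\<xi>. cis (x \<bullet> \<xi>) * h (\<xi> + e *\<^sub>R b))" for e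
  proof (rule Bochner_Integration.integrable_bound[OF ball[of "R + norm (e *\<^sub>R b)"]])
    have "h (\<xi> + e *\<^sub>R b) = 0" if "norm \<xi> > R + norm (e *\<^sub>R b)" for \<xi>
      using that norm_diff_ineq[of \<xi> "e *\<^sub>R b"] by (intro supp) linarith
    then show "AE \<xi> in lborel. norm (cis (x \<bullet> \<xi>) * complex_of_real (h (\<xi> + e *\<^sub>R b))) \<le> norm (L * indicator (cball 0 (R + norm (e *\<^sub>R b))) \<xi>)"
      using hbound L0 by (auto simp: norm_mult indicator_def abs_mult not_le)
  qed auto
  have eq: "(\<integral>\<xi>. cis (x \<bullet> \<xi>) * q k \<xi> \<partial>lborel) = ((cis (- (x \<bullet> b) * \<epsilon> k) - 1) / \<epsilon> k) * J" for k
  proof -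
    have "(\<integral>\<xi>. cis (x \<bullet> \<xi>) * h (\<xi> + \<epsilon> k *\<^sub>R b) \<partial>lborel)
        = (\<integral>\<xi>. cis (x \<bullet> (- (\<epsilon> k *\<^sub>R b) + \<xi>)) * h (- (\<epsilon> k *\<^sub>R b) + \<xi> + \<epsilon> k *\<^sub>R b) \<partial>lborel)"
      by (rule lborel_integral_translate[of "\<lambda>\<xi>. cis (x \<bullet> \<xi>) * h (\<xi> + \<epsilon> k *\<^sub>R b)", symmetric]) measurable
    also have "\<dots> = (\<integral>\<xi>. cis (- (x \<bullet> b) * \<epsilon> k) * (cis (x \<bullet> \<xi>) * h \<xi>) \<partial>lborel)"
      by (intro Bochner_Integration.integral_cong refl) (simp add: inner_diff_right cis_mult algebra_simps)
    also have "\<dots> = cis (- (x \<bullet> b) * \<epsilon> k) * J"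
      by (simp add: J_def)
    finally have "(\<integral>\<xi>. cis (x \<bullet> \<xi>) * h (\<xi> + \<epsilon> k *\<^sub>R b) \<partial>lborel) - J = (cis (- (x \<bullet> b) * \<epsilon> k) - 1) * J"
      by (simp add: algebra_simps)
    moreover have "(\<integral>\<xi>. cis (x \<bullet> \<xi>) * h (\<xi> + \<epsilon> k *\<^sub>R b) \<partial>lborel) - J
        = (\<integral>\<xi>. cis (x \<bullet> \<xi>) * h (\<xi> + \<epsilon> k *\<^sub>R b) - cis (x \<bullet> \<xi>) * h \<xi> \<partial>lborel)"
      unfolding J_def by (rule Bochner_Integration.integral_diff[symmetric]) (fact int int2)+
    moreover have "(\<integral>\<xi>. cis (x \<bullet> \<xi>) * h (\<xi> + \<epsilon> k *\<^sub>R b) - cis (x \<bullet> \<xi>) * h \<xi> \<partial>lborel)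
        = (\<integral>\<xi>. complex_of_real (\<epsilon> k) * (cis (x \<bullet> \<xi>) * q k \<xi>) \<partial>lborel)"
      using \<epsilon>(1)[of k] by (intro Bochner_Integration.integral_cong refl) (simp add: q_def field_simps)
    ultimately have "complex_of_real (\<epsilon> k) * (\<integral>\<xi>. cis (x \<bullet> \<xi>) * q k \<xi> \<partial>lborel) = (cis (- (x \<bullet> b) * \<epsilon> k) - 1) * J"
      by simp
    then show ?thesis using \<epsilon>(1)[of k] by (simp add: field_simps)
  qed
  \<comment> \<open>The scalar factor in \<open>eq\<close> is a difference quotient of the complex
    exponential at \<open>0\<close>.\<close>
  have "((\<lambda>z. exp (- \<i> * (x \<bullet> b) * z)) has_field_derivative - \<i> * (x \<bullet> b)) (at 0)"
    by (auto intro!: derivative_eq_intros)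
  then have "((\<lambda>z. (exp (- \<i> * (x \<bullet> b) * z) - 1) / z) \<longlongrightarrow> - \<i> * (x \<bullet> b)) (at 0)"
    by (simp add: DERIV_def)
  moreover have "filterlim (\<lambda>k. complex_of_real (\<epsilon> k)) (at 0) sequentially"
    using \<epsilon>0 tendsto_of_real[of \<epsilon> 0 sequentially, where 'a=complex] by (auto simp: filterlim_at)
  ultimately have "(\<lambda>k. (exp (- \<i> * (x \<bullet> b) * \<epsilon> k) - 1) / of_real (\<epsilon> k)) \<longlonglongrightarrow> - \<i> * (x \<bullet> b)"
    by (rule filterlim_compose)
  then have "(\<lambda>k. (cis (- (x \<bullet> b) * \<epsilon> k) - 1) / of_real (\<epsilon> k)) \<longlonglongrightarrow> - \<i> * (x \<bullet> b)"
    by (simp add: cis_conv_exp mult.assoc)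
  then have "(\<lambda>k. ((cis (- (x \<bullet> b) * \<epsilon> k) - 1) / of_real (\<epsilon> k)) * J) \<longlonglongrightarrow> - \<i> * (x \<bullet> b) * J"
    by (intro tendsto_intros)
  with lim1 show ?thesis
    unfolding eq J_def by (rule LIMSEQ_unique)
qed

section \<open>Bochner--Riesz symbols\<close>

text \<open>Normalised so that \<open>(s - |xi|^2)_+^m\<close> is \<open>s^m\<close> times the atom
  at \<open>xi / sqrt s\<close>. As \<open>0 ^ 0 = 1\<close>, the atom with \<open>m = 0\<close> is
  the constant 1; compact support needs \<open>m > 0\<close>.\<close>

definition atom :: "nat \<Rightarrow> 'a::euclidean_space \<Rightarrow> real" where
  "atom m \<xi> = max 0 (1 - (norm \<xi>)\<^sup>2) ^ m"

lemma atom_nonneg [simp]: "0 \<le> atom m \<xi>"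
  by (simp add: atom_def)

lemma atom_measurable [measurable]: "atom m \<in> borel_measurable borel"
  unfolding atom_def by measurable

text \<open>The condition \<open>m \<ge> 2\<close> makes the difference quotient at \<open>0\<close>
  vanish in the limit, and it excludes the value \<open>0 ^ 0 = 1\<close> in the formula for
  \<open>u < 0\<close>.\<close>

lemma max_power_has_real_derivative:
  assumes "m \<ge> 2"
  shows "((\<lambda>u::real. max 0 u ^ m) has_real_derivative m * max 0 u ^ (m - 1)) (at u)"
proof (cases "u = 0")
  case True
  have "((\<lambda>h. max 0 h ^ m / h) \<longlongrightarrow> 0) (at (0::real))"
  proof (rule Lim_null_comparison)
    show "\<forall>\<^sub>F h in at (0::real). norm (max 0 h ^ m / h) \<le> \<bar>h\<bar> ^ (m - 1)"
    proof (rule always_eventually, rule allI)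
      fix h :: real
      obtain k where "m = Suc k" using assms by (cases m) auto
      then show "norm (max 0 h ^ m / h) \<le> \<bar>h\<bar> ^ (m - 1)"
        using assms by (cases "h > 0") auto
    qed
    show "((\<lambda>h::real. \<bar>h\<bar> ^ (m - 1)) \<longlongrightarrow> 0) (at 0)"
      using assms by (auto intro!: tendsto_eq_intros)
  qed
  with True assms show ?thesis by (simp add: DERIV_def power_0_left)
next
  case False
  show ?thesis
  proof (cases "u > 0")
    case True
    have "((\<lambda>u::real. u ^ m) has_real_derivative m * u ^ (m - 1)) (at u)"
      using DERIV_pow[of m u] by simp
    then have "((\<lambda>u::real. max 0 u ^ m) has_real_derivative m * u ^ (m - 1)) (at u)"
      by (rule has_field_derivative_transform_within[where d=u]) (use True in \<open>auto simp: dist_real_def max_def\<close>)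
    with True show ?thesis by simp
  next
    case neg: False
    have "((\<lambda>u::real. 0) has_real_derivative 0) (at u)" by simp
    then have "((\<lambda>u::real. max 0 u ^ m) has_real_derivative 0) (at u)"
      by (rule has_field_derivative_transform_within[where d="-u"]) (use neg False assms in \<open>auto simp: dist_real_def max_def\<close>)
    with neg False assms show ?thesis by (simp add: power_0_left)
  qed
qed

text \<open>Differentiating an atom in direction \<open>b\<close> produces a factor
  \<open>\<xi> \<bullet> b\<close>; with these powers included, the family is closed under
  integration by parts.\<close>

definition atom_moment :: "'a::euclidean_space \<Rightarrow> nat \<Rightarrow> nat \<Rightarrow> 'a \<Rightarrow> complex" where
  "atom_moment b k m x = (\<integral>\<xi>. cis (x \<bullet> \<xi>) * of_real ((\<xi> \<bullet> b) ^ k * atom m \<xi>) \<partial>lborel)"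

lemma atom_le_indicator:
  assumes "m > 0"
  shows "atom m \<xi> \<le> indicator (cball 0 1) \<xi>" "0 \<le> atom m \<xi>"
proof -
  have "1 - (norm \<xi>)\<^sup>2 \<le> 0" if "norm \<xi> > 1"
    using that by (simp add: abs_square_le_1 one_le_power)
  then have "max 0 (1 - (norm \<xi>)\<^sup>2) = 0" if "norm \<xi> > 1" using that by simp
  then show "atom m \<xi> \<le> indicator (cball 0 1) \<xi>" "0 \<le> atom m \<xi>"
    using assms by (auto simp: atom_def indicator_def not_le power_0_left intro!: power_le_one)
qed

lemma monomial_atom_bound:
  assumes "m > 0" "norm b \<le> 1"
  shows "\<bar>(\<xi> \<bullet> b) ^ k * atom m \<xi>\<bar> \<le> indicator (cball 0 1) \<xi>"
proof (cases "norm \<xi> \<le> 1")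
  case True
  have "\<bar>\<xi> \<bullet> b\<bar> \<le> norm \<xi> * norm b" by (rule Cauchy_Schwarz_ineq2)
  also have "\<dots> \<le> 1 * 1" using True assms by (intro mult_mono) auto
  finally have "\<bar>\<xi> \<bullet> b\<bar> ^ k \<le> 1" by (intro power_le_one) auto
  then have "\<bar>\<xi> \<bullet> b\<bar> ^ k * \<bar>atom m \<xi>\<bar> \<le> 1 * 1"
    using atom_le_indicator[OF assms(1), of \<xi>] True by (intro mult_mono) auto
  with True show ?thesis by (simp add: abs_mult power_abs)
next
  case False
  then show ?thesis using atom_le_indicator[OF assms(1), of \<xi>] by simp
qed

lemma integrable_indicator_cball: "integrable lborel (\<lambda>\<xi>::'a::euclidean_space. indicator (cball 0 r) \<xi> :: real)"
  using emeasure_lborel_cball_finite[of "0::'a" r] by (intro integrable_real_indicator) auto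

lemma integrable_monomial_atom:
  assumes "m > 0" "norm b \<le> 1"
  shows "integrable lborel (\<lambda>\<xi>::'a::euclidean_space. cis (x \<bullet> \<xi>) * of_real ((\<xi> \<bullet> b) ^ k * atom m \<xi>))"
proof (rule Bochner_Integration.integrable_bound[OF integrable_indicator_cball[of 1]])
  show "AE \<xi> in lborel. norm (cis (x \<bullet> \<xi>) * complex_of_real ((\<xi> \<bullet> b) ^ k * atom m \<xi>)) \<le> norm (indicator (cball 0 1) \<xi> :: real)"
    using monomial_atom_bound[OF assms] by (auto simp: norm_mult simp del: of_real_mult)
qed measurable

text \<open>Since \<open>|x \<bullet> b|\<close> is traded for one order of smoothness, iteration gives polynomial decay.\<close>

lemma atom_moment_by_parts:
  assumes m: "m \<ge> 2" and b: "norm b = 1"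
  shows "- \<i> * (x \<bullet> b) * atom_moment b k m x
    = k * atom_moment b (k - 1) m x - 2 * m * atom_moment b (k + 1) (m - 1) x"
proof -
  define h where "h \<xi> = (\<xi> \<bullet> b) ^ k * atom m \<xi>" for \<xi>
  \<comment> \<open>For \<open>k = 0\<close> the truncated difference \<open>k - 1\<close> is
    harmless, since its term carries the factor \<open>k\<close>.\<close>
  define h' where "h' \<xi> = k * ((\<xi> \<bullet> b) ^ (k - 1) * atom m \<xi>) - 2 * m * ((\<xi> \<bullet> b) ^ (k + 1) * atom (m - 1) \<xi>)" for \<xi>
  have bb: "b \<bullet> b = 1" using b by (simp add: dot_square_norm)
  have "(\<integral>\<xi>. cis (x \<bullet> \<xi>) * h' \<xi> \<partial>lborel) = - \<i> * (x \<bullet> b) * (\<integral>\<xi>. cis (x \<bullet> \<xi>) * h \<xi> \<partial>lborel)"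
  \<comment> \<open>Monomials times atoms are at most 1 in absolute value, so
    \<open>k + 2 * m\<close> bounds \<open>h'\<close>; the summand 1 covers
    \<open>h\<close>.\<close>
  proof (rule integral_cis_directional_deriv[where R=1 and L="1 + real k + 2 * real m"])
    show "h \<in> borel_measurable borel" unfolding h_def by measurable
    show "h \<xi> = 0" if "norm \<xi> > 1" for \<xi>
      using monomial_atom_bound[of m b \<xi> k] that m b by (simp add: h_def)
    show "norm b \<le> 1" using b by simp
    show "((\<lambda>s. h (\<xi> + s *\<^sub>R b)) has_real_derivative h' (\<xi> + s *\<^sub>R b)) (at s)" for \<xi> s
    proof -
      have 1: "((\<lambda>s. ((\<xi> + s *\<^sub>R b) \<bullet> b) ^ k) has_real_derivative k * ((\<xi> + s *\<^sub>R b) \<bullet> b) ^ (k - 1)) (at s)"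
        by (auto intro!: derivative_eq_intros simp: inner_add_left bb)
      have "((\<lambda>s. 1 - (norm (\<xi> + s *\<^sub>R b))\<^sup>2) has_real_derivative - 2 * ((\<xi> + s *\<^sub>R b) \<bullet> b)) (at s)"
        unfolding dot_square_norm[symmetric] inner_add_left inner_add_right inner_scaleR_left inner_scaleR_right bb
        by (auto intro!: derivative_eq_intros simp: inner_commute[of b \<xi>])
      from DERIV_chain2[OF max_power_has_real_derivative[OF m] this]
      have 2: "((\<lambda>s. atom m (\<xi> + s *\<^sub>R b)) has_real_derivative m * atom (m - 1) (\<xi> + s *\<^sub>R b) * (- 2 * ((\<xi> + s *\<^sub>R b) \<bullet> b))) (at s)"
        by (simp add: atom_def)
      show ?thesis
        unfolding h_def by (rule DERIV_cong[OF DERIV_mult[OF 1 2]]) (simp add: h'_def algebra_simps)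
    qed
    have le1: "\<bar>(\<xi> \<bullet> b) ^ j * atom n \<xi>\<bar> \<le> 1" if "n > 0" for j n \<xi>
      by (rule order_trans[OF monomial_atom_bound[OF that]]) (auto simp: b indicator_def)
    show "\<bar>h' \<xi>\<bar> \<le> 1 + real k + 2 * real m" for \<xi>
    proof -
      have "\<bar>h' \<xi>\<bar> \<le> \<bar>k * ((\<xi> \<bullet> b) ^ (k - 1) * atom m \<xi>)\<bar> + \<bar>2 * m * ((\<xi> \<bullet> b) ^ (k + 1) * atom (m - 1) \<xi>)\<bar>"
        unfolding h'_def by (rule abs_triangle_ineq4)
      also have "\<dots> = k * \<bar>(\<xi> \<bullet> b) ^ (k - 1) * atom m \<xi>\<bar> + 2 * m * \<bar>(\<xi> \<bullet> b) ^ (k + 1) * atom (m - 1) \<xi>\<bar>"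
        by (simp add: abs_mult)
      also have "\<dots> \<le> real k * 1 + real (2 * m) * 1"
        using m by (intro add_mono mult_left_mono le1) auto
      finally show ?thesis by simp
    qed
    show "\<bar>h \<xi>\<bar> \<le> 1 + real k + 2 * real m" for \<xi>
      using le1[of m \<xi> k] m by (simp add: h_def)
  qed
  also have "(\<integral>\<xi>. cis (x \<bullet> \<xi>) * h \<xi> \<partial>lborel) = atom_moment b k m x"
    by (simp add: atom_moment_def h_def)
  also have "(\<integral>\<xi>. cis (x \<bullet> \<xi>) * h' \<xi> \<partial>lborel) = (\<integral>\<xi>. k * (cis (x \<bullet> \<xi>) * of_real ((\<xi> \<bullet> b) ^ (k - 1) * atom m \<xi>))
      - 2 * m * (cis (x \<bullet> \<xi>) * of_real ((\<xi> \<bullet> b) ^ (k + 1) * atom (m - 1) \<xi>)) \<partial>lborel)"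
    by (intro Bochner_Integration.integral_cong refl) (simp add: h'_def algebra_simps)
  also have "\<dots> = k * atom_moment b (k - 1) m x - 2 * m * atom_moment b (k + 1) (m - 1) x"
    unfolding atom_moment_def using m b
    by (subst Bochner_Integration.integral_diff; (intro integrable_mult_right integrable_monomial_atom)?) auto
  finally show ?thesis by simp
qed

text \<open>Each factor \<open>x \<bullet> b\<close> costs one integration by parts, which lowers
  \<open>m\<close> by one in one of the two resulting terms. Starting from \<open>j < m\<close>,
  every step still has \<open>m \<ge> 2\<close>, and the base case has \<open>m > 0\<close>, where
  the integrand is at most the indicator of the unit ball.\<close>

lemma atom_moment_decay:
  assumes "norm b = 1" "j < m"
  shows "\<exists>C\<ge>0. \<forall>x. \<bar>x \<bullet> b\<bar> ^ j * norm (atom_moment b k m x) \<le> C"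
  using assms(2)
proof (induction j arbitrary: m k)
  case 0
  have "norm (atom_moment b k m x) \<le> (\<integral>\<xi>. indicator (cball 0 1) \<xi> \<partial>(lborel :: 'a measure))" for x
    unfolding atom_moment_def
    by (rule Bochner_Integration.integral_norm_bound_integral[OF integrable_monomial_atom integrable_indicator_cball])
      (use 0 assms(1) monomial_atom_bound[of m b _ k] in \<open>auto simp: norm_mult simp del: of_real_mult\<close>)
  then show ?case
    by (intro exI[of _ "\<integral>\<xi>. indicator (cball 0 1) \<xi> \<partial>(lborel :: 'a measure)"]) (auto intro!: integral_nonneg)
next
  case (Suc j)
  obtain C1 where C1: "C1 \<ge> 0" "\<And>x. \<bar>x \<bullet> b\<bar> ^ j * norm (atom_moment b (k - 1) m x) \<le> C1"
    using Suc.IH[of m "k - 1"] Suc.prems by auto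
  obtain C2 where C2: "C2 \<ge> 0" "\<And>x. \<bar>x \<bullet> b\<bar> ^ j * norm (atom_moment b (k + 1) (m - 1) x) \<le> C2"
    using Suc.IH[of "m - 1" "k + 1"] Suc.prems by (auto simp: less_diff_conv)
  have "\<bar>x \<bullet> b\<bar> ^ Suc j * norm (atom_moment b k m x) \<le> k * C1 + 2 * m * C2" for x
  proof -
    have "\<bar>x \<bullet> b\<bar> ^ Suc j * norm (atom_moment b k m x) = \<bar>x \<bullet> b\<bar> ^ j * norm (- \<i> * (x \<bullet> b) * atom_moment b k m x)"
      by (simp add: norm_mult mult_ac)
    also have "\<dots> \<le> \<bar>x \<bullet> b\<bar> ^ j * (norm (k * atom_moment b (k - 1) m x) + norm (2 * m * atom_moment b (k + 1) (m - 1) x))"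
      using Suc.prems assms(1) by (subst atom_moment_by_parts) (auto intro!: mult_left_mono norm_triangle_ineq4)
    also have "\<dots> = k * (\<bar>x \<bullet> b\<bar> ^ j * norm (atom_moment b (k - 1) m x)) + 2 * m * (\<bar>x \<bullet> b\<bar> ^ j * norm (atom_moment b (k + 1) (m - 1) x))"
      by (simp add: norm_mult algebra_simps)
    also have "\<dots> \<le> k * C1 + 2 * m * C2"
      by (intro add_mono mult_left_mono C1 C2) auto
    finally show ?thesis .
  qed
  with C1(1) C2(1) show ?case by (intro exI[of _ "k * C1 + 2 * m * C2"]) auto
qed

definition atom_ft :: "nat \<Rightarrow> 'a::euclidean_space \<Rightarrow> complex" where
  "atom_ft m x = (\<integral>\<xi>. cis (x \<bullet> \<xi>) * of_real (atom m \<xi>) \<partial>lborel)"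

text \<open>Some coordinate of \<open>x\<close> is at least \<open>norm x / n\<close> in absolute
  value, so decay of order \<open>2n\<close> along every basis direction gives decay of order
  \<open>2n\<close> in the norm. The strict bound on \<open>m\<close> is what
  \<open>atom_moment_decay\<close> needs for \<open>j = 2n\<close>.\<close>

lemma atom_ft_decay:
  assumes "2 * DIM('a) < m"
  obtains C where "C > 0" "\<And>x::'a::euclidean_space. norm (atom_ft m x) \<le> C * inverse ((1 + norm x) ^ (2 * DIM('a)))"
proof -
  define n where "n = DIM('a)"
  have "\<exists>C. C \<ge> 0 \<and> (\<forall>x::'a. \<bar>x \<bullet> b\<bar> ^ j * norm (atom_ft m x) \<le> C)" if "b \<in> Basis" "j < m" for b :: 'a and j
    using atom_moment_decay[of b j m 0] that by (auto simp: atom_moment_def atom_ft_def)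
  then obtain C where C: "\<And>b j. b \<in> (Basis::'a set) \<Longrightarrow> j < m \<Longrightarrow> C b j \<ge> 0 \<and> (\<forall>x::'a. \<bar>x \<bullet> b\<bar> ^ j * norm (atom_ft m x) \<le> C b j)"
    by metis
  \<comment> \<open>The terms with \<open>j = 0\<close> cover \<open>norm x \<le> 1\<close>, where
    \<open>1 + norm x \<le> 2\<close>; those with \<open>j = 2n\<close> cover the rest, where
    \<open>1 + norm x\<close> is at most \<open>2n\<close> times a coordinate. The sum over
    \<open>Basis\<close> removes the dependence on which coordinate is large.\<close>
  define D where "D = (\<Sum>b\<in>(Basis::'a set). 2 ^ (2 * n) * C b 0 + (2 * real n) ^ (2 * n) * C b (2 * n))"
  have D: "(1 + norm x) ^ (2 * n) * norm (atom_ft m x) \<le> D" for x :: 'a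
  proof -
    obtain b where b: "b \<in> Basis" "norm x \<le> real n * \<bar>x \<bullet> b\<bar>"
    proof (rule ccontr)
      assume *: "\<not> thesis"
      have "norm x \<le> (\<Sum>b\<in>Basis. \<bar>x \<bullet> b\<bar>)" by (rule norm_le_l1)
      also have "\<dots> < (\<Sum>b\<in>(Basis::'a set). norm x / n)"
      proof (rule sum_strict_mono)
        fix b :: 'a assume "b \<in> Basis"
        with * that have "\<not> norm x \<le> real n * \<bar>x \<bullet> b\<bar>" by blast
        then show "\<bar>x \<bullet> b\<bar> < norm x / n" by (simp add: n_def field_simps)
      qed auto
      also have "\<dots> = norm x" by (simp add: n_def)
      finally show False by simp
    qed
    have "(1 + norm x) ^ (2 * n) * norm (atom_ft m x) \<le> 2 ^ (2 * n) * C b 0 + (2 * real n) ^ (2 * n) * C b (2 * n)"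
    proof (cases "norm x \<le> 1")
      case True
      have "(1 + norm x) ^ (2 * n) * norm (atom_ft m x) \<le> 2 ^ (2 * n) * C b 0"
        using True C[OF b(1), of 0] assms by (intro mult_mono power_mono) (auto simp: n_def)
      moreover have "0 \<le> (2 * real n) ^ (2 * n) * C b (2 * n)"
        using C[OF b(1), of "2 * n"] assms by (intro mult_nonneg_nonneg) (auto simp: n_def)
      ultimately show ?thesis by linarith
    next
      case False
      have "(1 + norm x) ^ (2 * n) \<le> (2 * real n * \<bar>x \<bullet> b\<bar>) ^ (2 * n)"
        using False b(2) by (intro power_mono) auto
      then have "(1 + norm x) ^ (2 * n) * norm (atom_ft m x) \<le> (2 * real n) ^ (2 * n) * (\<bar>x \<bullet> b\<bar> ^ (2 * n) * norm (atom_ft m x))"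
        by (subst mult.assoc[symmetric], subst power_mult_distrib[symmetric]) (rule mult_right_mono, auto)
      also have "\<dots> \<le> (2 * real n) ^ (2 * n) * C b (2 * n)"
        using C[OF b(1), of "2 * n"] assms by (intro mult_left_mono) (auto simp: n_def)
      moreover have "0 \<le> 2 ^ (2 * n) * C b 0"
        using C[OF b(1), of 0] assms by (intro mult_nonneg_nonneg) (auto simp: n_def)
      ultimately show ?thesis by linarith
    qed
    also have "\<dots> \<le> D"
      unfolding D_def using C assms b(1)
      by (intro member_le_sum[of b Basis "\<lambda>b. 2 ^ (2 * n) * C b 0 + (2 * real n) ^ (2 * n) * C b (2 * n)"])
        (auto simp: n_def intro!: add_nonneg_nonneg mult_nonneg_nonneg)
    finally show ?thesis .
  qed
  have "norm (atom_ft m x) \<le> (D + 1) * inverse ((1 + norm x) ^ (2 * DIM('a)))" for x :: 'a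
  proof -
    have "(1 + norm x) ^ (2 * DIM('a)) > 0" by (intro zero_less_power add_pos_nonneg) auto
    with D[of x] show ?thesis by (simp add: n_def field_simps)
  qed
  moreover have "D + 1 > 0" using D[of 0] by (smt (verit) mult_nonneg_nonneg norm_ge_zero zero_le_power)
  ultimately show ?thesis by (rule that[rotated])
qed

lemma atom_ft_measurable [measurable]: "atom_ft m \<in> borel_measurable borel"
  unfolding atom_ft_def by measurable

section \<open>Derivatives of the radial profile\<close>

lemma power_le_fact_exp:
  assumes "x \<ge> (0::real)"
  shows "x ^ k \<le> fact k * exp x"
proof -
  have "(\<Sum>n\<in>{k}. x ^ n /\<^sub>R fact n) \<le> (\<Sum>n. x ^ n /\<^sub>R fact n)"
    using assms by (intro sum_le_suminf summable_exp_generic) auto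
  then have "x ^ k /\<^sub>R fact k \<le> exp x"
    by (simp add: exp_def)
  then show ?thesis by (simp add: field_simps)
qed

text \<open>A single term of the exponential series suffices: with \<open>\<alpha> k \<ge> m\<close>
  and \<open>s \<ge> 1\<close>, \<open>s^m \<le> s^(\<alpha> k) \<le> k! exp (s^\<alpha>)\<close>.
  The factor \<open>2^m\<close> comes from \<open>1 + s \<le> 2 max 1 s\<close>.\<close>

lemma exp_powr_le_inverse_power:
  fixes \<alpha> :: real
  assumes "\<alpha> > 0"
  obtains C where "C > 0" "\<And>s::real. s \<ge> 0 \<Longrightarrow> exp (- (s powr \<alpha>)) \<le> C * inverse ((1 + s) ^ m)"
proof -
  define k where "k = nat \<lceil>m / \<alpha>\<rceil>"
  have "m / \<alpha> \<le> k" unfolding k_def by linarith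
  then have k: "real m \<le> \<alpha> * k" using assms by (simp add: field_simps)
  have "exp (- (s powr \<alpha>)) \<le> (2 ^ m * fact k) * inverse ((1 + s) ^ m)" if s: "s \<ge> 0" for s :: real
  proof -
    have "(1 + s) ^ m \<le> 2 ^ m * (fact k * exp (s powr \<alpha>))"
    proof (cases "s \<le> 1")
      case True
      have "(1::real) * 1 \<le> fact k * exp (s powr \<alpha>)" by (intro mult_mono) auto
      moreover have "(1 + s) ^ m \<le> 2 ^ m" using True s by (intro power_mono) auto
      ultimately show ?thesis
        by (metis mult.right_neutral mult_left_mono order_trans zero_le_numeral zero_le_power)
    next
      case False
      have "(1 + s) ^ m \<le> (2 * s) ^ m" using False by (intro power_mono) auto
      also have "\<dots> = 2 ^ m * s powr m" using False by (simp add: power_mult_distrib powr_realpow)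
      also have "\<dots> \<le> 2 ^ m * s powr (\<alpha> * k)"
        using False k by (intro mult_left_mono powr_mono) auto
      also have "s powr (\<alpha> * k) = (s powr \<alpha>) ^ k" using False by (simp add: powr_powr[symmetric] powr_realpow)
      also have "\<dots> \<le> fact k * exp (s powr \<alpha>)"
        by (intro power_le_fact_exp) auto
      finally show ?thesis by simp
    qed
    moreover have "(1 + s) ^ m > 0" using s by simp
    ultimately show ?thesis by (simp add: exp_minus field_simps)
  qed
  then show ?thesis by (intro that[of "2 ^ m * fact k"]) auto
qed

lemma powr_exp_decay:
  fixes \<alpha> \<gamma> :: real
  assumes "\<alpha> > 0"
  shows "((\<lambda>s. s powr \<gamma> * exp (- (s powr \<alpha>))) \<longlongrightarrow> 0) at_top"
proof -
  define m where "m = nat \<lceil>\<gamma>\<rceil> + 1"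
  obtain C where C: "C > 0" "\<And>s::real. s \<ge> 0 \<Longrightarrow> exp (- (s powr \<alpha>)) \<le> C * inverse ((1 + s) ^ m)"
    by (rule exp_powr_le_inverse_power[OF assms, where m=m]) blast
  have m: "\<gamma> \<le> m - 1" unfolding m_def by linarith
  show ?thesis
  proof (rule Lim_null_comparison)
    show "\<forall>\<^sub>F s in at_top. norm (s powr \<gamma> * exp (- (s powr \<alpha>))) \<le> C * inverse s"
      using eventually_ge_at_top[of "1::real"]
    proof eventually_elim
      case (elim s)
      have "s powr \<gamma> * exp (- (s powr \<alpha>)) \<le> s powr (m - 1) * (C * inverse ((1 + s) ^ m))"
        using elim m C by (intro mult_mono powr_mono) auto
      also have "\<dots> \<le> s powr (m - 1) * (C * inverse (s ^ m))"
        using elim C(1) by (intro mult_left_mono le_imp_inverse_le power_mono) auto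
      also have "\<dots> = C * inverse s"
        using elim by (simp add: powr_diff powr_realpow field_simps m_def)
      finally show ?case by simp
    qed
    show "((\<lambda>s::real. C * inverse s) \<longlongrightarrow> 0) at_top" by real_asymp
  qed
qed

text \<open>A Gamma-type integral, handled by comparison. The derivative of
  \<open>- 1 / (1 + s^\<gamma>)\<close> behaves like \<open>\<gamma> s^(\<gamma> - 1)\<close> near
  \<open>0\<close> and is integrable on the whole half-line, because its antiderivative has finite
  limits at both ends.\<close>

lemma set_integrable_powr_exp:
  fixes \<alpha> \<gamma> :: real
  assumes "\<alpha> > 0" "\<gamma> > 0"
  shows "set_integrable lborel {0<..} (\<lambda>s. s powr (\<gamma> - 1) * exp (- (s powr \<alpha>)))"
proof -
  define f where "f s = \<gamma> * s powr (\<gamma> - 1) / (1 + s powr \<gamma>)\<^sup>2" for s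
  define F where "F s = - inverse (1 + s powr \<gamma>)" for s :: real
  have pos: "0 < 1 + s powr \<gamma>" for s by (simp add: add_pos_nonneg)
  have f: "set_integrable lborel (einterval 0 \<infinity>) f"
  proof (rule interval_integral_FTC_nonneg(1)[where F=F])
    fix s :: real assume "0 < ereal s" "ereal s < \<infinity>"
    then have s: "s > 0" by simp
    show "DERIV F s :> f s"
      unfolding F_def f_def using s pos[of s]
      by (auto intro!: derivative_eq_intros simp: power2_eq_square divide_inverse)
    show "isCont f s"
      unfolding f_def using s pos[of s] by (intro continuous_intros) auto
  next
    show "((F \<circ> real_of_ereal) \<longlongrightarrow> -1) (at_right 0)"
    proof -
      have "((\<lambda>s. - inverse (1 + s powr \<gamma>)) \<longlongrightarrow> - inverse (1 + 0 powr \<gamma>)) (at_right 0)"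
        using assms by (intro tendsto_intros) (auto simp: eventually_at_filter)
      then show ?thesis
        unfolding F_def zero_ereal_def ereal_tendsto_simps by simp
    qed
    show "((F \<circ> real_of_ereal) \<longlongrightarrow> 0) (at_left \<infinity>)"
    proof -
      have "filterlim (\<lambda>s. 1 + s powr \<gamma>) at_top at_top"
        using assms by real_asymp
      then have "((\<lambda>s. - inverse (1 + s powr \<gamma>)) \<longlongrightarrow> - 0) at_top"
        by (intro tendsto_minus tendsto_inverse_0_at_top)
      then show ?thesis unfolding F_def ereal_tendsto_simps by simp
    qed
  qed (use assms in \<open>auto simp: f_def\<close>)
  define m where "m = nat \<lceil>\<gamma>\<rceil>"
  have m: "\<gamma> \<le> m" unfolding m_def by linarith
  \<comment> \<open>The order \<open>2 * m\<close> matches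
    \<open>(1 + s^\<gamma>)^2 \<le> 4 (1 + s)^(2m)\<close>, valid for
    \<open>\<gamma> \<le> m\<close>.\<close>
  obtain C where C: "C > 0" "\<And>s::real. s \<ge> 0 \<Longrightarrow> exp (- (s powr \<alpha>)) \<le> C * inverse ((1 + s) ^ (2 * m))"
    by (rule exp_powr_le_inverse_power[OF assms(1), where m="2 * m"]) blast
  have bnd: "s powr (\<gamma> - 1) * exp (- (s powr \<alpha>)) \<le> 4 * C / \<gamma> * f s" if s: "s > 0" for s
  proof -
    have "s powr \<gamma> \<le> (1 + s) powr \<gamma>" using s assms by (intro powr_mono2) auto
    also have "\<dots> \<le> (1 + s) powr m" using s m by (intro powr_mono) auto
    finally have "s powr \<gamma> \<le> (1 + s) ^ m" using s by (simp add: powr_realpow)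
    moreover have "1 \<le> (1 + s) ^ m" using s by simp
    ultimately have "(1 + s powr \<gamma>)\<^sup>2 \<le> (2 * (1 + s) ^ m)\<^sup>2" by (intro power_mono) auto
    then have "(1 + s powr \<gamma>)\<^sup>2 \<le> 4 * (1 + s) ^ (2 * m)" by (simp add: power_mult_distrib power_mult[symmetric] mult.commute)
    then have "inverse (4 * (1 + s) ^ (2 * m)) \<le> inverse ((1 + s powr \<gamma>)\<^sup>2)"
      using pos[of s] by (intro le_imp_inverse_le) auto
    then have "C * inverse ((1 + s) ^ (2 * m)) \<le> 4 * C * inverse ((1 + s powr \<gamma>)\<^sup>2)"
      using C(1) by simp
    with C(2)[of s] s have "exp (- (s powr \<alpha>)) \<le> 4 * C * inverse ((1 + s powr \<gamma>)\<^sup>2)" by linarith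
    then have "s powr (\<gamma> - 1) * exp (- (s powr \<alpha>)) \<le> s powr (\<gamma> - 1) * (4 * C * inverse ((1 + s powr \<gamma>)\<^sup>2))"
      by (intro mult_left_mono) auto
    also have "\<dots> = 4 * C / \<gamma> * f s"
      using assms by (simp add: f_def divide_inverse mult_ac)
    finally show ?thesis .
  qed
  have "set_integrable lborel {0<..} (\<lambda>s. 4 * C / \<gamma> * f s)"
    using f by (intro set_integrable_mult_right) (simp add: zero_ereal_def)
  then show ?thesis
    by (rule set_integrable_bound) (use order_trans[OF bnd abs_ge_self] in \<open>auto simp: set_borel_measurable_def\<close>)
qed

text \<open>\<open>radial_deriv \<beta> \<alpha> N\<close> is the \<open>N\<close>-th derivative of $s^\beta e^{-s^\alpha}$ on \<open>s > 0\<close>.\<close>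

fun tcoef :: "real \<Rightarrow> real \<Rightarrow> nat \<Rightarrow> nat \<Rightarrow> real" where
  "tcoef \<beta> \<alpha> 0 i = (if i = 0 then 1 else 0)"
| "tcoef \<beta> \<alpha> (Suc N) i = (\<beta> + i * \<alpha> - N) * tcoef \<beta> \<alpha> N i - \<alpha> * (case i of 0 \<Rightarrow> 0 | Suc j \<Rightarrow> tcoef \<beta> \<alpha> N j)"

definition radial_deriv :: "real \<Rightarrow> real \<Rightarrow> nat \<Rightarrow> real \<Rightarrow> real" where
  "radial_deriv \<beta> \<alpha> N s = (\<Sum>i\<le>N. tcoef \<beta> \<alpha> N i * (s powr (\<beta> + i * \<alpha> - N) * exp (- (s powr \<alpha>))))"

lemma tcoef_eq_0: "i > N \<Longrightarrow> tcoef \<beta> \<alpha> N i = 0"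
  by (induction N arbitrary: i) (auto split: nat.split)

text \<open>The first differentiation multiplies the coefficient of \<open>i = 0\<close> by
  \<open>\<beta> = 0\<close>, and no other coefficient ever feeds into it.\<close>

lemma tcoef_zero_eq_0: "N > 0 \<Longrightarrow> tcoef 0 \<alpha> N 0 = 0"
proof (induction N)
  case (Suc N) then show ?case by (cases N) auto
qed simp

text \<open>Differentiating the power in the term \<open>i\<close> gives the factor
  \<open>\<beta> + i \<alpha> - N\<close>; differentiating the exponential gives the factor
  \<open>- \<alpha>\<close> and shifts \<open>i\<close> to \<open>i + 1\<close>. Collecting by
  \<open>i\<close> is the recursion of \<open>tcoef\<close>.\<close>

lemma radial_deriv_has_derivative:
  assumes "s > 0"
  shows "(radial_deriv \<beta> \<alpha> N has_real_derivative radial_deriv \<beta> \<alpha> (Suc N) s) (at s)"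
proof -
  let ?e = "exp (- (s powr \<alpha>))"
  let ?c = "tcoef \<beta> \<alpha> N"
  have "(radial_deriv \<beta> \<alpha> N has_real_derivative
      (\<Sum>i\<le>N. ?c i * ((\<beta> + i * \<alpha> - N) * s powr (\<beta> + i * \<alpha> - Suc N) * ?e - \<alpha> * s powr (\<beta> + Suc i * \<alpha> - Suc N) * ?e))) (at s)"
    unfolding radial_deriv_def
  proof (intro DERIV_sum DERIV_cmult)
    fix i
    have "s powr (\<beta> + real (Suc i) * \<alpha> - real (Suc N)) = s powr (\<beta> + i * \<alpha> - N) * s powr (\<alpha> - 1)"
      by (simp add: powr_add[symmetric] algebra_simps)
    moreover have "s powr (\<beta> + i * \<alpha> - real (Suc N)) = s powr (\<beta> + i * \<alpha> - N - 1)"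
      by (simp add: algebra_simps)
    ultimately show "((\<lambda>s. s powr (\<beta> + i * \<alpha> - N) * exp (- (s powr \<alpha>))) has_real_derivative
        (\<beta> + i * \<alpha> - N) * s powr (\<beta> + i * \<alpha> - Suc N) * ?e - \<alpha> * s powr (\<beta> + Suc i * \<alpha> - Suc N) * ?e) (at s)"
      using assms by (auto intro!: derivative_eq_intros simp: algebra_simps)
  qed
  also have "(\<Sum>i\<le>N. ?c i * ((\<beta> + i * \<alpha> - N) * s powr (\<beta> + i * \<alpha> - Suc N) * ?e - \<alpha> * s powr (\<beta> + Suc i * \<alpha> - Suc N) * ?e))
      = (\<Sum>i\<le>N. (\<beta> + i * \<alpha> - N) * ?c i * (s powr (\<beta> + i * \<alpha> - Suc N) * ?e)) - (\<Sum>i\<le>N. \<alpha> * ?c i * (s powr (\<beta> + Suc i * \<alpha> - Suc N) * ?e))"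
    unfolding sum_subtractf[symmetric] by (intro sum.cong refl) (simp add: algebra_simps)
  also have "(\<Sum>i\<le>N. (\<beta> + i * \<alpha> - N) * ?c i * (s powr (\<beta> + i * \<alpha> - Suc N) * ?e))
      = (\<Sum>i\<le>Suc N. (\<beta> + i * \<alpha> - N) * ?c i * (s powr (\<beta> + i * \<alpha> - Suc N) * ?e))"
    by (simp add: tcoef_eq_0)
  also have "(\<Sum>i\<le>N. \<alpha> * ?c i * (s powr (\<beta> + Suc i * \<alpha> - Suc N) * ?e))
      = (\<Sum>i\<le>Suc N. \<alpha> * (case i of 0 \<Rightarrow> 0 | Suc j \<Rightarrow> ?c j) * (s powr (\<beta> + i * \<alpha> - Suc N) * ?e))"
    by (subst sum.atMost_Suc_shift) simp
  also have "(\<Sum>i\<le>Suc N. (\<beta> + i * \<alpha> - N) * ?c i * (s powr (\<beta> + i * \<alpha> - Suc N) * ?e))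
     - (\<Sum>i\<le>Suc N. \<alpha> * (case i of 0 \<Rightarrow> 0 | Suc j \<Rightarrow> ?c j) * (s powr (\<beta> + i * \<alpha> - Suc N) * ?e)) = radial_deriv \<beta> \<alpha> (Suc N) s"
    unfolding sum_subtractf[symmetric] radial_deriv_def by (intro sum.cong refl) (simp add: algebra_simps)
  finally show ?thesis .
qed

lemma radial_deriv_measurable [measurable]: "radial_deriv \<beta> \<alpha> N \<in> borel_measurable borel"
  unfolding radial_deriv_def by measurable

lemma radial_deriv_decay:
  assumes "\<alpha> > 0"
  shows "((\<lambda>s. s powr \<delta> * radial_deriv \<beta> \<alpha> N s) \<longlongrightarrow> 0) at_top"
proof -
  have "((\<lambda>s. \<Sum>i\<le>N. tcoef \<beta> \<alpha> N i * (s powr (\<delta> + (\<beta> + i * \<alpha> - N)) * exp (- (s powr \<alpha>)))) \<longlongrightarrow> (\<Sum>i\<le>N. tcoef \<beta> \<alpha> N i * 0)) at_top"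
    by (intro tendsto_intros powr_exp_decay assms)
  then show ?thesis
    by (simp add: radial_deriv_def sum_distrib_left powr_add mult_ac)
qed

text \<open>For \<open>\<beta> = 0\<close> the term \<open>i = 0\<close>, which is not integrable at \<open>0\<close>, has coefficient \<open>0\<close>.\<close>

lemma set_integrable_radial_deriv:
  assumes "\<alpha> > 0" "\<beta> \<ge> 0" "\<delta> \<ge> 0"
  shows "set_integrable lborel {0<..} (\<lambda>s. s powr (N + \<delta>) * radial_deriv \<beta> \<alpha> (Suc N) s)"
proof -
  let ?c = "tcoef \<beta> \<alpha> (Suc N)"
  have "set_integrable lborel {0<..} (\<lambda>s. \<Sum>i\<le>Suc N. ?c i * (s powr ((\<beta> + i * \<alpha> + \<delta>) - 1) * exp (- (s powr \<alpha>))))"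
    unfolding set_integrable_def scaleR_sum_right
  proof (intro Bochner_Integration.integrable_sum)
    fix i
    show "integrable lborel (\<lambda>s. indicator {0<..} s *\<^sub>R (?c i * (s powr ((\<beta> + i * \<alpha> + \<delta>) - 1) * exp (- (s powr \<alpha>)))))"
    proof (cases "\<beta> + i * \<alpha> > 0")
      case True
      then show ?thesis
        unfolding set_integrable_def[symmetric] using assms
        by (intro set_integrable_mult_right set_integrable_powr_exp) auto
    next
      case False
      have "i = 0"
      proof (rule ccontr)
        assume "i \<noteq> 0"
        then have "i * \<alpha> > 0" using assms by simp
        with False assms show False by linarith
      qed
      with False assms have "\<beta> = 0" by simp
      with \<open>i = 0\<close> have "?c i = 0" using tcoef_zero_eq_0[of "Suc N" \<alpha>] by simp
      then show ?thesis by simp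
    qed
  qed
  also have "(\<lambda>s. \<Sum>i\<le>Suc N. ?c i * (s powr ((\<beta> + i * \<alpha> + \<delta>) - 1) * exp (- (s powr \<alpha>))))
      = (\<lambda>s. s powr (N + \<delta>) * radial_deriv \<beta> \<alpha> (Suc N) s)"
    unfolding radial_deriv_def sum_distrib_left
  proof (intro ext sum.cong refl)
    fix s :: real and i :: nat
    have "s powr ((\<beta> + i * \<alpha> + \<delta>) - 1) = s powr (N + \<delta>) * s powr (\<beta> + i * \<alpha> - Suc N)"
      unfolding powr_add[symmetric] by (simp add: algebra_simps)
    then show "?c i * (s powr ((\<beta> + i * \<alpha> + \<delta>) - 1) * exp (- (s powr \<alpha>)))
        = s powr (N + \<delta>) * (?c i * (s powr (\<beta> + i * \<alpha> - Suc N) * exp (- (s powr \<alpha>))))"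
      by (simp only: mult_ac)
  qed
  finally show ?thesis .
qed

text \<open>Taylor's formula based at infinity, where all derivatives vanish faster than any power.
  Each induction step is one integration by parts; the factor \<open>s - u\<close> kills the
  boundary term at \<open>u\<close> except in the base case, which produces the value at
  \<open>u\<close>.\<close>

lemma radial_taylor:
  assumes "\<alpha> > 0" "\<beta> \<ge> 0" "u > 0"
  shows "set_lebesgue_integral lborel {u<..} (\<lambda>s. (s - u) ^ N * radial_deriv \<beta> \<alpha> (Suc N) s) = (- 1) ^ Suc N * fact N * radial_deriv \<beta> \<alpha> 0 u"
proof (induction N)
  have int: "set_integrable lborel {u<..} (\<lambda>s. (s - u) ^ N * radial_deriv \<beta> \<alpha> (Suc N) s)" for N
  proof -
    have "set_integrable lborel {u<..} (\<lambda>s. s powr (real N + 0) * radial_deriv \<beta> \<alpha> (Suc N) s)"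
      by (rule set_integrable_subset[OF set_integrable_radial_deriv[OF assms(1,2)]]) (use assms in auto)
    then show ?thesis
    proof (rule set_integrable_bound)
      have "\<bar>(s - u) ^ N\<bar> \<le> s powr N" if "s > u" for s
        using that assms by (auto simp: powr_realpow power_abs intro!: power_mono)
      then show "AE s in lborel. s \<in> {u<..} \<longrightarrow> norm ((s - u) ^ N * radial_deriv \<beta> \<alpha> (Suc N) s) \<le> norm (s powr (real N + 0) * radial_deriv \<beta> \<alpha> (Suc N) s)"
        by (auto simp: abs_mult intro!: mult_right_mono)
    qed (auto simp: set_borel_measurable_def)
  qed
  have cont: "isCont (radial_deriv \<beta> \<alpha> N) s" if "s > 0" for s N
    using radial_deriv_has_derivative[OF that] by (rule DERIV_isCont)
  have lim: "((\<lambda>s. (s - u) ^ N * radial_deriv \<beta> \<alpha> M s) \<longlongrightarrow> 0) at_top" for N M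
  proof (rule Lim_null_comparison)
    show "((\<lambda>s. \<bar>s powr N * radial_deriv \<beta> \<alpha> M s\<bar>) \<longlongrightarrow> 0) at_top"
      using radial_deriv_decay[OF assms(1)] by (rule tendsto_rabs_zero)
    show "\<forall>\<^sub>F s in at_top. norm ((s - u) ^ N * radial_deriv \<beta> \<alpha> M s) \<le> \<bar>s powr N * radial_deriv \<beta> \<alpha> M s\<bar>"
      using eventually_gt_at_top[of u]
    proof eventually_elim
      case (elim s)
      then have "\<bar>(s - u) ^ N\<bar> \<le> s powr N"
        using assms by (auto simp: powr_realpow power_abs intro!: power_mono)
      then show ?case by (auto simp: abs_mult intro!: mult_right_mono)
    qed
  qed
  {
    case 0
    have "(LBINT s=u..\<infinity>. radial_deriv \<beta> \<alpha> (Suc 0) s) = 0 - radial_deriv \<beta> \<alpha> 0 u"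
    proof (rule interval_integral_FTC_integrable)
      show "set_integrable lborel (einterval (ereal u) \<infinity>) (radial_deriv \<beta> \<alpha> (Suc 0))"
        using int[of 0] by simp
      show "((radial_deriv \<beta> \<alpha> 0 \<circ> real_of_ereal) \<longlongrightarrow> radial_deriv \<beta> \<alpha> 0 u) (at_right (ereal u))"
        unfolding ereal_tendsto_simps using cont[OF assms(3)]
        by (auto simp: isCont_def intro: tendsto_mono[OF at_le])
      show "((radial_deriv \<beta> \<alpha> 0 \<circ> real_of_ereal) \<longlongrightarrow> 0) (at_left \<infinity>)"
        unfolding ereal_tendsto_simps using lim[of 0 0] by simp
    qed (use assms in \<open>auto simp: has_real_derivative_iff_has_vector_derivative[symmetric] intro!: radial_deriv_has_derivative cont\<close>)
    then show ?case
      by (simp add: interval_lebesgue_integral_def)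
  next
    case (Suc N)
    \<comment> \<open>The derivative of \<open>(s - u)^(N+1)\<close> times the derivative of order
      \<open>N + 1\<close>. Both boundary values are \<open>0\<close>, so the integral of
      \<open>?g\<close> vanishes and links the formulas for \<open>N\<close> and
      \<open>N + 1\<close>.\<close>
    let ?g = "\<lambda>s. real (Suc N) * ((s - u) ^ N * radial_deriv \<beta> \<alpha> (Suc N) s) + (s - u) ^ Suc N * radial_deriv \<beta> \<alpha> (Suc (Suc N)) s"
    have "(LBINT s=u..\<infinity>. ?g s) = 0 - (u - u) ^ Suc N * radial_deriv \<beta> \<alpha> (Suc N) u"
    proof (rule interval_integral_FTC_integrable[where F="\<lambda>s. (s - u) ^ Suc N * radial_deriv \<beta> \<alpha> (Suc N) s"])
      show "set_integrable lborel (einterval (ereal u) \<infinity>) ?g"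
        unfolding einterval_eq by (intro set_integral_add set_integrable_mult_right int)
      show "(((\<lambda>s. (s - u) ^ Suc N * radial_deriv \<beta> \<alpha> (Suc N) s) \<circ> real_of_ereal) \<longlongrightarrow> (u - u) ^ Suc N * radial_deriv \<beta> \<alpha> (Suc N) u) (at_right (ereal u))"
        unfolding ereal_tendsto_simps using cont[OF assms(3)]
        by (intro tendsto_intros) (auto simp: isCont_def intro: tendsto_mono[OF at_le])
      show "(((\<lambda>s. (s - u) ^ Suc N * radial_deriv \<beta> \<alpha> (Suc N) s) \<circ> real_of_ereal) \<longlongrightarrow> 0) (at_left \<infinity>)"
        unfolding ereal_tendsto_simps by (rule lim)
      fix s assume "ereal u < ereal s"
      then have s: "s > 0" using assms by simp
      show "isCont ?g s" using s by (intro continuous_intros cont)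
      have "((\<lambda>s. (s - u) ^ Suc N * radial_deriv \<beta> \<alpha> (Suc N) s) has_real_derivative ?g s) (at s)"
        by (rule DERIV_cong[OF DERIV_mult[OF DERIV_power[OF DERIV_diff[OF DERIV_ident DERIV_const]] radial_deriv_has_derivative[OF s]]])
          (simp del: power_Suc)
      then show "((\<lambda>s. (s - u) ^ Suc N * radial_deriv \<beta> \<alpha> (Suc N) s) has_vector_derivative ?g s) (at s)"
        by (simp add: has_real_derivative_iff_has_vector_derivative)
    qed auto
    then have "set_lebesgue_integral lborel {u<..} ?g = 0"
      by (simp add: interval_lebesgue_integral_def)
    also have "set_lebesgue_integral lborel {u<..} ?g = Suc N * set_lebesgue_integral lborel {u<..} (\<lambda>s. (s - u) ^ N * radial_deriv \<beta> \<alpha> (Suc N) s)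
        + set_lebesgue_integral lborel {u<..} (\<lambda>s. (s - u) ^ Suc N * radial_deriv \<beta> \<alpha> (Suc (Suc N)) s)"
      by (subst set_integral_add; (intro set_integrable_mult_right int)?) (simp only: set_integral_mult_right)
    finally show ?case
      unfolding Suc.IH by (simp add: algebra_simps)
  }
qed

section \<open>Integrability of the kernels\<close>

lemma nn_integral_atom_finite:
  assumes "m > 0"
  shows "(\<integral>\<^sup>+\<xi>. ennreal (atom m \<xi>) \<partial>(lborel :: 'a::euclidean_space measure)) < \<infinity>"
proof -
  have "(\<integral>\<^sup>+\<xi>. ennreal (atom m \<xi>) \<partial>(lborel :: 'a measure)) \<le> (\<integral>\<^sup>+\<xi>. ennreal (indicator (cball 0 1) \<xi>) \<partial>(lborel :: 'a measure))"
    by (intro nn_integral_mono ennreal_leI atom_le_indicator(1) assms)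
  also have "\<dots> < \<infinity>" using emeasure_lborel_cball_finite[of "0::'a" 1] by (simp add: ennreal_indicator)
  finally show ?thesis .
qed

text \<open>Fourier integrals of superpositions of dilated atoms are integrable, because dilation does not
  change the \<open>L\<^sup>1\<close> norm of the transform of an atom.\<close>

lemma superposition_ft_integrable:
  fixes F :: "'a::euclidean_space \<Rightarrow> real" and w :: "real \<Rightarrow> real"
  assumes w [measurable]: "w \<in> borel_measurable borel" and w0: "\<And>s. s \<le> 0 \<Longrightarrow> w s = 0"
    and int1: "(\<integral>\<^sup>+s. ennreal \<bar>w s\<bar> \<partial>lborel) < \<infinity>"
    and int2: "(\<integral>\<^sup>+s. ennreal (\<bar>w s\<bar> * sqrt s ^ DIM('a)) \<partial>lborel) < \<infinity>"
    and m: "2 * DIM('a) < m"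
    and F [measurable]: "F \<in> borel_measurable borel"
    and repr: "AE \<xi> in lborel. F \<xi> = (\<integral>s. w s * atom m (\<xi> /\<^sub>R sqrt s) \<partial>lborel)"
  shows "(\<integral>\<^sup>+x. ennreal (norm (\<integral>\<xi>. cis (x \<bullet> \<xi>) * of_real (F \<xi>) \<partial>lborel)) \<partial>lborel) < \<infinity>"
proof -
  define g :: "'a \<Rightarrow> 'a \<Rightarrow> real \<Rightarrow> complex" where
    "g x \<xi> s = cis (x \<bullet> \<xi>) * of_real (w s * atom m (\<xi> /\<^sub>R sqrt s))" for x \<xi> s
  have [measurable]: "(\<lambda>(\<xi>, s). g x \<xi> s) \<in> borel_measurable (borel \<Otimes>\<^sub>M borel)" for x
    unfolding g_def by measurable
  have m0: "m > 0" using m by simp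
  have g0: "g x \<xi> s = 0" if "s \<le> 0" for x \<xi> s using w0[OF that] by (simp add: g_def)
  have nn_atom: "(\<integral>\<^sup>+\<xi>. ennreal (atom m (\<xi> /\<^sub>R sqrt s)) \<partial>(lborel :: 'a measure)) = ennreal (sqrt s ^ DIM('a)) * (\<integral>\<^sup>+\<xi>. ennreal (atom m \<xi>) \<partial>(lborel :: 'a measure))"
    if "s > 0" for s
    using that by (subst lborel_nn_integral_scaleR[where c="sqrt s"]) auto
  define I where "I = (\<integral>\<^sup>+\<xi>. ennreal (atom m \<xi>) \<partial>(lborel :: 'a measure))"
  have int: "integrable (lborel \<Otimes>\<^sub>M lborel) (\<lambda>(\<xi>, s). g x \<xi> s)" for x
  proof (rule integrableI_bounded)
    \<comment> \<open>Here \<open>int2\<close> enters: integrating a dilated atom over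
      \<open>\<xi>\<close> first produces the factor \<open>sqrt s ^ n\<close>.\<close>
    have "(\<integral>\<^sup>+p. ennreal (norm (case p of (\<xi>, s) \<Rightarrow> g x \<xi> s)) \<partial>(lborel \<Otimes>\<^sub>M lborel)) = (\<integral>\<^sup>+s. \<integral>\<^sup>+\<xi>. ennreal (norm (g x \<xi> s)) \<partial>lborel \<partial>lborel)"
      by (subst lborel_pair.nn_integral_snd[symmetric]) auto
    also have "\<dots> \<le> (\<integral>\<^sup>+s. ennreal (\<bar>w s\<bar> * sqrt s ^ DIM('a)) * I \<partial>lborel)"
    proof (rule nn_integral_mono)
      fix s :: real
      show "(\<integral>\<^sup>+\<xi>. ennreal (norm (g x \<xi> s)) \<partial>lborel) \<le> ennreal (\<bar>w s\<bar> * sqrt s ^ DIM('a)) * I"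
      proof (cases "s > 0")
        case True
        have "(\<integral>\<^sup>+\<xi>. ennreal (norm (g x \<xi> s)) \<partial>lborel) = (\<integral>\<^sup>+\<xi>. ennreal \<bar>w s\<bar> * ennreal (atom m (\<xi> /\<^sub>R sqrt s)) \<partial>(lborel :: 'a measure))"
          by (intro nn_integral_cong) (simp add: g_def norm_mult abs_mult ennreal_mult[symmetric] del: of_real_mult)
        also have "\<dots> = ennreal \<bar>w s\<bar> * (ennreal (sqrt s ^ DIM('a)) * I)"
          unfolding I_def nn_atom[OF True, symmetric] by (rule nn_integral_cmult) auto
        finally show ?thesis using True by (simp add: ennreal_mult mult.assoc)
      qed (simp add: g0)
    qed
    also have "\<dots> = (\<integral>\<^sup>+s. ennreal (\<bar>w s\<bar> * sqrt s ^ DIM('a)) \<partial>lborel) * I"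
      by (rule nn_integral_multc) auto
    also have "\<dots> < \<infinity>"
      using int2 nn_integral_atom_finite[OF m0, where 'a='a] by (simp add: I_def ennreal_mult_less_top)
    finally show "(\<integral>\<^sup>+p. ennreal (norm (case p of (\<xi>, s) \<Rightarrow> g x \<xi> s)) \<partial>(lborel \<Otimes>\<^sub>M lborel)) < \<infinity>" .
  qed auto
  have inner: "(\<integral>\<xi>. g x \<xi> s \<partial>lborel) = w s * sqrt s ^ DIM('a) * atom_ft m (sqrt s *\<^sub>R x)" if "s > 0" for x s
  proof -
    have "(\<integral>\<xi>. g x (sqrt s *\<^sub>R \<xi>) s \<partial>lborel) = inverse (sqrt s ^ DIM('a)) *\<^sub>R (\<integral>\<xi>. g x \<xi> s \<partial>lborel)"
      using that by (intro lborel_integral_scaleR) (auto simp: g_def)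
    moreover have "(\<integral>\<xi>. g x (sqrt s *\<^sub>R \<xi>) s \<partial>lborel) = w s * atom_ft m (sqrt s *\<^sub>R x)"
      unfolding atom_ft_def integral_mult_right_zero[symmetric] using that
      by (intro Bochner_Integration.integral_cong refl) (simp add: g_def)
    ultimately show ?thesis using that by (simp add: field_simps scaleR_conv_of_real)
  qed
  define A where "A = (\<integral>\<^sup>+x. ennreal (norm (atom_ft m x)) \<partial>(lborel :: 'a measure))"
  have A: "A < \<infinity>"
  proof -
    obtain C where C: "C > 0" "\<And>x::'a. norm (atom_ft m x) \<le> C * inverse ((1 + norm x) ^ (2 * DIM('a)))"
      using atom_ft_decay[OF m] by blast
    have "A \<le> (\<integral>\<^sup>+x. ennreal C * ennreal (inverse ((1 + norm x) ^ (2 * DIM('a)))) \<partial>(lborel :: 'a measure))"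
      unfolding A_def using C by (intro nn_integral_mono) (simp add: ennreal_mult[symmetric])
    also have "\<dots> = ennreal C * (\<integral>\<^sup>+x. ennreal (inverse ((1 + norm x) ^ (2 * DIM('a)))) \<partial>(lborel :: 'a measure))"
      by (rule nn_integral_cmult) auto
    also have "\<dots> < \<infinity>"
      using nn_integral_weight_finite[where 'a='a] by (simp add: ennreal_mult_less_top)
    finally show ?thesis .
  qed
  have pt: "ennreal (norm (\<integral>\<xi>. cis (x \<bullet> \<xi>) * of_real (F \<xi>) \<partial>lborel)) \<le> (\<integral>\<^sup>+s. ennreal (\<bar>w s\<bar> * sqrt s ^ DIM('a) * norm (atom_ft m (sqrt s *\<^sub>R x))) \<partial>lborel)" for x :: 'a
  proof -
    have "(\<integral>\<xi>. cis (x \<bullet> \<xi>) * of_real (F \<xi>) \<partial>lborel) = (\<integral>\<xi>. (\<integral>s. g x \<xi> s \<partial>lborel) \<partial>lborel)"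
    proof (rule integral_cong_AE)
      show "AE \<xi> in lborel. cis (x \<bullet> \<xi>) * of_real (F \<xi>) = (\<integral>s. g x \<xi> s \<partial>lborel)"
        using repr
      proof eventually_elim
        case (elim \<xi>)
        have "(\<integral>s. g x \<xi> s \<partial>lborel) = cis (x \<bullet> \<xi>) * (\<integral>s. complex_of_real (w s * atom m (\<xi> /\<^sub>R sqrt s)) \<partial>lborel)"
          unfolding g_def by (rule integral_mult_right_zero)
        then show ?case using elim by (simp only: integral_complex_of_real)
      qed
    qed measurable
    also have "\<dots> = (\<integral>s. (\<integral>\<xi>. g x \<xi> s \<partial>lborel) \<partial>lborel)"
      by (rule lborel_pair.Fubini_integral[OF int, symmetric])
    also have "ennreal (norm \<dots>) \<le> (\<integral>\<^sup>+s. ennreal (norm (\<integral>\<xi>. g x \<xi> s \<partial>lborel)) \<partial>lborel)"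
      by (intro integral_norm_bound_ennreal lborel_pair.integrable_snd[OF int])
    also have "\<dots> = (\<integral>\<^sup>+s. ennreal (\<bar>w s\<bar> * sqrt s ^ DIM('a) * norm (atom_ft m (sqrt s *\<^sub>R x))) \<partial>lborel)"
    proof (rule nn_integral_cong)
      fix s :: real
      show "ennreal (norm (\<integral>\<xi>. g x \<xi> s \<partial>lborel)) = ennreal (\<bar>w s\<bar> * sqrt s ^ DIM('a) * norm (atom_ft m (sqrt s *\<^sub>R x)))"
        by (cases "s > 0") (simp_all add: inner norm_mult norm_power g0 w0)
    qed
    finally show ?thesis .
  qed
  have "(\<integral>\<^sup>+x. ennreal (norm (\<integral>\<xi>. cis (x \<bullet> \<xi>) * of_real (F \<xi>) \<partial>lborel)) \<partial>lborel)
     \<le> (\<integral>\<^sup>+x. (\<integral>\<^sup>+s. ennreal (\<bar>w s\<bar> * sqrt s ^ DIM('a) * norm (atom_ft m (sqrt s *\<^sub>R x))) \<partial>lborel) \<partial>(lborel :: 'a measure))"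
    by (intro nn_integral_mono pt)
  also have "\<dots> = (\<integral>\<^sup>+s. (\<integral>\<^sup>+x. ennreal (\<bar>w s\<bar> * sqrt s ^ DIM('a) * norm (atom_ft m (sqrt s *\<^sub>R x))) \<partial>(lborel :: 'a measure)) \<partial>lborel)"
    by (rule lborel_pair.Fubini'[symmetric]) measurable
  also have "\<dots> = (\<integral>\<^sup>+s. ennreal \<bar>w s\<bar> * A \<partial>lborel)"
  proof (rule nn_integral_cong)
    fix s :: real
    show "(\<integral>\<^sup>+x. ennreal (\<bar>w s\<bar> * sqrt s ^ DIM('a) * norm (atom_ft m (sqrt s *\<^sub>R x))) \<partial>(lborel :: 'a measure)) = ennreal \<bar>w s\<bar> * A"
    proof (cases "s > 0")
      case True
      \<comment> \<open>The change of variables absorbs \<open>sqrt s ^ n\<close>, so the outer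
        integral is that of \<open>int1\<close> times a constant.\<close>
      have "A = ennreal (sqrt s ^ DIM('a)) * (\<integral>\<^sup>+x. ennreal (norm (atom_ft m (sqrt s *\<^sub>R x))) \<partial>(lborel :: 'a measure))"
        unfolding A_def using True by (intro lborel_nn_integral_scaleR) auto
      then have "ennreal \<bar>w s\<bar> * A = ennreal (\<bar>w s\<bar> * sqrt s ^ DIM('a)) * (\<integral>\<^sup>+x. ennreal (norm (atom_ft m (sqrt s *\<^sub>R x))) \<partial>(lborel :: 'a measure))"
        using True by (simp add: ennreal_mult mult.assoc)
      also have "\<dots> = (\<integral>\<^sup>+x. ennreal (\<bar>w s\<bar> * sqrt s ^ DIM('a)) * ennreal (norm (atom_ft m (sqrt s *\<^sub>R x))) \<partial>(lborel :: 'a measure))"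
        by (rule nn_integral_cmult[symmetric]) auto
      finally show ?thesis using True by (simp add: ennreal_mult[symmetric])
    qed (simp add: w0)
  qed
  also have "\<dots> = (\<integral>\<^sup>+s. ennreal \<bar>w s\<bar> \<partial>lborel) * A"
    by (rule nn_integral_multc) auto
  also have "\<dots> < \<infinity>"
    using int1 A by (simp add: ennreal_mult_less_top)
  finally show ?thesis .
qed

text \<open>One family for both estimates, \<open>\<kappa> = 0\<close> being the heat kernel. Since
  \<open>0 powr 0 = 0\<close>, the symbol with \<open>\<kappa> = 0\<close> has the value
  \<open>0\<close> instead of 1 at the origin, so comparisons with the heat symbol hold only almost
  everywhere.\<close>

definition symbol :: "real \<Rightarrow> real \<Rightarrow> real \<Rightarrow> 'a::euclidean_space \<Rightarrow> real" where
  "symbol \<kappa> \<alpha> t \<xi> = norm \<xi> powr \<kappa> * exp (- t * norm \<xi> powr (2 * \<alpha>))"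

lemma symbol_measurable [measurable]: "symbol \<kappa> \<alpha> t \<in> borel_measurable borel"
  unfolding symbol_def by measurable

lemma symbol_integrable:
  assumes "\<alpha> > 0" "\<kappa> \<ge> 0"
  shows "integrable lborel (symbol \<kappa> \<alpha> 1 :: 'a::euclidean_space \<Rightarrow> real)"
proof (rule integrableI_bounded)
  \<comment> \<open>The \<open>k\<close> additional powers of decay absorb the growth of
    \<open>|\<xi>|^\<kappa>\<close> and leave the integrable weight of exponent
    \<open>2n\<close>.\<close>
  define k where "k = nat \<lceil>\<kappa>\<rceil>"
  have k: "\<kappa> \<le> k" unfolding k_def by linarith
  obtain C where C: "C > 0" "\<And>s::real. s \<ge> 0 \<Longrightarrow> exp (- (s powr (2 * \<alpha>))) \<le> C * inverse ((1 + s) ^ (2 * DIM('a) + k))"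
    by (rule exp_powr_le_inverse_power[of "2 * \<alpha>" "2 * DIM('a) + k"]) (use assms in auto)
  have "symbol \<kappa> \<alpha> 1 \<xi> \<le> C * inverse ((1 + norm \<xi>) ^ (2 * DIM('a)))" for \<xi> :: 'a
  proof -
    have "norm \<xi> powr \<kappa> \<le> (1 + norm \<xi>) powr \<kappa>" using assms by (intro powr_mono2) auto
    also have "\<dots> \<le> (1 + norm \<xi>) powr k" using k by (intro powr_mono) auto
    also have "\<dots> = (1 + norm \<xi>) ^ k" by (rule powr_realpow) (simp add: add_pos_nonneg)
    finally have "symbol \<kappa> \<alpha> 1 \<xi> \<le> (1 + norm \<xi>) ^ k * (C * inverse ((1 + norm \<xi>) ^ (2 * DIM('a) + k)))"
      unfolding symbol_def using C(2)[of "norm \<xi>"] by (intro mult_mono) auto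
    also have "\<dots> = C * inverse ((1 + norm \<xi>) ^ (2 * DIM('a)))"
      using add_pos_nonneg[of 1 "norm \<xi>"] by (simp add: power_add field_simps)
    finally show ?thesis .
  qed
  then have "(\<integral>\<^sup>+\<xi>. ennreal (norm (symbol \<kappa> \<alpha> 1 \<xi>)) \<partial>(lborel :: 'a measure)) \<le>
      (\<integral>\<^sup>+\<xi>. ennreal C * ennreal (inverse ((1 + norm \<xi>) ^ (2 * DIM('a)))) \<partial>(lborel :: 'a measure))"
    using C by (intro nn_integral_mono) (simp add: ennreal_mult[symmetric] symbol_def)
  also have "\<dots> = ennreal C * (\<integral>\<^sup>+\<xi>. ennreal (inverse ((1 + norm \<xi>) ^ (2 * DIM('a)))) \<partial>(lborel :: 'a measure))"
    by (rule nn_integral_cmult) auto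
  also have "\<dots> < \<infinity>"
    using nn_integral_weight_finite[where 'a='a] by (simp add: ennreal_mult_less_top)
  finally show "(\<integral>\<^sup>+\<xi>. ennreal (norm (symbol \<kappa> \<alpha> 1 \<xi>)) \<partial>(lborel :: 'a measure)) < \<infinity>" .
qed measurable

text \<open>\<open>radial_taylor\<close> at \<open>u = |\<xi>|^2\<close> with
  \<open>\<beta> = \<kappa> / 2\<close> expresses the symbol as an integral of
  \<open>(s - |\<xi>|^2)_+^m\<close> over \<open>s\<close>, which is the representation that
  \<open>superposition_ft_integrable\<close> requires.\<close>

lemma symbol_ft_integrable:
  assumes "\<alpha> > 0" "\<kappa> \<ge> 0"
  shows "(\<integral>\<^sup>+x. ennreal (norm (\<integral>\<xi>. cis (x \<bullet> \<xi>) * of_real (symbol \<kappa> \<alpha> 1 \<xi>) \<partial>lborel)) \<partial>(lborel :: 'a::euclidean_space measure)) < \<infinity>"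
proof -
  \<comment> \<open>The smallest order for which \<open>atom_ft_decay\<close> applies.\<close>
  define m where "m = 2 * DIM('a) + 1"
  have m: "2 * DIM('a) < m" "m > 0" by (simp_all add: m_def)
  \<comment> \<open>The reciprocal of the constant in front of the value at \<open>u\<close> in
    \<open>radial_taylor\<close>.\<close>
  define c where "c = (- 1) ^ Suc m / fact m * (1::real)"
  define w where "w s = indicator {0<..} s * (c * (s powr m * radial_deriv (\<kappa> / 2) \<alpha> (Suc m) s))" for s
  \<comment> \<open>Needed for \<open>\<delta> = 0\<close>, the weight alone, and for
    \<open>\<delta> = n / 2\<close>, the weight times \<open>sqrt s ^ n\<close>.\<close>
  have w_int: "integrable lborel (\<lambda>s. w s * s powr \<delta>)" if "\<delta> \<ge> 0" for \<delta>
  proof -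
    have "set_integrable lborel {0<..} (\<lambda>s. c * (s powr (m + \<delta>) * radial_deriv (\<kappa> / 2) \<alpha> (Suc m) s))"
      using assms that by (intro set_integrable_mult_right set_integrable_radial_deriv) auto
    moreover have "w s * s powr \<delta> = indicator {0<..} s *\<^sub>R (c * (s powr (m + \<delta>) * radial_deriv (\<kappa> / 2) \<alpha> (Suc m) s))" for s
      by (simp add: w_def powr_add)
    ultimately show ?thesis by (simp add: set_integrable_def)
  qed
  show ?thesis
  proof (rule superposition_ft_integrable[OF _ _ _ _ m(1)])
    show [measurable]: "w \<in> borel_measurable borel" unfolding w_def by measurable
    show "w s = 0" if "s \<le> 0" for s using that by (simp add: w_def)
    have "(\<integral>\<^sup>+s. ennreal \<bar>w s\<bar> \<partial>lborel) = (\<integral>\<^sup>+s. ennreal (norm (w s * s powr 0)) \<partial>lborel)"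
      by (intro nn_integral_cong) (auto simp: w_def indicator_def)
    also have "\<dots> < \<infinity>" using w_int[of 0] by (simp add: integrable_iff_bounded)
    finally show "(\<integral>\<^sup>+s. ennreal \<bar>w s\<bar> \<partial>lborel) < \<infinity>" .
    have "(\<integral>\<^sup>+s. ennreal (\<bar>w s\<bar> * sqrt s ^ DIM('a)) \<partial>lborel) = (\<integral>\<^sup>+s. ennreal (norm (w s * s powr (DIM('a) / 2))) \<partial>lborel)"
    proof (intro nn_integral_cong)
      fix s :: real
      have "sqrt s ^ DIM('a) = s powr (DIM('a) / 2)" if "s > 0"
        using that by (simp add: powr_half_sqrt[symmetric] powr_powr powr_realpow[symmetric])
      then show "ennreal (\<bar>w s\<bar> * sqrt s ^ DIM('a)) = ennreal (norm (w s * s powr (DIM('a) / 2)))"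
        by (cases "s > 0") (auto simp: w_def abs_mult)
    qed
    also have "\<dots> < \<infinity>" using w_int[of "DIM('a) / 2"] by (simp add: integrable_iff_bounded)
    finally show "(\<integral>\<^sup>+s. ennreal (\<bar>w s\<bar> * sqrt s ^ DIM('a)) \<partial>lborel) < \<infinity>" .
    \<comment> \<open>The origin is left out because \<open>radial_taylor\<close> requires
      \<open>u > 0\<close>.\<close>
    show "AE \<xi>::'a in lborel. symbol \<kappa> \<alpha> 1 \<xi> = (\<integral>s. w s * atom m (\<xi> /\<^sub>R sqrt s) \<partial>lborel)"
      using AE_lborel_singleton[of 0]
    proof eventually_elim
      case (elim \<xi>)
      define l where "l = (norm \<xi>)\<^sup>2"
      have l: "l > 0" using elim by (simp add: l_def)
      have eq: "s powr m * atom m (\<xi> /\<^sub>R sqrt s) = indicator {l<..} s * (s - l) ^ m" if "s > 0" for s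
      proof -
        have "s * max 0 (1 - (norm (\<xi> /\<^sub>R sqrt s))\<^sup>2) = max 0 (s - l)"
        proof -
          have "(norm (\<xi> /\<^sub>R sqrt s))\<^sup>2 = l / s"
            using that by (simp add: l_def power_mult_distrib divide_inverse power_inverse mult.commute)
          moreover have "s * (1 - l / s) = s - l" using that by (simp add: field_simps)
          ultimately show ?thesis using that by (simp add: max_mult_distrib_left)
        qed
        then have "s powr m * atom m (\<xi> /\<^sub>R sqrt s) = max 0 (s - l) ^ m"
          using that by (simp add: atom_def powr_realpow power_mult_distrib[symmetric])
        also have "\<dots> = indicator {l<..} s * (s - l) ^ m"
          using m(2) by (auto simp: indicator_def max_def)
        finally show ?thesis .
      qed
      have "(\<integral>s. w s * atom m (\<xi> /\<^sub>R sqrt s) \<partial>lborel) = (\<integral>s. c * (indicator {l<..} s *\<^sub>R ((s - l) ^ m * radial_deriv (\<kappa> / 2) \<alpha> (Suc m) s)) \<partial>lborel)"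
      proof (intro Bochner_Integration.integral_cong refl)
        fix s :: real
        show "w s * atom m (\<xi> /\<^sub>R sqrt s) = c * (indicator {l<..} s *\<^sub>R ((s - l) ^ m * radial_deriv (\<kappa> / 2) \<alpha> (Suc m) s))"
        proof (cases "s > 0")
          case True
          then have "w s * atom m (\<xi> /\<^sub>R sqrt s) = c * radial_deriv (\<kappa> / 2) \<alpha> (Suc m) s * (s powr m * atom m (\<xi> /\<^sub>R sqrt s))"
            by (simp add: w_def)
          then show ?thesis unfolding eq[OF True] by simp
        qed (use l in \<open>simp add: w_def\<close>)
      qed
      also have "\<dots> = c * ((- 1) ^ Suc m * fact m * radial_deriv (\<kappa> / 2) \<alpha> 0 l)"
        using radial_taylor[of \<alpha> "\<kappa> / 2" l m] assms l by (simp add: set_lebesgue_integral_def)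
      also have "\<dots> = radial_deriv (\<kappa> / 2) \<alpha> 0 l"
        by (simp add: c_def power_mult_distrib[symmetric] field_simps)
      also have "\<dots> = symbol \<kappa> \<alpha> 1 \<xi>"
      proof -
        have "l = norm \<xi> powr 2" using elim by (simp add: l_def powr_numeral)
        then have "l powr a = norm \<xi> powr (2 * a)" for a
          by (simp only: powr_powr)
        from this[of "\<kappa> / 2"] this[of \<alpha>] show ?thesis
          by (simp add: radial_deriv_def symbol_def)
      qed
      finally show ?case by simp
    qed
  qed measurable
qed

section \<open>Fourier inversion\<close>

lemma integral_lborel_prod:
  fixes f :: "'a::euclidean_space \<Rightarrow> real \<Rightarrow> complex"
  assumes "\<And>b. b \<in> Basis \<Longrightarrow> integrable lborel (f b)"
  shows "(\<integral>x. (\<Prod>b\<in>Basis. f b (x \<bullet> b)) \<partial>(lborel :: 'a measure)) = (\<Prod>b\<in>Basis. (\<integral>u. f b u \<partial>lborel))"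
    and "integrable (lborel :: 'a measure) (\<lambda>x. \<Prod>b\<in>Basis. f b (x \<bullet> b))"
proof -
  interpret product_sigma_finite "\<lambda>_::'a. lborel :: real measure"
    by standard
  have [measurable]: "f b \<in> borel_measurable borel" if "b \<in> Basis" for b
    using borel_measurable_integrable[OF assms[OF that]] by simp
  have lb: "(lborel :: 'a measure) = distr (\<Pi>\<^sub>M b\<in>Basis. lborel) borel (\<lambda>f. \<Sum>b\<in>Basis. f b *\<^sub>R b)"
    unfolding lborel_def[where 'a='a] lborel_eq_real ..
  have meas: "(\<lambda>f. \<Sum>b\<in>Basis. f b *\<^sub>R b) \<in> measurable (\<Pi>\<^sub>M b\<in>(Basis::'a set). (lborel :: real measure)) (borel :: 'a measure)"
    by measurable
  have coord: "(\<Prod>b\<in>(Basis::'a set). f b ((\<Sum>b\<in>Basis. y b *\<^sub>R b) \<bullet> b)) = (\<Prod>b\<in>Basis. f b (y b))" for y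
    by (intro prod.cong refl) simp
  show "(\<integral>x. (\<Prod>b\<in>Basis. f b (x \<bullet> b)) \<partial>(lborel :: 'a measure)) = (\<Prod>b\<in>Basis. (\<integral>u. f b u \<partial>lborel))"
    unfolding lb by (subst integral_distr[OF meas]) (simp_all add: coord product_integral_prod assms)
  show "integrable (lborel :: 'a measure) (\<lambda>x. \<Prod>b\<in>Basis. f b (x \<bullet> b))"
    unfolding lb by (subst integrable_distr_eq[OF meas]) (simp_all add: coord product_integrable_prod assms)
qed

text \<open>Normalised to integral 1, so that its dilations form an approximate identity. It
  reproduces itself under the Fourier integral up to the factor \<open>(2 pi)^(n/2)\<close>, and
  therefore also serves as the damping factor.\<close>

definition gauss :: "'a::euclidean_space \<Rightarrow> real" where
  "gauss x = exp (- (norm x)\<^sup>2 / 2) / sqrt (2 * pi) ^ DIM('a)"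

lemma gauss_eq_prod: "gauss (x :: 'a::euclidean_space) = (\<Prod>b\<in>Basis. std_normal_density (x \<bullet> b))"
proof -
  have "(\<Prod>b\<in>(Basis :: 'a set). std_normal_density (x \<bullet> b)) = (\<Prod>b\<in>(Basis :: 'a set). 1 / sqrt (2 * pi)) * (\<Prod>b\<in>(Basis :: 'a set). exp (- (x \<bullet> b)\<^sup>2 / 2))"
    unfolding std_normal_density_def prod.distrib[symmetric] by (intro prod.cong) auto
  also have "(\<Prod>b\<in>(Basis :: 'a set). exp (- (x \<bullet> b)\<^sup>2 / 2)) = exp (\<Sum>b\<in>(Basis :: 'a set). - (x \<bullet> b)\<^sup>2 / 2)"
    by (simp add: exp_sum)
  also have "(\<Sum>b\<in>(Basis :: 'a set). - (x \<bullet> b)\<^sup>2 / 2) = - (norm x)\<^sup>2 / 2"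
    by (simp add: norm_eq_sqrt_inner[of x] euclidean_inner[of x x] sum_nonneg sum_divide_distrib[symmetric] sum_negf power2_eq_square)
  finally show ?thesis by (simp add: gauss_def power_divide)
qed

lemma cis_sum: "finite A \<Longrightarrow> cis (\<Sum>b\<in>A. f b) = (\<Prod>b\<in>A. cis (f b))"
  by (induction rule: finite_induct) (auto simp: cis_mult[symmetric])

lemma gauss_nonneg [simp]: "0 \<le> gauss x"
  by (simp add: gauss_def)

lemma gauss_measurable [measurable]: "gauss \<in> borel_measurable borel"
  unfolding gauss_def by measurable

text \<open>Density and character both factor over the coordinates, which reduces the claim to the
  characteristic function of the standard normal distribution.\<close>

lemma gauss_ft:
  "(\<integral>y. cis (x \<bullet> y) * of_real (gauss y) \<partial>(lborel :: 'a::euclidean_space measure)) = of_real (exp (- (norm x)\<^sup>2 / 2))"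
  "integrable (lborel :: 'a measure) (\<lambda>y. cis (x \<bullet> y) * of_real (gauss y))"
proof -
  have 1: "cis (x \<bullet> y) * of_real (gauss y) = (\<Prod>b\<in>Basis. cis ((x \<bullet> b) * (y \<bullet> b)) * of_real (std_normal_density (y \<bullet> b)))" for y :: 'a
    by (simp add: gauss_eq_prod euclidean_inner[of x y] cis_sum prod.distrib)
  have int: "integrable lborel (\<lambda>u. cis (c * u) * of_real (std_normal_density u))" for c
  proof (rule Bochner_Integration.integrable_bound)
    show "integrable lborel std_normal_density" by simp
  qed (auto simp: norm_mult)
  have ft: "(\<integral>u. cis (c * u) * of_real (std_normal_density u) \<partial>lborel) = of_real (exp (- c\<^sup>2 / 2))" for c
  proof -
    have "char std_normal_distribution c = (\<integral>u. std_normal_density u *\<^sub>R iexp (c * u) \<partial>lborel)"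
      unfolding char_def by (rule integral_density) auto
    then show ?thesis
      unfolding char_std_normal_distribution
      by (simp add: scaleR_conv_of_real cis_conv_exp mult.commute)
  qed
  have "(\<integral>y. cis (x \<bullet> y) * of_real (gauss y) \<partial>(lborel :: 'a measure)) = (\<Prod>b\<in>(Basis::'a set). of_real (exp (- (x \<bullet> b)\<^sup>2 / 2)))"
    unfolding 1 by (subst integral_lborel_prod(1)[OF int]) (simp add: ft)
  also have "\<dots> = of_real (exp (\<Sum>b\<in>(Basis :: 'a set). - (x \<bullet> b)\<^sup>2 / 2))"
    by (simp add: exp_sum)
  also have "(\<Sum>b\<in>(Basis :: 'a set). - (x \<bullet> b)\<^sup>2 / 2) = - (norm x)\<^sup>2 / 2"
    by (simp add: norm_eq_sqrt_inner[of x] euclidean_inner[of x x] sum_nonneg sum_divide_distrib[symmetric] sum_negf power2_eq_square)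
  finally show "(\<integral>y. cis (x \<bullet> y) * of_real (gauss y) \<partial>(lborel :: 'a measure)) = of_real (exp (- (norm x)\<^sup>2 / 2))" .
  show "integrable (lborel :: 'a measure) (\<lambda>y. cis (x \<bullet> y) * of_real (gauss y))"
    unfolding 1 by (rule integral_lborel_prod(2)[OF int])
qed

lemma gauss_integral: "integrable lborel (gauss :: 'a::euclidean_space \<Rightarrow> real)" "(\<integral>y. gauss y \<partial>(lborel :: 'a measure)) = 1"
proof -
  have "integrable (lborel :: 'a measure) (\<lambda>y. complex_of_real (gauss y))"
    using gauss_ft(2)[of "0::'a"] by simp
  then show "integrable (lborel :: 'a measure) gauss" by (simp only: complex_of_real_integrable_eq)
  have "(\<integral>y. complex_of_real (gauss y) \<partial>(lborel :: 'a measure)) = 1"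
    using gauss_ft(1)[of "0::'a"] by simp
  then show "(\<integral>y. gauss y \<partial>(lborel :: 'a measure)) = 1"
    by (simp only: integral_complex_of_real of_real_eq_1_iff)
qed

lemma integrable_lborel_scaleR:
  fixes f :: "'a::euclidean_space \<Rightarrow> 'b::{banach, second_countable_topology}"
  assumes f: "integrable lborel f" and c: "c > 0"
  shows "integrable lborel (\<lambda>x. f (c *\<^sub>R x))"
proof -
  have [measurable]: "f \<in> borel_measurable borel" using borel_measurable_integrable[OF f] by simp
  have "ennreal (c ^ DIM('a)) * (\<integral>\<^sup>+x. ennreal (norm (f (c *\<^sub>R x))) \<partial>lborel) = (\<integral>\<^sup>+x. ennreal (norm (f x)) \<partial>lborel)"
    using c by (intro lborel_nn_integral_scaleR[symmetric]) auto
  also have "\<dots> < \<infinity>" using f by (simp add: integrable_iff_bounded)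
  finally have "(\<integral>\<^sup>+x. ennreal (norm (f (c *\<^sub>R x))) \<partial>lborel) < \<infinity>"
    using c by (auto simp: ennreal_mult_less_top)
  then show ?thesis by (intro integrableI_bounded) auto
qed

text \<open>Both sides are limits of the transform of the inverse transform damped by the Gaussian
  \<open>exp (-\<epsilon>\<^sup>2 |x|\<^sup>2 / 2)\<close>.\<close>

theorem fourier_inversion:
  fixes m :: "'a::euclidean_space \<Rightarrow> complex"
  assumes cont: "continuous_on UNIV m" and bdd: "\<And>\<xi>. norm (m \<xi>) \<le> B"
    and int: "integrable lborel m"
    and intK: "(\<integral>\<^sup>+x. ennreal (norm (\<integral>\<xi>. cis (x \<bullet> \<xi>) * m \<xi> \<partial>lborel)) \<partial>lborel) < \<infinity>"
  shows "(\<integral>x. cis (- (x \<bullet> \<xi>)) * (\<integral>\<eta>. cis (x \<bullet> \<eta>) * m \<eta> \<partial>lborel) \<partial>lborel) = (2 * pi) ^ DIM('a) * m \<xi>"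
proof -
  have m [measurable]: "m \<in> borel_measurable borel"
    using cont by (rule borel_measurable_continuous_onI)
  define K where "K x = (\<integral>\<eta>. cis (x \<bullet> \<eta>) * m \<eta> \<partial>lborel)" for x
  have [measurable]: "K \<in> borel_measurable borel" unfolding K_def by measurable
  have K: "integrable lborel K"
    using intK by (intro integrableI_bounded) (auto simp: K_def)
  define \<epsilon> :: "nat \<Rightarrow> real" where "\<epsilon> k = 1 / (k + 1)" for k
  have \<epsilon>: "\<epsilon> k > 0" for k by (auto simp: \<epsilon>_def)
  have \<epsilon>0: "\<epsilon> \<longlonglongrightarrow> 0" unfolding \<epsilon>_def by real_asymp
  \<comment> \<open>The peak of \<open>gauss\<close> is \<open>1 / c\<close>. One factor
    \<open>c\<close> turns \<open>gauss\<close> into a damping factor tending to 1, the second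
    arises from its transform; together they give \<open>(2 pi)^n\<close>.\<close>
  define c where "c = sqrt (2 * pi) ^ DIM('a)"
  have c: "c > 0" "c * c = (2 * pi) ^ DIM('a)"
    unfolding c_def power_mult_distrib[symmetric] by simp_all
  define D where "D k = (\<integral>x. cis (- (x \<bullet> \<xi>)) * K x * of_real (c * gauss (\<epsilon> k *\<^sub>R x)) \<partial>lborel)" for k
  have damp: "c * gauss x = exp (- (norm x)\<^sup>2 / 2)" for x :: 'a
    by (simp add: gauss_def c_def)
  have lim1: "D \<longlonglongrightarrow> (\<integral>x. cis (- (x \<bullet> \<xi>)) * K x * of_real 1 \<partial>lborel)"
    unfolding D_def
  proof (rule integral_dominated_convergence[OF _ _ integrable_norm[OF K]])
    show "AE x in lborel. (\<lambda>k. cis (- (x \<bullet> \<xi>)) * K x * complex_of_real (c * gauss (\<epsilon> k *\<^sub>R x))) \<longlonglongrightarrow> cis (- (x \<bullet> \<xi>)) * K x * complex_of_real 1"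
    proof (rule always_eventually, rule allI)
      fix x :: 'a
      have "(\<lambda>k. exp (- (\<bar>\<epsilon> k\<bar> * norm x)\<^sup>2 / 2)) \<longlonglongrightarrow> exp (- (\<bar>0\<bar> * norm x)\<^sup>2 / 2)"
        by (intro tendsto_intros \<epsilon>0) auto
      then have "(\<lambda>k. c * gauss (\<epsilon> k *\<^sub>R x)) \<longlonglongrightarrow> 1"
        unfolding damp by simp
      then show "(\<lambda>k. cis (- (x \<bullet> \<xi>)) * K x * complex_of_real (c * gauss (\<epsilon> k *\<^sub>R x))) \<longlonglongrightarrow> cis (- (x \<bullet> \<xi>)) * K x * complex_of_real 1"
        by (intro tendsto_intros)
    qed
    show "AE x in lborel. norm (cis (- (x \<bullet> \<xi>)) * K x * complex_of_real (c * gauss (\<epsilon> k *\<^sub>R x))) \<le> norm (K x)" for k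
      unfolding damp by (auto simp: norm_mult mult_left_le)
  qed measurable
  \<comment> \<open>After Fubini the integral over \<open>x\<close> is a Gaussian in
    \<open>\<eta>\<close> of width \<open>\<epsilon> k\<close> around \<open>\<xi>\<close>; the
    substitution \<open>\<eta> = \<xi> + \<epsilon> k u\<close> makes it a mean of \<open>m\<close>
    near \<open>\<xi>\<close>.\<close>
  have D_eq: "D k = (c * c) * (\<integral>u. m (\<xi> + \<epsilon> k *\<^sub>R u) * of_real (gauss u) \<partial>lborel)" for k
  proof -
    let ?e = "\<epsilon> k"
    define f where "f x \<eta> = cis (x \<bullet> (\<eta> - \<xi>)) * m \<eta> * of_real (c * gauss (?e *\<^sub>R x))" for x \<eta>
    have [measurable]: "case_prod f \<in> borel_measurable (borel \<Otimes>\<^sub>M borel)"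
      unfolding f_def by measurable
    have "integrable (lborel \<Otimes>\<^sub>M lborel) (\<lambda>(x, \<eta>). of_real (c * gauss (?e *\<^sub>R x)) * m \<eta>)"
    proof (rule lborel_pair.Fubini_integrable)
      have "integrable lborel (\<lambda>x. \<bar>c * gauss (?e *\<^sub>R x)\<bar> * (\<integral>\<eta>. norm (m \<eta>) \<partial>lborel))"
        using integrable_lborel_scaleR[OF gauss_integral(1) \<epsilon>[of k]]
        by (intro integrable_mult_left integrable_abs integrable_mult_right)
      then show "integrable lborel (\<lambda>x. \<integral>\<eta>. norm (case (x, \<eta>) of (x, \<eta>) \<Rightarrow> of_real (c * gauss (?e *\<^sub>R x)) * m \<eta>) \<partial>lborel)"
        by (simp only: prod.case norm_mult norm_of_real integral_mult_right_zero)
      show "AE x in lborel. integrable lborel (\<lambda>\<eta>. case (x, \<eta>) of (x, \<eta>) \<Rightarrow> of_real (c * gauss (?e *\<^sub>R x)) * m \<eta>)"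
        using int by simp
    qed measurable
    then have intf: "integrable (lborel \<Otimes>\<^sub>M lborel) (case_prod f)"
      by (rule Bochner_Integration.integrable_bound) (auto simp: f_def norm_mult)
    have "D k = (\<integral>x. (\<integral>\<eta>. f x \<eta> \<partial>lborel) \<partial>lborel)"
      unfolding D_def
    proof (intro Bochner_Integration.integral_cong refl)
      fix x :: 'a
      have "cis (- (x \<bullet> \<xi>)) * K x * of_real (c * gauss (?e *\<^sub>R x)) = (cis (- (x \<bullet> \<xi>)) * of_real (c * gauss (?e *\<^sub>R x))) * K x"
        by simp
      also have "\<dots> = (\<integral>\<eta>. (cis (- (x \<bullet> \<xi>)) * of_real (c * gauss (?e *\<^sub>R x))) * (cis (x \<bullet> \<eta>) * m \<eta>) \<partial>lborel)"
        unfolding K_def by (rule integral_mult_right_zero[symmetric])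
      also have "\<dots> = (\<integral>\<eta>. f x \<eta> \<partial>lborel)"
      proof (intro Bochner_Integration.integral_cong refl)
        fix \<eta>
        have "cis (x \<bullet> (\<eta> - \<xi>)) = cis (- (x \<bullet> \<xi>)) * cis (x \<bullet> \<eta>)"
          by (simp add: cis_mult inner_diff_right)
        then show "(cis (- (x \<bullet> \<xi>)) * of_real (c * gauss (?e *\<^sub>R x))) * (cis (x \<bullet> \<eta>) * m \<eta>) = f x \<eta>"
          by (simp add: f_def mult_ac)
      qed
      finally show "cis (- (x \<bullet> \<xi>)) * K x * of_real (c * gauss (?e *\<^sub>R x)) = (\<integral>\<eta>. f x \<eta> \<partial>lborel)" .
    qed
    also have "\<dots> = (\<integral>\<eta>. (\<integral>x. f x \<eta> \<partial>lborel) \<partial>lborel)"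
      by (rule lborel_pair.Fubini_integral[OF intf, symmetric])
    also have "\<dots> = (\<integral>\<eta>. (c * c) * inverse (?e ^ DIM('a)) * (m \<eta> * of_real (gauss ((\<eta> - \<xi>) /\<^sub>R ?e))) \<partial>lborel)"
    proof (intro Bochner_Integration.integral_cong refl)
      fix \<eta> :: 'a
      have [simp]: "?e * (inverse ?e * z) = z" for z using \<epsilon>[of k] by (simp add: mult.assoc[symmetric])
      have "(\<integral>x. f x \<eta> \<partial>lborel) = (\<integral>x. (m \<eta> * c) * (cis (((\<eta> - \<xi>) /\<^sub>R ?e) \<bullet> (?e *\<^sub>R x)) * of_real (gauss (?e *\<^sub>R x))) \<partial>lborel)"
        using \<epsilon>[of k] by (intro Bochner_Integration.integral_cong refl) (simp add: f_def inner_commute mult_ac)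
      also have "\<dots> = (m \<eta> * c) * (\<integral>x. cis (((\<eta> - \<xi>) /\<^sub>R ?e) \<bullet> (?e *\<^sub>R x)) * of_real (gauss (?e *\<^sub>R x)) \<partial>lborel)"
        by (rule integral_mult_right_zero)
      also have "(\<integral>x. cis (((\<eta> - \<xi>) /\<^sub>R ?e) \<bullet> (?e *\<^sub>R x)) * of_real (gauss (?e *\<^sub>R x)) \<partial>lborel) = inverse (?e ^ DIM('a)) *\<^sub>R of_real (exp (- (norm ((\<eta> - \<xi>) /\<^sub>R ?e))\<^sup>2 / 2))"
        unfolding gauss_ft(1)[symmetric] using \<epsilon>[of k]
        by (intro lborel_integral_scaleR[of "\<lambda>x. cis (((\<eta> - \<xi>) /\<^sub>R ?e) \<bullet> x) * of_real (gauss x)"]) auto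
      also have "(m \<eta> * c) * (inverse (?e ^ DIM('a)) *\<^sub>R of_real (exp (- (norm ((\<eta> - \<xi>) /\<^sub>R ?e))\<^sup>2 / 2))) = (c * c) * inverse (?e ^ DIM('a)) * (m \<eta> * of_real (gauss ((\<eta> - \<xi>) /\<^sub>R ?e)))"
        unfolding damp[symmetric] by (simp add: scaleR_conv_of_real mult_ac)
      finally show "(\<integral>x. f x \<eta> \<partial>lborel) = (c * c) * inverse (?e ^ DIM('a)) * (m \<eta> * of_real (gauss ((\<eta> - \<xi>) /\<^sub>R ?e)))" .
    qed
    also have "\<dots> = (c * c) * (inverse (?e ^ DIM('a)) *\<^sub>R (\<integral>\<eta>. m \<eta> * of_real (gauss ((\<eta> - \<xi>) /\<^sub>R ?e)) \<partial>lborel))"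
      unfolding integral_mult_right_zero by (simp add: scaleR_conv_of_real)
    also have "(\<integral>\<eta>. m \<eta> * of_real (gauss ((\<eta> - \<xi>) /\<^sub>R ?e)) \<partial>lborel) = (\<integral>\<eta>. m (\<xi> + \<eta>) * of_real (gauss ((\<xi> + \<eta> - \<xi>) /\<^sub>R ?e)) \<partial>lborel)"
      by (intro lborel_integral_translate[symmetric, of "\<lambda>\<eta>. m \<eta> * of_real (gauss ((\<eta> - \<xi>) /\<^sub>R ?e))"]) measurable
    also have "inverse (?e ^ DIM('a)) *\<^sub>R \<dots> = (\<integral>u. m (\<xi> + ?e *\<^sub>R u) * of_real (gauss ((\<xi> + ?e *\<^sub>R u - \<xi>) /\<^sub>R ?e)) \<partial>lborel)"
      using \<epsilon>[of k] by (intro lborel_integral_scaleR[symmetric, of "\<lambda>\<eta>. m (\<xi> + \<eta>) * of_real (gauss ((\<xi> + \<eta> - \<xi>) /\<^sub>R ?e))"]) auto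
    also have "\<dots> = (\<integral>u. m (\<xi> + ?e *\<^sub>R u) * of_real (gauss u) \<partial>lborel)"
      using \<epsilon>[of k] by (intro Bochner_Integration.integral_cong refl) simp
    finally show ?thesis .
  qed
  have "(\<lambda>k. \<integral>u. m (\<xi> + \<epsilon> k *\<^sub>R u) * of_real (gauss u) \<partial>lborel) \<longlonglongrightarrow> (\<integral>u. m \<xi> * of_real (gauss u) \<partial>(lborel :: 'a measure))"
  proof (rule integral_dominated_convergence[where w="\<lambda>u::'a. B * gauss u"])
    show "integrable lborel (\<lambda>u::'a. B * gauss u)" by (intro integrable_mult_right gauss_integral)
    show "AE u in lborel. (\<lambda>k. m (\<xi> + \<epsilon> k *\<^sub>R u) * complex_of_real (gauss u)) \<longlonglongrightarrow> m \<xi> * complex_of_real (gauss u)"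
    proof (rule always_eventually, rule allI)
      fix u :: 'a
      have "(\<lambda>k. \<xi> + \<epsilon> k *\<^sub>R u) \<longlonglongrightarrow> \<xi> + 0 *\<^sub>R u" by (intro tendsto_intros \<epsilon>0)
      moreover have "isCont m \<xi>" using cont by (simp add: continuous_on_eq_continuous_at)
      ultimately have "(\<lambda>k. m (\<xi> + \<epsilon> k *\<^sub>R u)) \<longlonglongrightarrow> m \<xi>"
        by (intro isCont_tendsto_compose[of \<xi> m]) auto
      then show "(\<lambda>k. m (\<xi> + \<epsilon> k *\<^sub>R u) * complex_of_real (gauss u)) \<longlonglongrightarrow> m \<xi> * complex_of_real (gauss u)"
        by (intro tendsto_intros)
    qed
    show "AE u in lborel. norm (m (\<xi> + \<epsilon> k *\<^sub>R u) * complex_of_real (gauss u)) \<le> B * gauss u" for k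
      using bdd by (auto simp: norm_mult intro!: mult_right_mono)
  qed measurable
  also have "(\<integral>u. m \<xi> * of_real (gauss u) \<partial>(lborel :: 'a measure)) = m \<xi>"
    by (simp add: gauss_integral integral_complex_of_real)
  finally have "D \<longlonglongrightarrow> (c * c) * m \<xi>"
    unfolding D_eq by (intro tendsto_intros)
  from LIMSEQ_unique[OF lim1 this] show ?thesis
    by (simp add: K_def c(2) flip: of_real_mult)
qed

section \<open>Scaling of the kernels\<close>

definition symbol_kernel :: "real \<Rightarrow> real \<Rightarrow> real \<Rightarrow> 'a::euclidean_space \<Rightarrow> complex" where
  "symbol_kernel \<kappa> \<alpha> t = inv_fourier (\<lambda>\<xi>. of_real (symbol \<kappa> \<alpha> t \<xi>))"

lemma symbol_kernel_lborel:
  "symbol_kernel \<kappa> \<alpha> t (x :: 'a::euclidean_space) =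
    (\<integral>\<xi>. cis (x \<bullet> \<xi>) * of_real (symbol \<kappa> \<alpha> t \<xi>) \<partial>lborel) / of_real ((2 * pi) ^ DIM('a))"
  unfolding symbol_kernel_def inv_fourier_def by (subst integral_completion) auto

lemma symbol_kernel_measurable [measurable]: "symbol_kernel \<kappa> \<alpha> t \<in> borel_measurable borel"
  unfolding symbol_kernel_lborel[abs_def] by measurable

lemma symbol_scale:
  assumes "\<alpha> > 0" "t > 0"
  shows "symbol \<kappa> \<alpha> t \<xi> = t powr (- \<kappa> / (2 * \<alpha>)) * symbol \<kappa> \<alpha> 1 (t powr (1 / (2 * \<alpha>)) *\<^sub>R \<xi>)"
proof -
  have "(t powr (1 / (2 * \<alpha>)) * norm \<xi>) powr \<kappa> = t powr (\<kappa> / (2 * \<alpha>)) * norm \<xi> powr \<kappa>"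
    using assms by (simp add: powr_mult powr_powr)
  moreover have "(t powr (1 / (2 * \<alpha>)) * norm \<xi>) powr (2 * \<alpha>) = t * norm \<xi> powr (2 * \<alpha>)"
    using assms by (simp add: powr_mult powr_powr)
  moreover have "t powr (- \<kappa> / (2 * \<alpha>)) * t powr (\<kappa> / (2 * \<alpha>)) = 1"
    using assms by (simp add: powr_add[symmetric])
  ultimately show ?thesis
    by (simp add: symbol_def mult.assoc[symmetric])
qed

lemma symbol_integrable_scaled:
  assumes "\<alpha> > 0" "\<kappa> \<ge> 0" "t > 0"
  shows "integrable lborel (symbol \<kappa> \<alpha> t :: 'a::euclidean_space \<Rightarrow> real)"
  unfolding symbol_scale[OF assms(1,3), abs_def]
  using assms by (intro integrable_mult_right integrable_lborel_scaleR symbol_integrable) auto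

lemma symbol_kernel_scale:
  assumes "\<alpha> > 0" "t > 0"
  shows "symbol_kernel \<kappa> \<alpha> t (x :: 'a::euclidean_space) =
    of_real (t powr (- \<kappa> / (2 * \<alpha>)) * t powr (- (real DIM('a) / (2 * \<alpha>)))) * symbol_kernel \<kappa> \<alpha> 1 (x /\<^sub>R t powr (1 / (2 * \<alpha>)))"
proof -
  define s where "s = t powr (1 / (2 * \<alpha>))"
  have s: "s > 0" using assms by (simp add: s_def)
  have sn: "inverse (s ^ DIM('a)) = t powr (- (real DIM('a) / (2 * \<alpha>)))"
    using assms by (simp add: s_def powr_minus powr_powr powr_realpow[symmetric])
  have "(\<integral>\<xi>. cis (x \<bullet> \<xi>) * of_real (symbol \<kappa> \<alpha> t \<xi>) \<partial>lborel)
      = (\<integral>\<xi>. of_real (t powr (- \<kappa> / (2 * \<alpha>))) * (cis ((x /\<^sub>R s) \<bullet> (s *\<^sub>R \<xi>)) * of_real (symbol \<kappa> \<alpha> 1 (s *\<^sub>R \<xi>))) \<partial>lborel)"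
  proof -
    have "(x /\<^sub>R s) \<bullet> (s *\<^sub>R \<xi>) = x \<bullet> \<xi>" for \<xi>
      using s by (simp add: field_simps)
    then show ?thesis
      by (intro Bochner_Integration.integral_cong refl)
        (simp only: symbol_scale[OF assms, of \<kappa>, folded s_def] of_real_mult mult_ac)
  qed
  also have "\<dots> = of_real (t powr (- \<kappa> / (2 * \<alpha>))) * (\<integral>\<xi>. cis ((x /\<^sub>R s) \<bullet> (s *\<^sub>R \<xi>)) * of_real (symbol \<kappa> \<alpha> 1 (s *\<^sub>R \<xi>)) \<partial>lborel)"
    by (rule integral_mult_right_zero)
  also have "(\<integral>\<xi>. cis ((x /\<^sub>R s) \<bullet> (s *\<^sub>R \<xi>)) * of_real (symbol \<kappa> \<alpha> 1 (s *\<^sub>R \<xi>)) \<partial>lborel)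
     = inverse (s ^ DIM('a)) *\<^sub>R (\<integral>\<xi>. cis ((x /\<^sub>R s) \<bullet> \<xi>) * of_real (symbol \<kappa> \<alpha> 1 \<xi>) \<partial>lborel)"
    using s by (intro lborel_integral_scaleR[of "\<lambda>\<xi>. cis ((x /\<^sub>R s) \<bullet> \<xi>) * of_real (symbol \<kappa> \<alpha> 1 \<xi>)"]) auto
  finally show ?thesis
    unfolding symbol_kernel_lborel sn by (simp add: s_def scaleR_conv_of_real)
qed

text \<open>By scaling only \<open>t = 1\<close> matters: there the supremum is bounded by the
  integral of the symbol, and the L1 norm is finite by \<open>symbol_ft_integrable\<close>. The
  dilation factor \<open>t^(-n/(2\<alpha>))\<close> survives in the supremum and cancels in the L1
  norm.\<close>

lemma symbol_kernel_bounds: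
  assumes "\<alpha> > 0" "\<kappa> \<ge> 0"
  obtains D where "D > 0"
    "\<And>t x. t > 0 \<Longrightarrow> norm (symbol_kernel \<kappa> \<alpha> t (x :: 'a::euclidean_space)) \<le> D * t powr (- \<kappa> / (2 * \<alpha>)) * t powr (- (real DIM('a) / (2 * \<alpha>)))"
    "\<And>t. t > 0 \<Longrightarrow> (\<integral>\<^sup>+x. ennreal (norm (symbol_kernel \<kappa> \<alpha> t x)) \<partial>(lborel :: 'a measure)) \<le> ennreal (D * t powr (- \<kappa> / (2 * \<alpha>)))"
proof -
  define c where "c = (2 * pi) ^ DIM('a)"
  have c: "c > 0" by (simp add: c_def)
  define A where "A = (\<integral>\<xi>. symbol \<kappa> \<alpha> 1 \<xi> \<partial>(lborel :: 'a measure)) / c"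
  have sup: "norm (symbol_kernel \<kappa> \<alpha> 1 x) \<le> A" for x :: 'a
  proof -
    have "norm (\<integral>\<xi>. cis (x \<bullet> \<xi>) * of_real (symbol \<kappa> \<alpha> 1 \<xi>) \<partial>lborel) \<le> (\<integral>\<xi>. norm (cis (x \<bullet> \<xi>) * complex_of_real (symbol \<kappa> \<alpha> 1 \<xi>)) \<partial>lborel)"
      by (rule integral_norm_bound)
    also have "\<dots> = A * c"
      using c by (simp add: norm_mult A_def symbol_def)
    finally show ?thesis
      unfolding symbol_kernel_lborel c_def[symmetric] norm_divide norm_of_real using c by (simp add: field_simps)
  qed
  define B where "B = (\<integral>\<^sup>+x. ennreal (norm (symbol_kernel \<kappa> \<alpha> 1 x)) \<partial>(lborel :: 'a measure))"
  have "B = (\<integral>\<^sup>+x. ennreal (inverse c) * ennreal (norm (\<integral>\<xi>. cis (x \<bullet> \<xi>) * of_real (symbol \<kappa> \<alpha> 1 \<xi>) \<partial>lborel)) \<partial>(lborel :: 'a measure))"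
    unfolding B_def symbol_kernel_lborel c_def[symmetric] using c
    by (intro nn_integral_cong) (simp add: norm_mult norm_inverse divide_inverse mult.commute flip: ennreal_mult)
  also have "\<dots> = ennreal (inverse c) * (\<integral>\<^sup>+x. ennreal (norm (\<integral>\<xi>. cis (x \<bullet> \<xi>) * of_real (symbol \<kappa> \<alpha> 1 \<xi>) \<partial>lborel)) \<partial>(lborel :: 'a measure))"
    by (rule nn_integral_cmult) measurable
  also have "\<dots> < \<infinity>"
    using symbol_ft_integrable[OF assms, where 'a='a] by (simp add: ennreal_mult_less_top)
  finally obtain b where b: "B = ennreal b" "b \<ge> 0" by (cases B) auto
  \<comment> \<open>A common constant for both bounds; the summand 1 makes it positive.\<close>
  define D where "D = A + b + 1"
  have A0: "A \<ge> 0" using sup[of 0] norm_ge_zero order_trans by blast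
  have D: "D > 0" "A \<le> D" "b \<le> D" using A0 b(2) by (auto simp: D_def)
  show ?thesis
  proof (rule that[OF D(1)])
    fix t :: real assume t: "t > 0"
    define s where "s = t powr (1 / (2 * \<alpha>))"
    have s: "s > 0" using t by (simp add: s_def)
    let ?T = "t powr (- \<kappa> / (2 * \<alpha>))" and ?S = "t powr (- (real DIM('a) / (2 * \<alpha>)))"
    have sn: "s ^ DIM('a) * ?S = 1"
    proof -
      have "s ^ DIM('a) = t powr (real DIM('a) / (2 * \<alpha>))"
        using t by (simp add: s_def powr_powr powr_realpow[symmetric])
      then show ?thesis using t by (simp add: powr_minus)
    qed
    have norm_eq: "norm (symbol_kernel \<kappa> \<alpha> t x) = ?T * ?S * norm (symbol_kernel \<kappa> \<alpha> 1 (x /\<^sub>R s))" for x :: 'a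
      by (subst symbol_kernel_scale[OF assms(1) t]) (simp add: norm_mult s_def)
    show "norm (symbol_kernel \<kappa> \<alpha> t x) \<le> D * ?T * ?S" for x :: 'a
    proof -
      have "?T * ?S * norm (symbol_kernel \<kappa> \<alpha> 1 (x /\<^sub>R s)) \<le> ?T * ?S * D"
        using order_trans[OF sup D(2)] by (intro mult_left_mono) auto
      then show ?thesis unfolding norm_eq by (simp add: mult_ac)
    qed
    have "(\<integral>\<^sup>+x. ennreal (norm (symbol_kernel \<kappa> \<alpha> t x)) \<partial>(lborel :: 'a measure))
       = ennreal (s ^ DIM('a)) * (\<integral>\<^sup>+x. ennreal (norm (symbol_kernel \<kappa> \<alpha> t (s *\<^sub>R x))) \<partial>(lborel :: 'a measure))"
      using s by (intro lborel_nn_integral_scaleR) auto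
    also have "(\<integral>\<^sup>+x. ennreal (norm (symbol_kernel \<kappa> \<alpha> t (s *\<^sub>R x))) \<partial>(lborel :: 'a measure))
       = (\<integral>\<^sup>+x. ennreal (?T * ?S) * ennreal (norm (symbol_kernel \<kappa> \<alpha> 1 x)) \<partial>(lborel :: 'a measure))"
      unfolding norm_eq using s by (intro nn_integral_cong) (simp flip: ennreal_mult)
    also have "\<dots> = ennreal (?T * ?S) * B"
      unfolding B_def by (rule nn_integral_cmult) measurable
    also have "ennreal (s ^ DIM('a)) * (ennreal (?T * ?S) * B) = ennreal (?T * b)"
    proof -
      have "s ^ DIM('a) * (?T * ?S * b) = ?T * b * (s ^ DIM('a) * ?S)" by simp
      then have "s ^ DIM('a) * (?T * ?S * b) = ?T * b" unfolding sn by simp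
      then show ?thesis using s b by (simp flip: ennreal_mult)
    qed
    also have "\<dots> \<le> ennreal (D * ?T)"
      using D(3) by (intro ennreal_leI) (simp add: mult.commute mult_right_mono)
    finally show "(\<integral>\<^sup>+x. ennreal (norm (symbol_kernel \<kappa> \<alpha> t x)) \<partial>(lborel :: 'a measure)) \<le> ennreal (D * ?T)" .
  qed
qed

lemma heat_kernel_eq_symbol_kernel: "heat_kernel \<alpha> t = (symbol_kernel 0 \<alpha> t :: 'a::euclidean_space \<Rightarrow> complex)"
proof
  fix x :: 'a
  have "(\<integral>\<xi>. cis (x \<bullet> \<xi>) * of_real (exp (- t * norm \<xi> powr (2 * \<alpha>))) \<partial>lebesgue) = (\<integral>\<xi>. cis (x \<bullet> \<xi>) * complex_of_real (symbol 0 \<alpha> t \<xi>) \<partial>lebesgue)"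
  proof (rule integral_cong_AE)
    have "AE \<xi>::'a in lebesgue. \<xi> \<noteq> 0"
      using AE_lborel_singleton by (rule AE_completion)
    then show "AE \<xi> in lebesgue. cis (x \<bullet> \<xi>) * of_real (exp (- t * norm \<xi> powr (2 * \<alpha>))) = cis (x \<bullet> \<xi>) * complex_of_real (symbol 0 \<alpha> t \<xi>)"
      by eventually_elim (simp add: symbol_def)
  qed (auto intro!: measurable_completion)
  then show "heat_kernel \<alpha> t x = symbol_kernel 0 \<alpha> t x"
    by (simp add: heat_kernel_def symbol_kernel_def inv_fourier_def)
qed

text \<open>Inversion is applied to the continuous symbol \<open>m\<close>, with value 1 at the
  origin, rather than to \<open>symbol 0 \<alpha> t\<close>. Both have the same inverse transform,
  so the integrability results carry over.\<close>

lemma fourier_heat_kernel: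
  assumes "\<alpha> > 0" "t > 0"
  shows "fourier (heat_kernel \<alpha> t) (\<xi> :: 'a::euclidean_space) = of_real (exp (- t * norm \<xi> powr (2 * \<alpha>)))"
proof -
  define c where "c = complex_of_real ((2 * pi) ^ DIM('a))"
  have c: "c \<noteq> 0" by (simp add: c_def)
  define m where "m \<xi> = complex_of_real (exp (- t * norm \<xi> powr (2 * \<alpha>)))" for \<xi> :: 'a
  have [measurable]: "m \<in> borel_measurable borel" unfolding m_def by measurable
  have AE: "AE \<xi>::'a in lborel. complex_of_real (symbol 0 \<alpha> t \<xi>) = m \<xi>"
    using AE_lborel_singleton[of 0] by eventually_elim (simp add: symbol_def m_def)
  have K: "(\<integral>\<eta>. cis (x \<bullet> \<eta>) * m \<eta> \<partial>lborel) = c * heat_kernel \<alpha> t x" for x :: 'a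
  proof -
    have "(\<integral>\<eta>. cis (x \<bullet> \<eta>) * m \<eta> \<partial>lborel) = (\<integral>\<eta>. cis (x \<bullet> \<eta>) * complex_of_real (symbol 0 \<alpha> t \<eta>) \<partial>lborel)"
      using AE by (intro integral_cong_AE) auto
    then show ?thesis using c by (simp add: heat_kernel_eq_symbol_kernel symbol_kernel_lborel c_def)
  qed
  have [measurable]: "heat_kernel \<alpha> t \<in> borel_measurable (borel :: 'a measure)"
    unfolding heat_kernel_eq_symbol_kernel by measurable
  have "(\<integral>x. cis (- (x \<bullet> \<xi>)) * (\<integral>\<eta>. cis (x \<bullet> \<eta>) * m \<eta> \<partial>lborel) \<partial>lborel) = (2 * pi) ^ DIM('a) * m \<xi>"
  proof (rule fourier_inversion[where B=1])
    show "continuous_on UNIV m"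
      unfolding m_def using assms by (intro continuous_intros continuous_on_powr') auto
    show "norm (m \<xi>) \<le> 1" for \<xi> using assms by (simp add: m_def)
    have "integrable lborel (\<lambda>\<xi>::'a. complex_of_real (symbol 0 \<alpha> t \<xi>))"
      using symbol_integrable_scaled[OF assms(1) _ assms(2), of 0, where 'a='a] by (simp add: complex_of_real_integrable_eq)
    then show "integrable lborel m"
      by (rule integrable_cong_AE_imp) (use AE in \<open>auto elim: eventually_mono\<close>)
    obtain D where D: "(\<integral>\<^sup>+x. ennreal (norm (symbol_kernel 0 \<alpha> t x)) \<partial>(lborel :: 'a measure)) \<le> ennreal (D * t powr (- 0 / (2 * \<alpha>)))"
      using symbol_kernel_bounds[OF assms(1) order_refl[of 0], where 'a='a] assms(2) by metis
    have "(\<integral>\<^sup>+x. ennreal (norm (\<integral>\<eta>. cis (x \<bullet> \<eta>) * m \<eta> \<partial>lborel)) \<partial>lborel) = (\<integral>\<^sup>+x. ennreal (norm c) * ennreal (norm (symbol_kernel 0 \<alpha> t x)) \<partial>(lborel :: 'a measure))"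
      unfolding K by (intro nn_integral_cong) (simp add: heat_kernel_eq_symbol_kernel norm_mult ennreal_mult)
    also have "\<dots> = ennreal (norm c) * (\<integral>\<^sup>+x. ennreal (norm (symbol_kernel 0 \<alpha> t x)) \<partial>(lborel :: 'a measure))"
      by (rule nn_integral_cmult) measurable
    also have "\<dots> < \<infinity>" using D by (auto simp: ennreal_mult_less_top intro: le_less_trans)
    finally show "(\<integral>\<^sup>+x. ennreal (norm (\<integral>\<eta>. cis (x \<bullet> \<eta>) * m \<eta> \<partial>lborel)) \<partial>lborel) < \<infinity>" .
  qed
  then have "(\<integral>x. c * (cis (- (x \<bullet> \<xi>)) * heat_kernel \<alpha> t x) \<partial>lborel) = c * m \<xi>"
    unfolding K by (simp add: c_def mult_ac)
  then have "(\<integral>x. cis (- (x \<bullet> \<xi>)) * heat_kernel \<alpha> t x \<partial>lborel) = m \<xi>"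
    using c by simp
  then show ?thesis
    unfolding fourier_def m_def by (subst integral_completion) auto
qed

lemma frac_laplacian_heat_kernel:
  assumes "\<alpha> > 0" "t > 0"
  shows "frac_laplacian (\<kappa> / 2) (heat_kernel \<alpha> t) = (symbol_kernel \<kappa> \<alpha> t :: 'a::euclidean_space \<Rightarrow> complex)"
  unfolding frac_laplacian_def fourier_multiplier_def symbol_kernel_def
  by (simp add: fourier_heat_kernel[OF assms] symbol_def)

section \<open>Smoothing and embedding of Lebesgue spaces\<close>

text \<open>Convexity: the tangent of \<open>x^q\<close> at \<open>a\<close> lies below the graph.
  It follows from Young's inequality with weights \<open>1 / q\<close> and
  \<open>1 - 1 / q\<close>.\<close>

lemma powr_tangent:
  fixes a x q :: real
  assumes "a \<ge> 0" "x \<ge> 0" "q \<ge> 1"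
  shows "q * a powr (q - 1) * x \<le> x powr q + (q - 1) * a powr q"
proof (cases "a = 0 \<or> x = 0")
  case False
  have "(x powr q) powr (1 / q) * (a powr q) powr (1 - 1 / q) \<le> 1 / q * x powr q + (1 - 1 / q) * a powr q"
    using assms False by (intro Youngs_inequality_0) auto
  moreover have "(x powr q) powr (1 / q) = x" "(a powr q) powr (1 - 1 / q) = a powr (q - 1)"
    using assms False by (simp_all add: powr_powr right_diff_distrib)
  ultimately have "q * (x * a powr (q - 1)) \<le> q * (1 / q * x powr q + (1 - 1 / q) * a powr q)"
    using assms by (intro mult_left_mono) auto
  also have "\<dots> = x powr q + (q - 1) * a powr q"
    using assms by (simp add: field_simps)
  finally show ?thesis by (simp add: mult_ac)
qed (use assms in auto)

text \<open>Integrate the tangent inequality at \<open>a\<close> against \<open>k\<close>: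
  \<open>a = 1\<close> shows that the mean is finite, and the mean itself as \<open>a\<close> gives
  the estimate. Total mass below 1 is enough because the constant term \<open>(q - 1) a^q\<close> is
  nonnegative.\<close>

lemma nn_integral_jensen_powr:
  fixes k f :: "'b \<Rightarrow> real"
  assumes [measurable]: "k \<in> borel_measurable M" "f \<in> borel_measurable M"
    and nn: "\<And>y. 0 \<le> k y" "\<And>y. 0 \<le> f y"
    and k: "(\<integral>\<^sup>+y. ennreal (k y) \<partial>M) \<le> 1" and q: "q \<ge> 1"
    and fin: "(\<integral>\<^sup>+y. ennreal (k y * f y powr q) \<partial>M) < \<infinity>"
  shows "(\<integral>\<^sup>+y. ennreal (k y * f y) \<partial>M) < \<infinity>"
    "ennreal (enn2real (\<integral>\<^sup>+y. ennreal (k y * f y) \<partial>M) powr q) \<le> (\<integral>\<^sup>+y. ennreal (k y * f y powr q) \<partial>M)"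
proof -
  define U where "U = (\<integral>\<^sup>+y. ennreal (k y * f y) \<partial>M)"
  define W where "W = (\<integral>\<^sup>+y. ennreal (k y * f y powr q) \<partial>M)"
  define N where "N = (\<integral>\<^sup>+y. ennreal (k y) \<partial>M)"
  have tangent: "ennreal (q * a powr (q - 1)) * U \<le> W + ennreal ((q - 1) * a powr q) * N" if a: "a \<ge> 0" for a
  proof -
    have "ennreal (q * a powr (q - 1)) * U = (\<integral>\<^sup>+y. ennreal (q * a powr (q - 1)) * ennreal (k y * f y) \<partial>M)"
      unfolding U_def by (rule nn_integral_cmult[symmetric]) measurable
    also have "\<dots> \<le> (\<integral>\<^sup>+y. ennreal (k y * f y powr q) + ennreal ((q - 1) * a powr q) * ennreal (k y) \<partial>M)"
    proof (rule nn_integral_mono)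
      fix y
      have "k y * (q * a powr (q - 1) * f y) \<le> k y * (f y powr q + (q - 1) * a powr q)"
        by (intro mult_left_mono powr_tangent nn a q)
      then have "(q * a powr (q - 1)) * (k y * f y) \<le> k y * f y powr q + ((q - 1) * a powr q) * k y"
        by (simp add: algebra_simps)
      from ennreal_leI[OF this]
      show "ennreal (q * a powr (q - 1)) * ennreal (k y * f y) \<le> ennreal (k y * f y powr q) + ennreal ((q - 1) * a powr q) * ennreal (k y)"
        using nn[of y] q by (simp add: ennreal_mult)
    qed
    also have "\<dots> = W + ennreal ((q - 1) * a powr q) * N"
      unfolding W_def N_def by (subst nn_integral_add) (auto simp: nn_integral_cmult)
    finally show ?thesis .
  qed
  have "ennreal q * U \<le> W + ennreal (q - 1) * N"
    using tangent[of 1] by simp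
  also have "\<dots> < \<infinity>"
    using fin k unfolding W_def[symmetric] N_def[symmetric]
    by (auto simp: ennreal_mult_less_top intro: le_less_trans)
  finally have U: "U < \<infinity>" using q by (auto simp: ennreal_mult_less_top)
  then show "U < \<infinity>" .
  obtain u where u: "U = ennreal u" "u \<ge> 0" using U by (cases U) auto
  obtain w where w: "W = ennreal w" "w \<ge> 0" using fin unfolding W_def[symmetric] by (cases W) auto
  have "ennreal (q * u powr q) = ennreal (q * u powr (q - 1)) * U"
  proof -
    have "u powr q = u powr (q - 1) * u"
      using u(2) by (cases "u = 0") (auto simp: powr_diff)
    then show ?thesis using u q by (simp add: mult.assoc flip: ennreal_mult)
  qed
  also have "\<dots> \<le> W + ennreal ((q - 1) * u powr q) * N" by (rule tangent[OF u(2)])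
  also have "\<dots> \<le> W + ennreal ((q - 1) * u powr q) * 1"
    using k unfolding N_def[symmetric] by (intro add_left_mono mult_left_mono) auto
  also have "\<dots> = ennreal (w + (q - 1) * u powr q)"
    using w q by simp
  finally have "q * u powr q \<le> w + (q - 1) * u powr q"
    using w q by (subst (asm) ennreal_le_iff) auto
  then have "u powr q \<le> w" by (simp add: algebra_simps)
  then show "ennreal (enn2real U powr q) \<le> W" using u w by (simp add: ennreal_leI)
qed

section \<open>Monotonicity of \<open>\<omega>\<close>, convolution and embedding\<close>

lemma omega_measurable [measurable (raw)]:
  assumes [measurable]: "p \<in> borel_measurable M" "f \<in> borel_measurable M"
  shows "(\<lambda>x. \<omega> (p x) (f x)) \<in> borel_measurable M"
  unfolding \<omega>_def by measurable

lemma omega_mono: "0 \<le> s \<Longrightarrow> s \<le> t \<Longrightarrow> \<omega> p s \<le> \<omega> p t"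
  by (auto simp: \<omega>_def intro!: ennreal_leI powr_mono2)

lemma omega_zero [simp]: "\<omega> p 0 = 0"
  by (simp add: \<omega>_def)

lemma enn2real_mono_finite: "p \<le> q \<Longrightarrow> q \<noteq> \<infinity> \<Longrightarrow> enn2real p \<le> enn2real q"
  by (rule enn2real_mono) (auto simp: top.not_eq_extremum)

lemma omega_mono_exponent:
  assumes "t > 1" "p \<le> q"
  shows "\<omega> p t \<le> \<omega> q t"
  using assms by (auto simp: \<omega>_def top_unique intro!: ennreal_leI powr_mono enn2real_mono_finite)

lemma omega_antimono_exponent:
  assumes "0 \<le> t" "t \<le> 1" "p \<le> q"
  shows "\<omega> q t \<le> \<omega> p t"
  using assms by (auto simp: \<omega>_def top_unique intro!: ennreal_leI powr_mono' enn2real_mono_finite)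

text \<open>No Young inequality is needed: by Jensen \<open>U\<^sup>q\<close> is bounded by \<open>S\<close> and has integral at most \<open>1\<close>,
  and \<open>U\<^sup>P = U\<^sup>P\<^sup>-\<^sup>q U\<^sup>q\<close>.\<close>

lemma nn_convolution_smoothing:
  fixes k f :: "'a::euclidean_space \<Rightarrow> real" and q P :: ennreal
  assumes [measurable]: "k \<in> borel_measurable borel" "f \<in> borel_measurable borel"
    and nn: "\<And>y. 0 \<le> k y" "\<And>y. 0 \<le> f y"
    and k: "(\<integral>\<^sup>+y. ennreal (k y) \<partial>lborel) \<le> 1" "\<And>y. k y \<le> S" and S: "S > 0"
    and q: "1 \<le> q" "q \<le> P"
    and f: "(\<integral>\<^sup>+y. \<omega> q (f y) \<partial>lborel) \<le> 1"
  defines "U \<equiv> \<lambda>x. \<integral>\<^sup>+y. ennreal (k (x - y) * f y) \<partial>lborel"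
  shows "U x < \<infinity>"
    and "(\<integral>\<^sup>+x. \<omega> P (enn2real (U x) / S powr (recip q - recip P)) \<partial>lborel) \<le> 1"
proof -
  have [measurable]: "U \<in> borel_measurable borel" unfolding U_def by measurable
  have kx: "(\<integral>\<^sup>+y. ennreal (k (x - y)) \<partial>lborel) \<le> 1" for x
  proof -
    have "(\<integral>\<^sup>+y. ennreal (k (x - y)) \<partial>lborel) = (\<integral>\<^sup>+y. ennreal (k y) \<partial>lborel)"
    proof -
      have "(\<integral>\<^sup>+y. ennreal (k y) \<partial>lborel) = (\<integral>\<^sup>+y. ennreal (k y) \<partial>density (distr lborel borel (\<lambda>y. x + (-1) *\<^sub>R y)) (\<lambda>_. ennreal (\<bar>-1\<bar> ^ DIM('a))))"
        by (subst lborel_affine[of "-1" x]) auto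
      also have "\<dots> = (\<integral>\<^sup>+y. ennreal (k (x - y)) \<partial>lborel)"
        by (simp add: density_1 nn_integral_distr)
      finally show ?thesis ..
    qed
    then show ?thesis using k(1) by simp
  qed
  have "(\<forall>x. U x < \<infinity>) \<and> (\<integral>\<^sup>+x. \<omega> P (enn2real (U x) / S powr (recip q - recip P)) \<partial>lborel) \<le> 1"
  proof (cases "q = \<infinity>")
    case True
    \<comment> \<open>Both reciprocals are \<open>0\<close>, so the normalising power of
      \<open>S\<close> is 1 and the modular only tests \<open>U \<le> 1\<close>.\<close>
    then have P: "P = \<infinity>" using q by (simp add: top_unique)
    have "AE y in lborel. \<omega> q (f y) \<noteq> \<infinity>"
      using f by (intro nn_integral_PInf_AE) (auto simp: top_unique)
    then have AE: "AE y in lborel. f y \<le> 1"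
      using True by (auto elim!: eventually_mono simp: \<omega>_def split: if_splits)
    have U1: "U x \<le> 1" for x
    proof -
      have "U x \<le> (\<integral>\<^sup>+y. ennreal (k (x - y)) \<partial>lborel)"
        unfolding U_def
        by (intro nn_integral_mono_AE) (use AE in eventually_elim, auto intro!: ennreal_leI mult_left_le nn)
      with kx[of x] show ?thesis by simp
    qed
    moreover have "enn2real (U x) \<le> 1" for x
      using enn2real_mono[OF U1, of x] by simp
    moreover have "U x < \<infinity>" for x by (rule le_less_trans[OF U1]) simp
    ultimately show ?thesis
      using True P S by (auto simp: \<omega>_def)
  next
    case False
    define q' where "q' = enn2real q"
    have q': "q = ennreal q'" "q' \<ge> 1"
    proof -
      show eq: "q = ennreal q'" using False by (simp add: q'_def top.not_eq_extremum)
      have "ennreal 1 \<le> ennreal q'" using q(1) unfolding eq by simp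
      then show "q' \<ge> 1" by (subst (asm) ennreal_le_iff2) auto
    qed
    have rq: "recip q = 1 / q'"
      using q' by (simp add: inverse_ennreal divide_inverse)
    have om: "\<omega> q s = ennreal (s powr q')" for s using False by (simp add: \<omega>_def q'_def)
    \<comment> \<open>The convolution of \<open>k\<close> with \<open>f powr q'\<close>. It
      majorises \<open>U powr q'\<close>, is at most \<open>S\<close> because
      \<open>k \<le> S\<close>, and has integral at most 1 because both factors have.\<close>
    define W where "W x = (\<integral>\<^sup>+y. ennreal (k (x - y) * f y powr q') \<partial>lborel)" for x
    have WS: "W x \<le> ennreal S" for x
    proof -
      have "W x \<le> (\<integral>\<^sup>+y. ennreal S * ennreal (f y powr q') \<partial>lborel)"
        unfolding W_def using k(2) S
        by (intro nn_integral_mono) (auto simp: mult_right_mono intro!: ennreal_leI simp flip: ennreal_mult)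
      also have "\<dots> = ennreal S * (\<integral>\<^sup>+y. \<omega> q (f y) \<partial>lborel)"
        unfolding om by (rule nn_integral_cmult) measurable
      also have "\<dots> \<le> ennreal S * 1" by (intro mult_left_mono f) auto
      finally show ?thesis by simp
    qed
    have fin: "W x < \<infinity>" for x by (rule le_less_trans[OF WS]) simp
    have UW: "U x < \<infinity>" "ennreal (enn2real (U x) powr q') \<le> W x" for x
      unfolding U_def W_def
      by (rule nn_integral_jensen_powr[OF _ _ _ _ kx q'(2) fin[unfolded W_def]]; simp add: nn)+
    have W1: "(\<integral>\<^sup>+x. W x \<partial>lborel) \<le> 1"
    proof -
      have "(\<integral>\<^sup>+x. W x \<partial>lborel) = (\<integral>\<^sup>+y. (\<integral>\<^sup>+x. ennreal (k (x - y) * f y powr q') \<partial>lborel) \<partial>lborel)"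
        unfolding W_def by (rule lborel_pair.Fubini'[symmetric]) measurable
      also have "\<dots> = (\<integral>\<^sup>+y. ennreal (f y powr q') * (\<integral>\<^sup>+x. ennreal (k (- y + x)) \<partial>lborel) \<partial>lborel)"
      proof (rule nn_integral_cong)
        fix y
        have "(\<integral>\<^sup>+x. ennreal (k (x - y) * f y powr q') \<partial>lborel) = (\<integral>\<^sup>+x. ennreal (f y powr q') * ennreal (k (- y + x)) \<partial>lborel)"
          by (intro nn_integral_cong) (simp add: nn mult.commute flip: ennreal_mult)
        also have "\<dots> = ennreal (f y powr q') * (\<integral>\<^sup>+x. ennreal (k (- y + x)) \<partial>lborel)"
          by (rule nn_integral_cmult) measurable
        finally show "(\<integral>\<^sup>+x. ennreal (k (x - y) * f y powr q') \<partial>lborel) = ennreal (f y powr q') * (\<integral>\<^sup>+x. ennreal (k (- y + x)) \<partial>lborel)" .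
      qed
      also have "\<dots> \<le> (\<integral>\<^sup>+y. ennreal (f y powr q') * 1 \<partial>lborel)"
      proof (intro nn_integral_mono mult_left_mono)
        fix y
        show "(\<integral>\<^sup>+x. ennreal (k (- y + x)) \<partial>lborel) \<le> 1"
          using k(1) by (subst lborel_nn_integral_translate[of "\<lambda>x. ennreal (k x)"]) auto
      qed auto
      also have "\<dots> \<le> 1" using f by (simp add: om)
      finally show ?thesis .
    qed
    have uS: "enn2real (U x) powr q' \<le> S" for x
      using order_trans[OF UW(2) WS] S by (subst (asm) ennreal_le_iff) auto
    have usup: "enn2real (U x) \<le> S powr (1 / q')" for x
    proof -
      have "(enn2real (U x) powr q') powr (1 / q') \<le> S powr (1 / q')"
        using uS q' by (intro powr_mono2) auto
      then show ?thesis using q' by (simp add: powr_powr)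
    qed
    \<comment> \<open>For \<open>P = \<infinity>\<close> the normalising factor is the supremum
      bound \<open>usup\<close> itself and the left-hand side is \<open>0\<close>. For finite
      \<open>P\<close> the surplus \<open>U powr (P' - q')\<close> is at most the denominator, by
      the same bound.\<close>
    have "\<omega> P (enn2real (U x) / S powr (recip q - recip P)) \<le> W x" for x
    proof (cases "P = \<infinity>")
      case True
      then show ?thesis using usup[of x] S by (simp add: \<omega>_def rq)
    next
      case False
      define P' where "P' = enn2real P"
      have P': "P = ennreal P'" using False by (simp add: P'_def top.not_eq_extremum)
      have "q' \<le> P'" using q(2) q' unfolding P' by (simp add: ennreal_le_iff2)
      then have P'q: "P' \<ge> q'" "P' > 0" using q' by auto
      have rP: "recip P = 1 / P'"
        using P'q unfolding P' by (simp add: inverse_ennreal divide_inverse)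
      define u where "u = enn2real (U x)"
      have u: "u \<ge> 0" by (simp add: u_def)
      have "(u / S powr (1 / q' - 1 / P')) powr P' = u powr P' / S powr (P' / q' - 1)"
        using P'q u S by (simp add: powr_divide powr_powr left_diff_distrib)
      also have "u powr P' = u powr q' * u powr (P' - q')"
        by (simp add: powr_add[symmetric])
      also have "u powr (P' - q') \<le> (S powr (1 / q')) powr (P' - q')"
        using P'q usup[of x] u by (intro powr_mono2) (auto simp: u_def)
      also have "(S powr (1 / q')) powr (P' - q') = S powr (P' / q' - 1)"
        using q' by (simp add: powr_powr diff_divide_distrib)
      finally have "(u / S powr (1 / q' - 1 / P')) powr P' \<le> u powr q'"
        using S by (simp add: mult_left_mono divide_right_mono)
      then show ?thesis
        using UW(2)[of x] False by (auto simp: \<omega>_def rq rP P'_def[symmetric] u_def intro: order_trans[OF ennreal_leI])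
    qed
    then have "(\<integral>\<^sup>+x. \<omega> P (enn2real (U x) / S powr (recip q - recip P)) \<partial>lborel) \<le> (\<integral>\<^sup>+x. W x \<partial>lborel)"
      by (intro nn_integral_mono)
    with W1 UW(1) show ?thesis by auto
  qed
  then show "U x < \<infinity>" "(\<integral>\<^sup>+x. \<omega> P (enn2real (U x) / S powr (recip q - recip P)) \<partial>lborel) \<le> 1"
    by auto
qed

text \<open>Pointwise form of the embedding of \<open>L\<^sup>P\<close> into the space with exponent \<open>p(\<cdot>) \<le> P\<close>: with
  \<open>L = ln (e + |x|)\<close> and \<open>M\<close> large the second summand is integrable.\<close>

lemma omega_embedding:
  fixes p P :: ennreal
  assumes p: "1 \<le> p" "p \<le> P" and v: "0 \<le> v" and Q: "1 \<le> Q" and M: "0 \<le> M" and c: "0 \<le> c"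
    and L: "L > 0" and le: "recip p - recip P \<le> c / L"
  shows "\<omega> p (v / (Q * exp (M * c))) \<le> ennreal (1 / Q) * (\<omega> P v + ennreal (exp (- M * L)))"
proof (cases "p = \<infinity>")
  case True
  then have P: "P = \<infinity>" using p by (simp add: top_unique)
  have "v / (Q * exp (M * c)) \<le> 1" if "v \<le> 1"
  proof -
    have "1 * 1 \<le> Q * exp (M * c)" using Q M c by (intro mult_mono) auto
    with that Q show ?thesis by (simp add: divide_le_eq)
  qed
  then show ?thesis using True P Q by (auto simp: \<omega>_def ennreal_mult_top)
next
  case False
  define p' where "p' = enn2real p"
  have p': "p = ennreal p'" "p' \<ge> 1"
  proof -
    show eq: "p = ennreal p'" using False by (simp add: p'_def top.not_eq_extremum)
    have "ennreal 1 \<le> ennreal p'" using p(1) unfolding eq by simp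
    then show "p' \<ge> 1" by (subst (asm) ennreal_le_iff2) auto
  qed
  have rp: "recip p = 1 / p'"
    using p' by (simp add: inverse_ennreal divide_inverse)
  have lhs: "\<omega> p (v / (Q * exp (M * c))) = ennreal ((v / (Q * exp (M * c))) powr p')"
    using False by (simp add: \<omega>_def p'_def)
  \<comment> \<open>As \<open>Q \<ge> 1\<close> and \<open>p' \<ge> 1\<close>, the power
    \<open>(1 / Q) powr p'\<close> can be replaced by \<open>1 / Q\<close>, uniformly in the
    exponent.\<close>
  have split: "(v / (Q * exp (M * c))) powr p' \<le> (1 / Q) * (v powr p' * exp (- (M * c * p')))"
  proof -
    have "(v / (Q * exp (M * c))) powr p' = (1 / Q) powr p' * (v powr p' * exp (- (M * c * p')))"
      using v Q by (simp add: powr_divide powr_mult exp_powr_real exp_minus field_simps)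
    also have "(1 / Q) powr p' \<le> (1 / Q) powr 1"
      using Q p' by (intro powr_mono') auto
    finally show ?thesis using Q by (simp add: mult_right_mono)
  qed
  show ?thesis
  proof (cases "P = \<infinity>")
    case True
    show ?thesis
    proof (cases "v \<le> 1")
      case v1: True
      \<comment> \<open>Where \<open>P = \<infinity>\<close>, the logarithmic bound forces
        \<open>p' \<ge> L / c\<close>, so the scaling constant raised to \<open>p'\<close> is
        already as small as the error term.\<close>
      have "1 / p' \<le> c / L" using le unfolding rp True by simp
      then have "L \<le> c * p'" using p' L by (simp add: field_simps)
      then have "exp (- (M * c * p')) \<le> exp (- M * L)" using M by (simp add: mult.assoc mult_left_mono)
      moreover have "v powr p' \<le> 1" using v1 v p' by (intro powr_le1) auto
      ultimately have "v powr p' * exp (- (M * c * p')) \<le> 1 * exp (- M * L)"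
        by (intro mult_mono) auto
      then have "(1 / Q) * (v powr p' * exp (- (M * c * p'))) \<le> (1 / Q) * exp (- M * L)"
        using Q by (intro mult_left_mono) auto
      with split have "(v / (Q * exp (M * c))) powr p' \<le> (1 / Q) * exp (- M * L)" by linarith
      then show ?thesis using v1 True Q unfolding lhs
        by (simp add: \<omega>_def ennreal_leI flip: ennreal_mult)
    next
      case False
      then show ?thesis using True Q by (simp add: \<omega>_def ennreal_mult_top)
    qed
  next
    case P_fin: False
    define P' where "P' = enn2real P"
    have P': "P = ennreal P'" using P_fin by (simp add: P'_def top.not_eq_extremum)
    have "p' \<le> P'" using p(2) p' unfolding P' by (simp add: ennreal_le_iff2)
    then have P'p: "P' \<ge> p'" "P' > 0" using p' by auto
    have rP: "recip P = 1 / P'"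
      using P'p unfolding P' by (simp add: inverse_ennreal divide_inverse)
    \<comment> \<open>Young's inequality interpolates \<open>v powr p'\<close> between
      \<open>v powr P'\<close> and \<open>?h\<close> with weight \<open>?\<theta>\<close>. The price
      is \<open>?h\<close> to the power \<open>?\<theta> - 1\<close>, that is
      \<open>exp (M L (1 - ?\<theta>))\<close>, which the logarithmic bound keeps below
      \<open>exp (M c p')\<close>.\<close>
    let ?h = "exp (- M * L)" and ?\<theta> = "p' / P'"
    have th: "0 \<le> ?\<theta>" "?\<theta> \<le> 1" using P'p p' by auto
    have "v powr p' \<le> exp (M * c * p') * (v powr P' + ?h)"
    proof (cases "v = 0")
      case False
      then have v0: "v > 0" using v by simp
      have "(v powr P') powr ?\<theta> * ?h powr (1 - ?\<theta>) \<le> ?\<theta> * v powr P' + (1 - ?\<theta>) * ?h"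
        using th v0 by (intro Youngs_inequality_0) auto
      also have "\<dots> \<le> 1 * v powr P' + 1 * ?h"
        using th by (intro add_mono mult_right_mono) auto
      finally have 1: "v powr p' * ?h powr (1 - ?\<theta>) \<le> v powr P' + ?h"
        using P'p by (simp add: powr_powr)
      have "L * (1 - ?\<theta>) \<le> c * p'"
      proof -
        have "(1 / p' - 1 / P') * (L * p') \<le> c / L * (L * p')"
          using le L p' unfolding rp rP by (intro mult_right_mono) auto
        moreover have "(1 / p' - 1 / P') * (L * p') = L * (1 - ?\<theta>)"
          using p' P'p by (simp add: left_diff_distrib right_diff_distrib)
        moreover have "c / L * (L * p') = c * p'" using L by simp
        ultimately show ?thesis by simp
      qed
      then have "M * (L * (1 - ?\<theta>)) \<le> M * (c * p')" using M by (rule mult_left_mono)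
      then have 2: "1 \<le> exp (M * c * p') * ?h powr (1 - ?\<theta>)"
        by (simp add: exp_powr_real flip: exp_add)
      have "v powr p' * 1 \<le> v powr p' * (exp (M * c * p') * ?h powr (1 - ?\<theta>))"
        using 2 by (intro mult_left_mono) auto
      also have "\<dots> = exp (M * c * p') * (v powr p' * ?h powr (1 - ?\<theta>))" by simp
      also have "\<dots> \<le> exp (M * c * p') * (v powr P' + ?h)" by (intro mult_left_mono 1) auto
      finally show ?thesis by simp
    qed auto
    then have "v powr p' * exp (- (M * c * p')) \<le> v powr P' + ?h"
      by (simp add: exp_minus field_simps)
    then have "(1 / Q) * (v powr p' * exp (- (M * c * p'))) \<le> (1 / Q) * (v powr P' + ?h)"
      using Q by (intro mult_left_mono) auto
    with split have "(v / (Q * exp (M * c))) powr p' \<le> (1 / Q) * (v powr P' + ?h)" by linarith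
    then show ?thesis using P_fin Q unfolding lhs
      by (simp add: \<omega>_def P'_def ennreal_leI flip: ennreal_mult ennreal_plus)
  qed
qed

section \<open>Variable Lebesgue spaces\<close>

lemma completion_ex_borel_measurable_complex:
  fixes f :: "'b \<Rightarrow> complex"
  assumes "f \<in> borel_measurable (completion M)"
  obtains g where "g \<in> borel_measurable M" "AE x in M. f x = g x"
proof -
  have "(\<lambda>x. Re (f x)) \<in> borel_measurable (completion M)" "(\<lambda>x. Im (f x)) \<in> borel_measurable (completion M)"
    using assms by measurable
  then obtain a b where "a \<in> borel_measurable M" "AE x in M. Re (f x) = a x"
    "b \<in> borel_measurable M" "AE x in M. Im (f x) = b x"
    using completion_ex_borel_measurable_real by metis
  note [measurable] = this(1,3) and ae = this(2,4)
  show ?thesis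
  proof (rule that[of "\<lambda>x. of_real (a x) + \<i> * of_real (b x)"])
    show "AE x in M. f x = of_real (a x) + \<i> * of_real (b x)"
      using ae by eventually_elim (simp add: complex_eq_iff)
  qed measurable
qed

text \<open>A supremum in \<open>ennreal\<close> is reached along a sequence, so only countably many
  null sets are collected.\<close>

lemma AE_exp_minus:
  "AE x in lborel. exp_minus r \<le> r (x :: 'a::euclidean_space)"
proof -
  let ?A = "{c. AE x in lebesgue. c \<le> r (x :: 'a)}"
  have "0 \<in> ?A" by simp
  then have "?A \<noteq> {}" by blast
  then obtain f :: "nat \<Rightarrow> ennreal" where f: "range f \<subseteq> ?A" "Sup ?A = (SUP i. f i)"
    using ennreal_Sup_countable_SUP by meson
  then have "AE x in lebesgue. \<forall>i. f i \<le> r x"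
    unfolding AE_all_countable by auto
  then have "AE x in lborel. \<forall>i. f i \<le> r x" by (simp add: AE_completion_iff)
  then show ?thesis
    unfolding exp_minus_def f(2) by eventually_elim (auto intro: SUP_least)
qed

lemma AE_exp_plus: "AE x in lborel. r (x :: 'a::euclidean_space) \<le> exp_plus r"
  using esssup_AE[of r lebesgue] by (simp add: AE_completion_iff exp_plus_def)

lemma exponents_bounds:
  fixes r :: "'a::euclidean_space \<Rightarrow> ennreal"
  assumes "r \<in> exponents"
  shows "1 \<le> exp_minus r" "exp_minus r \<le> exp_plus r"
proof -
  have "AE x in lebesgue. 1 \<le> r x" using assms by (auto simp: exponents_def)
  then show "1 \<le> exp_minus r" unfolding exp_minus_def by (auto intro: Sup_upper)
  \<comment> \<open>An inequality between constants that holds almost everywhere is true, since the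
    measure is not zero.\<close>
  have "AE x in (lborel :: 'a measure). exp_minus r \<le> exp_plus r"
    using AE_exp_minus[of r] AE_exp_plus[of r] by eventually_elim auto
  moreover have "ae_filter (lborel :: 'a measure) \<noteq> bot"
    by (simp add: ae_filter_eq_bot_iff)
  ultimately show "exp_minus r \<le> exp_plus r"
    by (simp add: eventually_const)
qed

lemma ennreal_inverse_antimono: "p \<le> q \<Longrightarrow> inverse q \<le> inverse (p :: ennreal)"
  by (simp add: less_eq_ennreal.rep_eq inverse_ennreal.rep_eq ereal_inverse_antimono)

lemma ennreal_inverse_inverse [simp]: "inverse (inverse p) = (p :: ennreal)"
proof (cases p)
  case (real u)
  then show ?thesis by (cases "u = 0") (auto simp: inverse_ennreal)
qed simp

lemma recip_bounds: "1 \<le> p \<Longrightarrow> 0 \<le> recip p \<and> recip p \<le> 1"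
proof -
  assume "1 \<le> p"
  then have "inverse p \<le> inverse 1" by (rule ennreal_inverse_antimono)
  then show ?thesis using enn2real_mono[of "inverse p" 1] by simp
qed

lemma recip_antimono: "1 \<le> p \<Longrightarrow> p \<le> q \<Longrightarrow> recip q \<le> recip p"
proof (rule enn2real_mono)
  assume p: "1 \<le> p" "p \<le> q"
  show "inverse q \<le> inverse p" using p(2) by (rule ennreal_inverse_antimono)
  have "inverse p \<le> inverse 1" using p(1) by (rule ennreal_inverse_antimono)
  then show "inverse p < top" by (auto intro: le_less_trans)
qed

text \<open>The decay condition makes \<open>1/p\<close> converge to its constant
  \<open>g_inf\<close>, which identifies that constant with the limit in the definition of
  \<open>exp_infty\<close>. The limit passes between \<open>real\<close> and \<open>ennreal\<close>
  because \<open>p \<ge> 1\<close> keeps the inverses finite.\<close>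

lemma log_exponents_exp_infty:
  fixes p :: "'a::euclidean_space \<Rightarrow> ennreal"
  assumes "p \<in> log_exponents"
  obtains c where "c > 0" "\<And>x. recip (p x) - recip (exp_infty p) \<le> c / ln (exp 1 + norm x)"
proof -
  obtain c g where c: "c > 0" "\<And>x. \<bar>recip (p x) - g\<bar> \<le> c / ln (exp 1 + norm x)"
    using assms unfolding log_exponents_def globally_log_holder_def by blast
  have p1: "1 \<le> p x" for x using assms by (auto simp: log_exponents_def exponents_def)
  have inv: "inverse (p x) = ennreal (recip (p x))" for x
  proof -
    have "inverse (p x) \<le> inverse 1" using p1 by (rule ennreal_inverse_antimono)
    then have "inverse (p x) < top" by (auto intro: le_less_trans)
    then show ?thesis by simp
  qed
  have "((\<lambda>x::'a. c / ln (exp 1 + norm x)) \<longlongrightarrow> 0) at_infinity"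
  proof -
    have "((\<lambda>u. c / ln (exp 1 + u)) \<longlongrightarrow> 0) at_top" by real_asymp
    from filterlim_compose[OF this filterlim_norm_at_top] show ?thesis .
  qed
  then have "((\<lambda>x. recip (p x) - g) \<longlongrightarrow> 0) at_infinity"
    by (rule Lim_null_comparison[rotated]) (simp add: c(2))
  then have lim: "((\<lambda>x. recip (p x)) \<longlongrightarrow> g) at_infinity"
    by (simp add: LIM_zero_iff)
  have nt: "(at_infinity :: 'a filter) \<noteq> bot" by (simp add: trivial_limit_at_infinity)
  have g0: "g \<ge> 0" by (rule tendsto_lowerbound[OF lim _ nt]) simp
  have "((\<lambda>x. inverse (p x)) \<longlongrightarrow> ennreal g) at_infinity"
    using tendsto_ennrealI[OF lim] by (simp only: inv[symmetric])
  then have "Lim at_infinity (\<lambda>x. inverse (p x)) = ennreal g"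
    by (rule tendsto_Lim[OF nt])
  then have "recip (exp_infty p) = g"
    using g0 by (simp add: exp_infty_def)
  with c show ?thesis by (intro that[of c]) (auto simp: abs_le_iff)
qed

section \<open>From the modular to the Luxemburg norm\<close>

lemma omega_divide_le:
  assumes "1 \<le> p" "0 \<le> t" "N \<ge> 1"
  shows "\<omega> p (t / N) \<le> ennreal (1 / N) * \<omega> p t"
proof -
  show ?thesis
  proof (cases "p = \<infinity>")
    case True
    then show ?thesis using assms by (auto simp: \<omega>_def ennreal_mult_top divide_le_eq)
  next
    case False
    have p': "enn2real p \<ge> 1" using enn2real_mono_finite[OF assms(1)] False by simp
    have "(t / N) powr enn2real p = (1 / N) powr enn2real p * t powr enn2real p"
      using assms by (simp add: powr_divide)
    also have "\<dots> \<le> (1 / N) powr 1 * t powr enn2real p"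
      using assms p' by (intro mult_right_mono powr_mono') auto
    finally show ?thesis
      using False assms by (simp add: \<omega>_def ennreal_leI flip: ennreal_mult)
  qed
qed

text \<open>The infimum in the norm of \<open>\<phi>\<close> is over a nonempty set: dividing by
  \<open>max 1 m\<close> brings a finite modular \<open>m\<close> down to at most 1.\<close>

lemma modular_scale_le_one:
  assumes r: "r \<in> exponents" and \<phi>: "\<phi> \<in> var_Lp r"
  obtains l :: real where "l > 0" "modular r (\<lambda>x. \<phi> x / of_real l) \<le> 1"
proof -
  obtain l0 where l0: "l0 > 0" "modular r (\<lambda>x. of_real l0 * \<phi> x) < \<infinity>" and [measurable]: "\<phi> \<in> borel_measurable lebesgue"
    using \<phi> by (auto simp: var_Lp_def)
  have [measurable]: "r \<in> borel_measurable lebesgue" and r1: "\<And>x. 1 \<le> r x" using r by (auto simp: exponents_def)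
  obtain m where m: "modular r (\<lambda>x. of_real l0 * \<phi> x) = ennreal m" "m \<ge> 0"
    using l0(2) by (cases "modular r (\<lambda>x. of_real l0 * \<phi> x)") auto
  define N where "N = max 1 m"
  have N: "N \<ge> 1" "m \<le> N" by (auto simp: N_def)
  have "modular r (\<lambda>x. \<phi> x / of_real (N / l0)) \<le> (\<integral>\<^sup>+x. ennreal (1 / N) * \<omega> (r x) (norm (of_real l0 * \<phi> x)) \<partial>lebesgue)"
    unfolding modular_def
  proof (rule nn_integral_mono)
    fix x
    have "norm (\<phi> x / of_real (N / l0)) = norm (of_real l0 * \<phi> x) / N"
      using l0(1) N by (simp add: norm_divide norm_mult field_simps)
    then show "\<omega> (r x) (norm (\<phi> x / of_real (N / l0))) \<le> ennreal (1 / N) * \<omega> (r x) (norm (of_real l0 * \<phi> x))"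
      using omega_divide_le[OF r1 _ N(1)] by (metis norm_ge_zero)
  qed
  also have "\<dots> = ennreal (1 / N) * modular r (\<lambda>x. of_real l0 * \<phi> x)"
    unfolding modular_def by (rule nn_integral_cmult) measurable
  also have "\<dots> \<le> 1"
    using m N by (simp flip: ennreal_mult)
  finally show ?thesis using l0(1) N by (intro that[of "N / l0"]) auto
qed

text \<open>Reduction to the unit ball of the modular. Convolution commutes with division by
  \<open>l\<close>, so every \<open>l\<close> admissible for \<open>\<phi>\<close> makes
  \<open>\<Lambda> l\<close> admissible for \<open>k \<ast> \<phi>\<close>; the infimum over
  \<open>l\<close> gives the norm estimate.\<close>

lemma var_norm_bound_by_homogeneity:
  fixes k :: "'a::euclidean_space \<Rightarrow> complex"
  assumes r: "r \<in> exponents" and \<Lambda>: "\<Lambda> > 0" and \<phi>: "\<phi> \<in> var_Lp r"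
    and unit: "\<And>\<psi>. \<psi> \<in> borel_measurable lebesgue \<Longrightarrow> modular r \<psi> \<le> 1 \<Longrightarrow>
      k \<ast> \<psi> \<in> borel_measurable lebesgue \<and> modular p (\<lambda>x. (k \<ast> \<psi>) x / of_real \<Lambda>) \<le> 1"
  shows "k \<ast> \<phi> \<in> var_Lp p" "var_norm p (k \<ast> \<phi>) \<le> ennreal \<Lambda> * var_norm r \<phi>"
proof -
  have \<phi>_meas [measurable]: "\<phi> \<in> borel_measurable lebesgue" using \<phi> by (simp add: var_Lp_def)
  define A where "A = {l::real. l > 0 \<and> modular r (\<lambda>x. \<phi> x / of_real l) \<le> 1}"
  have hom: "k \<ast> (\<lambda>x. \<phi> x / of_real l) = (\<lambda>x. (k \<ast> \<phi>) x / of_real l)" for l :: real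
    by (simp add: convol_def fun_eq_iff)
  have step: "(\<lambda>x. (k \<ast> \<phi>) x / of_real l) \<in> borel_measurable lebesgue \<and> modular p (\<lambda>x. (k \<ast> \<phi>) x / of_real (\<Lambda> * l)) \<le> 1"
    if "l \<in> A" for l
    using unit[of "\<lambda>x. \<phi> x / of_real l"] that unfolding A_def hom by (simp add: mult.commute)
  obtain l where l: "l \<in> A" using modular_scale_le_one[OF r \<phi>] unfolding A_def by blast
  then have l0: "l > 0" by (simp add: A_def)
  show "k \<ast> \<phi> \<in> var_Lp p"
  proof -
    have "(\<lambda>x. of_real l * ((k \<ast> \<phi>) x / of_real l)) \<in> borel_measurable lebesgue"
      using step[OF l] by (intro borel_measurable_times borel_measurable_const) auto
    then have "k \<ast> \<phi> \<in> borel_measurable lebesgue" using l0 by simp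
    moreover have "modular p (\<lambda>x. of_real (1 / (\<Lambda> * l)) * (k \<ast> \<phi>) x) \<le> 1"
      using step[OF l] by simp
    then have "modular p (\<lambda>x. of_real (1 / (\<Lambda> * l)) * (k \<ast> \<phi>) x) < \<infinity>"
      by (rule le_less_trans) simp
    ultimately show ?thesis
      unfolding var_Lp_def using l0 \<Lambda> by (auto intro!: exI[of _ "1 / (\<Lambda> * l)"])
  qed
  have le: "var_norm p (k \<ast> \<phi>) \<le> ennreal \<Lambda> * ennreal l" if lA: "l \<in> A" for l
  proof -
    have "\<Lambda> * l > 0" using \<Lambda> lA by (simp add: A_def)
    then have "var_norm p (k \<ast> \<phi>) \<le> ennreal (\<Lambda> * l)"
      unfolding var_norm_def using step[OF lA] by (intro INF_lower) auto
    then show ?thesis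
      using lA \<Lambda> by (simp add: A_def ennreal_mult)
  qed
  \<comment> \<open>The factor \<open>\<Lambda>\<close> is moved to the left so that a lower bound
    of the infimum suffices, and then moved back.\<close>
  have cancel: "ennreal (1 / \<Lambda>) * (ennreal \<Lambda> * u) = u" "ennreal \<Lambda> * (ennreal (1 / \<Lambda>) * u) = u" for u
    using \<Lambda> by (simp_all add: mult.assoc[symmetric] flip: ennreal_mult)
  have "ennreal (1 / \<Lambda>) * var_norm p (k \<ast> \<phi>) \<le> (INF l\<in>A. ennreal l)"
  proof (rule INF_greatest)
    fix l assume "l \<in> A"
    from mult_left_mono[OF le[OF this], of "ennreal (1 / \<Lambda>)"]
    show "ennreal (1 / \<Lambda>) * var_norm p (k \<ast> \<phi>) \<le> ennreal l" by (simp only: cancel zero_le)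
  qed
  then have "ennreal \<Lambda> * (ennreal (1 / \<Lambda>) * var_norm p (k \<ast> \<phi>)) \<le> ennreal \<Lambda> * (INF l\<in>A. ennreal l)"
    by (rule mult_left_mono) simp
  then show "var_norm p (k \<ast> \<phi>) \<le> ennreal \<Lambda> * var_norm r \<phi>"
    unfolding cancel by (simp add: var_norm_def A_def)
qed

text \<open>A Lebesgue measurable \<open>\<phi>\<close> is replaced by a Borel function, so that
  joint measurability and Tonelli on \<open>lborel\<close> become available.\<close>

lemma convol_eq_lborel:
  fixes k \<phi> \<psi> :: "'a::euclidean_space \<Rightarrow> complex"
  assumes [measurable]: "k \<in> borel_measurable borel" "\<psi> \<in> borel_measurable borel"
    and AE: "AE y in lborel. \<phi> y = \<psi> y" and \<phi>: "\<phi> \<in> borel_measurable lebesgue"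
  shows "(k \<ast> \<phi>) x = (\<integral>y. k (x - y) * \<psi> y \<partial>lborel)"
proof -
  have "(k \<ast> \<phi>) x = (\<integral>y. k (x - y) * \<psi> y \<partial>lebesgue)"
    unfolding convol_def
  proof (rule integral_cong_AE)
    have "(\<lambda>y. k (x - y)) \<in> borel_measurable lebesgue"
      by (rule measurable_completion) measurable
    with \<phi> show "(\<lambda>y. k (x - y) * \<phi> y) \<in> borel_measurable lebesgue" by measurable
    show "(\<lambda>y. k (x - y) * \<psi> y) \<in> borel_measurable lebesgue"
      by (rule measurable_completion) measurable
    show "AE y in lebesgue. k (x - y) * \<phi> y = k (x - y) * \<psi> y"
      using AE_completion[OF AE] by eventually_elim simp
  qed
  also have "\<dots> = (\<integral>y. k (x - y) * \<psi> y \<partial>lborel)"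
    by (rule integral_completion) measurable
  finally show ?thesis .
qed

text \<open>\<open>A\<close> bounds the L1 norm and \<open>A * S\<close> the supremum, so
  \<open>norm (k x) / A\<close> is normalised as in \<open>nn_convolution_smoothing\<close>. The
  factor 2 pays for the two parts of \<open>\<phi>\<close>, and \<open>G\<close> for both powers of
  \<open>S\<close>. In the embedding the two parts contribute modular at most 1 each and the weight
  \<open>Q - 2\<close>; the total \<open>Q\<close> is compensated by the factor \<open>1 / Q\<close>
  of \<open>omega_embedding\<close>.\<close>

lemma modular_convol_le_one:
  fixes k :: "'a::euclidean_space \<Rightarrow> complex" and p r :: "'a \<Rightarrow> ennreal" and P :: ennreal
  assumes [measurable]: "k \<in> borel_measurable borel"
    and A: "A > 0" and S: "S > 0"
    and k_sup: "\<And>x. norm (k x) \<le> A * S"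
    and k_int: "(\<integral>\<^sup>+x. ennreal (norm (k x)) \<partial>lborel) \<le> ennreal A"
    and r: "r \<in> exponents" and rP: "exp_plus r \<le> P"
    and p1: "\<And>x. 1 \<le> p x" and pP: "AE x in lborel. p x \<le> P"
    and c: "c \<ge> 0" and log: "\<And>x. recip (p x) - recip P \<le> c / ln (exp 1 + norm x)"
    and G: "S powr (recip (exp_minus r) - recip P) \<le> G" "S powr (recip (exp_plus r) - recip P) \<le> G"
    and Q: "(\<integral>\<^sup>+x. ennreal (inverse ((1 + norm x) ^ (2 * DIM('a)))) \<partial>(lborel :: 'a measure)) \<le> ennreal (Q - 2)" "Q \<ge> 2"
    and \<phi>: "\<phi> \<in> borel_measurable lebesgue" "modular r \<phi> \<le> 1"
  shows "k \<ast> \<phi> \<in> borel_measurable lebesgue"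
    "modular p (\<lambda>x. (k \<ast> \<phi>) x / of_real (2 * A * G * (Q * exp (real (2 * DIM('a)) * c)))) \<le> 1"
proof -
  obtain \<psi> where [measurable]: "\<psi> \<in> borel_measurable lborel" and AE\<psi>: "AE x in lborel. \<phi> x = \<psi> x"
    using completion_ex_borel_measurable_complex[OF \<phi>(1)] by blast
  have [measurable]: "\<psi> \<in> borel_measurable borel" using \<open>\<psi> \<in> borel_measurable lborel\<close> by simp
  have conv: "(k \<ast> \<phi>) x = (\<integral>y. k (x - y) * \<psi> y \<partial>lborel)" for x
    by (rule convol_eq_lborel) (use AE\<psi> \<phi> in auto)
  show "k \<ast> \<phi> \<in> borel_measurable lebesgue"
  proof (rule measurable_completion)
    show "k \<ast> \<phi> \<in> borel_measurable lborel"
      unfolding conv[abs_def] by measurable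
  qed
  note r_bounds = exponents_bounds[OF r]
  define K where "K x = norm (k x) / A" for x
  have [measurable]: "K \<in> borel_measurable borel" unfolding K_def by measurable
  have K0: "0 \<le> K x" for x using A by (simp add: K_def)
  have KS: "K x \<le> S" for x using k_sup[of x] A by (simp add: K_def field_simps)
  have K1: "(\<integral>\<^sup>+x. ennreal (K x) \<partial>lborel) \<le> 1"
  proof -
    have "(\<integral>\<^sup>+x. ennreal (K x) \<partial>lborel) = (\<integral>\<^sup>+x. ennreal (1 / A) * ennreal (norm (k x)) \<partial>lborel)"
      using A by (intro nn_integral_cong) (simp add: K_def flip: ennreal_mult)
    also have "\<dots> = ennreal (1 / A) * (\<integral>\<^sup>+x. ennreal (norm (k x)) \<partial>lborel)"
      by (rule nn_integral_cmult) measurable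
    also have "\<dots> \<le> ennreal (1 / A) * ennreal A" by (rule mult_left_mono[OF k_int]) simp
    also have "\<dots> = 1" using A by (simp flip: ennreal_mult)
    finally show ?thesis .
  qed
  define f1 where "f1 y = (if norm (\<psi> y) > 1 then norm (\<psi> y) else 0)" for y
  define f2 where "f2 y = (if norm (\<psi> y) > 1 then 0 else norm (\<psi> y))" for y
  have [measurable]: "f1 \<in> borel_measurable borel" "f2 \<in> borel_measurable borel"
    unfolding f1_def f2_def by measurable
  have f0: "0 \<le> f1 y" "0 \<le> f2 y" "norm (\<psi> y) = f1 y + f2 y" for y
    by (auto simp: f1_def f2_def)
  have mod: "(\<integral>\<^sup>+y. \<omega> (r y) (norm (\<phi> y)) \<partial>lborel) \<le> 1"
    using \<phi>(2) unfolding modular_def nn_integral_completion .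
  have m1: "(\<integral>\<^sup>+y. \<omega> (exp_minus r) (f1 y) \<partial>lborel) \<le> 1"
  proof -
    have "(\<integral>\<^sup>+y. \<omega> (exp_minus r) (f1 y) \<partial>lborel) \<le> (\<integral>\<^sup>+y. \<omega> (r y) (norm (\<phi> y)) \<partial>lborel)"
      by (rule nn_integral_mono_AE, use AE\<psi> AE_exp_minus[of r] in eventually_elim)
        (auto simp: f1_def intro: omega_mono_exponent)
    with mod show ?thesis by simp
  qed
  have m2: "(\<integral>\<^sup>+y. \<omega> (exp_plus r) (f2 y) \<partial>lborel) \<le> 1"
  proof -
    have "(\<integral>\<^sup>+y. \<omega> (exp_plus r) (f2 y) \<partial>lborel) \<le> (\<integral>\<^sup>+y. \<omega> (r y) (norm (\<phi> y)) \<partial>lborel)"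
      by (rule nn_integral_mono_AE, use AE\<psi> AE_exp_plus[of r] in eventually_elim)
        (auto simp: f2_def intro: omega_antimono_exponent)
    with mod show ?thesis by simp
  qed
  define U1 where "U1 x = (\<integral>\<^sup>+y. ennreal (K (x - y) * f1 y) \<partial>lborel)" for x
  define U2 where "U2 x = (\<integral>\<^sup>+y. ennreal (K (x - y) * f2 y) \<partial>lborel)" for x
  have [measurable]: "U1 \<in> borel_measurable borel" "U2 \<in> borel_measurable borel"
    unfolding U1_def U2_def by measurable
  define V1 where "V1 x = enn2real (U1 x) / S powr (recip (exp_minus r) - recip P)" for x
  define V2 where "V2 x = enn2real (U2 x) / S powr (recip (exp_plus r) - recip P)" for x
  have [measurable]: "V1 \<in> borel_measurable borel" "V2 \<in> borel_measurable borel"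
    unfolding V1_def V2_def by measurable
  have U1: "U1 x < \<infinity>" "(\<integral>\<^sup>+x. \<omega> P (V1 x) \<partial>lborel) \<le> 1" for x
    unfolding U1_def V1_def
    by (rule nn_convolution_smoothing[OF _ _ K0 f0(1) K1 KS S r_bounds(1) order_trans[OF r_bounds(2) rP] m1]; simp)+
  have U2: "U2 x < \<infinity>" "(\<integral>\<^sup>+x. \<omega> P (V2 x) \<partial>lborel) \<le> 1" for x
    unfolding U2_def V2_def
    by (rule nn_convolution_smoothing[OF _ _ K0 f0(2) K1 KS S order_trans[OF r_bounds] rP m2]; simp)+
  have V0: "0 \<le> V1 x" "0 \<le> V2 x" for x by (simp_all add: V1_def V2_def)
  have G0: "G > 0"
    by (rule less_le_trans[OF _ G(1)]) (use S in simp)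
  define M where "M = real (2 * DIM('a))"
  define B where "B = Q * exp (M * c)"
  have B: "B > 0" using Q by (simp add: B_def)
  \<comment> \<open>A maximum instead of a sum, because \<open>\<omega> P\<close> of a maximum is at
    most the sum of the two values.\<close>
  have norm_conv: "norm ((k \<ast> \<phi>) x) \<le> 2 * A * G * max (V1 x) (V2 x)" for x
  proof -
    have "ennreal (norm ((k \<ast> \<phi>) x)) \<le> (\<integral>\<^sup>+y. ennreal (norm (k (x - y) * \<psi> y)) \<partial>lborel)"
    proof (cases "integrable lborel (\<lambda>y. k (x - y) * \<psi> y)")
      case True then show ?thesis unfolding conv by (rule integral_norm_bound_ennreal)
    next
      case False then show ?thesis unfolding conv by (simp add: not_integrable_integral_eq)
    qed
    also have "\<dots> = (\<integral>\<^sup>+y. ennreal A * (ennreal (K (x - y) * f1 y) + ennreal (K (x - y) * f2 y)) \<partial>lborel)"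
    proof (rule nn_integral_cong)
      fix y
      have "norm (k (x - y) * \<psi> y) = A * (K (x - y) * f1 y + K (x - y) * f2 y)"
        using A by (simp add: K_def norm_mult f0(3) field_simps)
      then show "ennreal (norm (k (x - y) * \<psi> y)) = ennreal A * (ennreal (K (x - y) * f1 y) + ennreal (K (x - y) * f2 y))"
        using A K0 f0 by (simp flip: ennreal_plus ennreal_mult)
    qed
    also have "\<dots> = ennreal A * (U1 x + U2 x)"
      unfolding U1_def U2_def by (subst nn_integral_cmult) (simp_all add: nn_integral_add)
    also have "\<dots> = ennreal (A * (enn2real (U1 x) + enn2real (U2 x)))"
      using U1(1)[of x] U2(1)[of x] A by (simp add: ennreal_mult)
    finally have "norm ((k \<ast> \<phi>) x) \<le> A * (enn2real (U1 x) + enn2real (U2 x))"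
      using A by (subst (asm) ennreal_le_iff) auto
    also have "enn2real (U1 x) = S powr (recip (exp_minus r) - recip P) * V1 x"
      using S by (simp add: V1_def)
    also have "enn2real (U2 x) = S powr (recip (exp_plus r) - recip P) * V2 x"
      using S by (simp add: V2_def)
    also have "A * (S powr (recip (exp_minus r) - recip P) * V1 x + S powr (recip (exp_plus r) - recip P) * V2 x)
        \<le> A * (G * max (V1 x) (V2 x) + G * max (V1 x) (V2 x))"
      using A G G0 V0 by (intro mult_left_mono add_mono mult_mono) auto
    finally show ?thesis by (simp add: algebra_simps)
  qed
  have "modular p (\<lambda>x. (k \<ast> \<phi>) x / of_real (2 * A * G * B)) = (\<integral>\<^sup>+x. \<omega> (p x) (norm ((k \<ast> \<phi>) x) / (2 * A * G * B)) \<partial>lborel)"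
    unfolding modular_def nn_integral_completion using A G0 B by (simp add: norm_divide norm_mult)
  also have "\<dots> \<le> (\<integral>\<^sup>+x. ennreal (1 / Q) * (\<omega> P (V1 x) + \<omega> P (V2 x) + ennreal (inverse ((1 + norm x) ^ (2 * DIM('a))))) \<partial>lborel)"
  proof (rule nn_integral_mono_AE, use pP in eventually_elim)
    case (elim x)
    let ?v = "max (V1 x) (V2 x)"
    have "exp 1 + norm x > 1" using exp_gt_one[of "1::real"] by (smt (verit) norm_ge_zero exp_gt_one)
    then have L: "ln (exp 1 + norm x) > 0" by simp
    have "norm ((k \<ast> \<phi>) x) / (2 * A * G * B) \<le> (2 * A * G * ?v) / (2 * A * G * B)"
      using norm_conv[of x] A G0 B by (intro divide_right_mono) auto
    also have "\<dots> = ?v / B" using A G0 by simp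
    finally have "\<omega> (p x) (norm ((k \<ast> \<phi>) x) / (2 * A * G * B)) \<le> \<omega> (p x) (?v / B)"
      using A G0 B by (intro omega_mono) auto
    also have "\<dots> \<le> ennreal (1 / Q) * (\<omega> P ?v + ennreal (exp (- M * ln (exp 1 + norm x))))"
      unfolding B_def by (rule omega_embedding[OF p1 elim _ _ _ c L log]) (use V0 Q in \<open>auto simp: M_def le_max_iff_disj\<close>)
    also have "\<dots> \<le> ennreal (1 / Q) * (\<omega> P (V1 x) + \<omega> P (V2 x) + ennreal (inverse ((1 + norm x) ^ (2 * DIM('a)))))"
    proof (intro mult_left_mono add_mono)
      show "\<omega> P ?v \<le> \<omega> P (V1 x) + \<omega> P (V2 x)" by (auto simp: max_def intro: add_increasing add_increasing2)
      \<comment> \<open>With \<open>M = 2n\<close> the error term of the embedding is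
        \<open>(e + |x|)^(-2n)\<close>, which lies below the integrable weight.\<close>
      have "exp (M * ln (exp 1 + norm x)) = (exp 1 + norm x) ^ (2 * DIM('a))"
        unfolding M_def exp_of_nat_mult using \<open>exp 1 + norm x > 1\<close> by simp
      then have "exp (- M * ln (exp 1 + norm x)) = inverse ((exp 1 + norm x) ^ (2 * DIM('a)))"
        by (simp add: exp_minus)
      also have "\<dots> \<le> inverse ((1 + norm x) ^ (2 * DIM('a)))"
        by (intro le_imp_inverse_le power_mono zero_less_power) (auto simp: add_pos_nonneg)
      finally show "ennreal (exp (- M * ln (exp 1 + norm x))) \<le> ennreal (inverse ((1 + norm x) ^ (2 * DIM('a))))"
        by (rule ennreal_leI)
    qed auto
    finally show ?case .
  qed
  also have "\<dots> = ennreal (1 / Q) * ((\<integral>\<^sup>+x. \<omega> P (V1 x) \<partial>lborel) + (\<integral>\<^sup>+x. \<omega> P (V2 x) \<partial>lborel)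
      + (\<integral>\<^sup>+x. ennreal (inverse ((1 + norm x) ^ (2 * DIM('a)))) \<partial>(lborel :: 'a measure)))"
    by (subst nn_integral_cmult) (simp_all add: nn_integral_add)
  also have "\<dots> \<le> ennreal (1 / Q) * (1 + 1 + ennreal (Q - 2))"
    by (intro mult_left_mono add_mono U1 U2 Q) auto
  also have "\<dots> = ennreal (1 / Q) * ennreal (1 + 1 + (Q - 2))"
    using Q(2) by (simp only: ennreal_plus ennreal_1 zero_le_one add_nonneg_nonneg diff_ge_0_iff_ge)
  also have "\<dots> = 1"
    using Q(2) by (simp flip: ennreal_mult)
  finally show "modular p (\<lambda>x. (k \<ast> \<phi>) x / of_real (2 * A * G * (Q * exp (real (2 * DIM('a)) * c)))) \<le> 1"
    by (simp add: B_def M_def)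
qed

text \<open>The correction term is nonnegative. Both inequalities point in the direction that
  enlarges \<open>t\<close> to the power \<open>-n \<sigma>(t) / (2\<alpha>)\<close>, the base being
  at most 1 in the first and above 1 in the second.\<close>

lemma decay_exponent_bounds:
  fixes p r :: "'a::euclidean_space \<Rightarrow> ennreal"
  defines "a \<equiv> recip (exp_minus r)" and "b \<equiv> recip (exp_plus r)" and "c \<equiv> recip (exp_infty p)"
  assumes "0 \<le> c" "c \<le> b" "b \<le> a" "a \<le> 1"
  shows "t \<le> 1 \<Longrightarrow> a - c \<le> decay_exponent p r t" "t > 1 \<Longrightarrow> decay_exponent p r t \<le> b - c"
proof -
  \<comment> \<open>The denominators are nonnegative by \<open>a \<le> 1\<close> and
    \<open>b \<le> 1\<close>. They vanish only if \<open>c = 0\<close>, when \<open>e = 0\<close>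
    and the bracket is 1 as prescribed.\<close>
  define e where "e = c * ((a - b) / ((1 + c - a) * (1 + c - b)))"
  have e: "0 \<le> e"
    unfolding e_def using assms(4-) by (intro mult_nonneg_nonneg divide_nonneg_nonneg) auto
  have eq: "decay_exponent p r t = (if t \<le> 1 then (a - c) * (1 + e) else (b - c) * (1 - e))"
    by (simp add: decay_exponent_def Let_def a_def b_def c_def e_def)
  show "a - c \<le> decay_exponent p r t" if "t \<le> 1"
    using that mult_left_mono[OF e, of "a - c"] assms(4-) by (simp add: eq algebra_simps)
  show "decay_exponent p r t \<le> b - c" if "t > 1"
    using that mult_left_mono[OF e, of "b - c"] assms(4-) by (simp add: eq algebra_simps)
qed

text \<open>The kernel at time \<open>t\<close> enters \<open>modular_convol_le_one\<close> with
  \<open>A = D t^(-\<kappa>/(2\<alpha>))\<close> and \<open>S = t^(-n/(2\<alpha>))\<close>. The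
  constants \<open>D\<close>, \<open>Q\<close> and \<open>c\<close> are independent of
  \<open>t\<close>, hence so is \<open>C\<close>.\<close>

theorem symbol_kernel_var_norm_bound:
  fixes \<alpha> \<kappa> :: real and p r :: "'a::euclidean_space \<Rightarrow> ennreal"
  assumes \<alpha>: "\<alpha> > 0" and \<kappa>: "\<kappa> \<ge> 0" and p: "p \<in> log_exponents" and r: "r \<in> exponents"
    and rp: "exp_plus r \<le> exp_infty p" and p_inf: "exp_plus p = exp_infty p"
  obtains C :: real where "C > 0"
    "\<And>t \<phi>. t > 0 \<Longrightarrow> \<phi> \<in> var_Lp r \<Longrightarrow> symbol_kernel \<kappa> \<alpha> t \<ast> \<phi> \<in> var_Lp p \<and>
      var_norm p (symbol_kernel \<kappa> \<alpha> t \<ast> \<phi>) \<le>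
        ennreal (C * t powr (- \<kappa> / (2 * \<alpha>) - real DIM('a) * decay_exponent p r t / (2 * \<alpha>))) * var_norm r \<phi>"
proof -
  define P where "P = exp_infty p"
  obtain c where c: "c > 0" "\<And>x. recip (p x) - recip P \<le> c / ln (exp 1 + norm x)"
    unfolding P_def using log_exponents_exp_infty[OF p] by blast
  obtain D where D: "D > 0"
    "\<And>t x. t > 0 \<Longrightarrow> norm (symbol_kernel \<kappa> \<alpha> t (x :: 'a)) \<le> D * t powr (- \<kappa> / (2 * \<alpha>)) * t powr (- (real DIM('a) / (2 * \<alpha>)))"
    "\<And>t. t > 0 \<Longrightarrow> (\<integral>\<^sup>+x. ennreal (norm (symbol_kernel \<kappa> \<alpha> t x)) \<partial>(lborel :: 'a measure)) \<le> ennreal (D * t powr (- \<kappa> / (2 * \<alpha>)))"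
    using symbol_kernel_bounds[OF \<alpha> \<kappa>, where 'a='a] by blast
  obtain H where H: "(\<integral>\<^sup>+x. ennreal (inverse ((1 + norm x) ^ (2 * DIM('a)))) \<partial>(lborel :: 'a measure)) = ennreal H" "H \<ge> 0"
    using nn_integral_weight_finite[where 'a='a] 
    by (cases "(\<integral>\<^sup>+x. ennreal (inverse ((1 + norm x) ^ (2 * DIM('a)))) \<partial>(lborel :: 'a measure))") auto
  define Q where "Q = H + 2"
  define C where "C = 2 * D * (Q * exp (real (2 * DIM('a)) * c))"
  have C: "C > 0" using D(1) H by (simp add: C_def Q_def)
  have p1: "1 \<le> p x" for x using p by (auto simp: log_exponents_def exponents_def)
  have pP: "AE x in lborel. p x \<le> P" using AE_exp_plus[of p] by (simp add: p_inf P_def)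
  note r_bounds = exponents_bounds[OF r]
  have order: "0 \<le> recip P" "recip P \<le> recip (exp_plus r)" "recip (exp_plus r) \<le> recip (exp_minus r)" "recip (exp_minus r) \<le> 1"
    using recip_antimono[OF order_trans[OF r_bounds] rp] recip_antimono[OF r_bounds] recip_bounds[OF r_bounds(1)]
    by (auto simp: P_def)
  show ?thesis
  proof (rule that[OF C])
    fix t :: real and \<phi> :: "'a \<Rightarrow> complex" assume t: "t > 0" and \<phi>: "\<phi> \<in> var_Lp r"
    define \<sigma> where "\<sigma> = decay_exponent p r t"
    define S where "S = t powr (- (real DIM('a) / (2 * \<alpha>)))"
    define T where "T = t powr (- \<kappa> / (2 * \<alpha>))"
    define G where "G = t powr (- (real DIM('a) * \<sigma> / (2 * \<alpha>)))"
    have pos: "S > 0" "D * T > 0" "G > 0" using t D(1) by (simp_all add: S_def T_def G_def)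
    define n where "n = real DIM('a) / (2 * \<alpha>)"
    have n: "n > 0" using \<alpha> by (simp add: n_def)
    have G_eq: "G = t powr (- (n * \<sigma>))" by (simp add: G_def n_def)
    have S_powr: "S powr u = t powr (- (n * u))" for u by (simp add: S_def n_def powr_powr)
    \<comment> \<open>Used at the two end points of the range of \<open>u\<close>, which are the
      exponents from \<open>r^+\<close> and \<open>r^-\<close>. For \<open>t \<le> 1\<close> the
      upper end is the worst case, for \<open>t > 1\<close> the lower one, and
      \<open>\<sigma>\<close> lies beyond it.\<close>
    have le_G: "S powr u \<le> G" if "recip (exp_plus r) - recip P \<le> u" "u \<le> recip (exp_minus r) - recip P" for u
    proof (cases "t \<le> 1")
      case True
      then have "u \<le> \<sigma>"
        using decay_exponent_bounds(1)[of p r t] order that by (simp add: \<sigma>_def P_def)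
      then show ?thesis unfolding S_powr G_eq using True t n by (intro powr_mono') auto
    next
      case False
      then have "\<sigma> \<le> u"
        using decay_exponent_bounds(2)[of p r t] order that by (simp add: \<sigma>_def P_def)
      then show ?thesis unfolding S_powr G_eq using False t n by (intro powr_mono) auto
    qed
    have \<Lambda>: "2 * (D * T) * G * (Q * exp (real (2 * DIM('a)) * c)) = C * t powr (- \<kappa> / (2 * \<alpha>) - real DIM('a) * decay_exponent p r t / (2 * \<alpha>))"
      using t by (simp add: C_def T_def G_def \<sigma>_def powr_diff powr_minus_divide)
    have unit: "symbol_kernel \<kappa> \<alpha> t \<ast> \<psi> \<in> borel_measurable lebesgue \<and>
       modular p (\<lambda>x. (symbol_kernel \<kappa> \<alpha> t \<ast> \<psi>) x / of_real (2 * (D * T) * G * (Q * exp (real (2 * DIM('a)) * c)))) \<le> 1"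
      if "\<psi> \<in> borel_measurable lebesgue" "modular r \<psi> \<le> 1" for \<psi>
    proof -
      note bound = modular_convol_le_one[of "symbol_kernel \<kappa> \<alpha> t" "D * T" S r P p c G Q \<psi>]
      show ?thesis
        by (intro conjI bound)
          (use pos D(2,3)[OF t] r rp p1 pP c that H le_G order in \<open>auto simp: S_def T_def Q_def P_def\<close>)
    qed
    have "2 * (D * T) * G * (Q * exp (real (2 * DIM('a)) * c)) > 0"
      unfolding \<Lambda> using C t by simp
    from var_norm_bound_by_homogeneity[OF r this \<phi> unit]
    show "symbol_kernel \<kappa> \<alpha> t \<ast> \<phi> \<in> var_Lp p \<and>
      var_norm p (symbol_kernel \<kappa> \<alpha> t \<ast> \<phi>) \<le>
        ennreal (C * t powr (- \<kappa> / (2 * \<alpha>) - real DIM('a) * decay_exponent p r t / (2 * \<alpha>))) * var_norm r \<phi>"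
      unfolding \<Lambda> by blast
  qed
qed

theorem theorem4p3:
  fixes \<alpha> \<kappa> :: real and p r :: "'a::euclidean_space \<Rightarrow> ennreal"
  assumes "\<alpha> > 0" and "\<kappa> > 0"
    and "p \<in> log_exponents" and "r \<in> exponents"
    and "(exp_plus r \<le> exp_plus p \<and> exp_plus p = exp_infty p \<and> exp_infty p < \<infinity>) \<or>
         (exp_plus p = exp_infty p \<and> exp_infty p = \<infinity>)"
  shows "\<exists>C::real>0. \<forall>t::real>0. \<forall>\<phi>\<in>var_Lp r.
    heat_kernel \<alpha> t \<ast> \<phi> \<in> var_Lp p \<and>
    var_norm p (heat_kernel \<alpha> t \<ast> \<phi>) \<le>
      ennreal (C * t powr (- (real DIM('a) * decay_exponent p r t / (2 * \<alpha>)))) * var_norm r \<phi> \<and>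
    frac_laplacian (\<kappa> / 2) (heat_kernel \<alpha> t) \<ast> \<phi> \<in> var_Lp p \<and>
    var_norm p (frac_laplacian (\<kappa> / 2) (heat_kernel \<alpha> t) \<ast> \<phi>) \<le>
      ennreal (C * t powr (- \<kappa> / (2 * \<alpha>) - real DIM('a) * decay_exponent p r t / (2 * \<alpha>)))
        * var_norm r \<phi>"
proof -
  \<comment> \<open>In the second alternative the bound on \<open>exp_plus r\<close> is trivial,
    since \<open>exp_infty p = \<infinity>\<close>.\<close>
  have rp: "exp_plus r \<le> exp_infty p" and p_inf: "exp_plus p = exp_infty p"
    using assms(5) by (auto simp: top_greatest)
  have mono: "x \<le> ennreal (C * u) * v"
    if "x \<le> ennreal (C' * u) * v" "C' \<le> C" "u \<ge> 0" for x v :: ennreal and C C' u :: real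
    using that by (meson order_trans mult_right_mono ennreal_leI zero_le)
  \<comment> \<open>Estimate (1) is the case \<open>\<kappa> = 0\<close> of the common
    bound.\<close>
  obtain C0 where C0: "C0 > 0"
    "\<And>t \<phi>. t > 0 \<Longrightarrow> \<phi> \<in> var_Lp r \<Longrightarrow> symbol_kernel 0 \<alpha> t \<ast> \<phi> \<in> var_Lp p \<and>
      var_norm p (symbol_kernel 0 \<alpha> t \<ast> \<phi>) \<le>
        ennreal (C0 * t powr (- 0 / (2 * \<alpha>) - real DIM('a) * decay_exponent p r t / (2 * \<alpha>))) * var_norm r \<phi>"
    using symbol_kernel_var_norm_bound[OF assms(1) order_refl assms(3,4) rp p_inf] by blast
  obtain C1 where C1: "C1 > 0"
    "\<And>t \<phi>. t > 0 \<Longrightarrow> \<phi> \<in> var_Lp r \<Longrightarrow> symbol_kernel \<kappa> \<alpha> t \<ast> \<phi> \<in> var_Lp p \<and>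
      var_norm p (symbol_kernel \<kappa> \<alpha> t \<ast> \<phi>) \<le>
        ennreal (C1 * t powr (- \<kappa> / (2 * \<alpha>) - real DIM('a) * decay_exponent p r t / (2 * \<alpha>))) * var_norm r \<phi>"
    using symbol_kernel_var_norm_bound[OF assms(1) less_imp_le[OF assms(2)] assms(3,4) rp p_inf] by blast
  show ?thesis
  proof (intro exI[of _ "max C0 C1"] conjI allI impI ballI)
    show "max C0 C1 > 0" using C0(1) by simp
    fix t :: real and \<phi> assume t: "t > 0" and \<phi>: "\<phi> \<in> var_Lp r"
    note heat = heat_kernel_eq_symbol_kernel and frac = frac_laplacian_heat_kernel[OF assms(1) t]
    show "heat_kernel \<alpha> t \<ast> \<phi> \<in> var_Lp p"
      using C0(2)[OF t \<phi>] unfolding heat ..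
    show "frac_laplacian (\<kappa> / 2) (heat_kernel \<alpha> t) \<ast> \<phi> \<in> var_Lp p"
      using C1(2)[OF t \<phi>] unfolding frac ..
    show "var_norm p (heat_kernel \<alpha> t \<ast> \<phi>) \<le>
      ennreal (max C0 C1 * t powr (- (real DIM('a) * decay_exponent p r t / (2 * \<alpha>)))) * var_norm r \<phi>"
      unfolding heat by (rule mono[of _ C0]) (use C0(2)[OF t \<phi>] in simp_all)
    show "var_norm p (frac_laplacian (\<kappa> / 2) (heat_kernel \<alpha> t) \<ast> \<phi>) \<le>
      ennreal (max C0 C1 * t powr (- \<kappa> / (2 * \<alpha>) - real DIM('a) * decay_exponent p r t / (2 * \<alpha>))) * var_norm r \<phi>"
      unfolding frac by (rule mono[of _ C1]) (use C1(2)[OF t \<phi>] in simp_all)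
  qed
qed

end
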